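(* Let $r,s\ge 0$ be integers, $P=[0,r]\times[0,s]$, let $(i,j)\in P$, and fix $k\in[0,r+s+1]$. Let $\rho_B^{k+1}(i,j)$ denote the rational function in the variables $x_{u,v}$ associated to the poset element $(i,j)$ after $k+1$ applications of the birational rowmotion map to the generic initial labeling of $P$. Set $M=[k-i]_+ + [k-j]_+$. (a) When $M\le k$, $$\rho_B^{k+1}(i,j)=\mu^{([k-j]_+,\,[k-i]_+)}\left(\frac{\varphi_{k-M}(i-k+M,\;j-k+M)}{\varphi_{k-M+1}(i-k+M,\;j-k+M)}\right).$$ (b) When $M\ge k$, $$\rho_B^{k+1}(i,j)=\frac{1}{\rho_B^{k-i-j}(r-i,\,s-j)},$$ where $\rho_B^{k-i-j}(r-i,s-j)$ is well-defined by part (a).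
   Context: For an integer $n\ge 0$, $[0,n]=\{0,1,\dots,n\}$, and $[\alpha]_+=\max\{\alpha,0\}$. $P=[0,r]\times[0,s]$ is ordered componentwise (product of two chains); $\widehat P$ is $P$ with a new global minimum $\hat 0$ and a new global maximum $\hat 1$ adjoined. Write $w\lessdot v$ when $v$ covers $w$ in $\widehat P$. Birational rowmotion. Let $\mathbb K$ be a field. For $v\in P$ the birational toggle $T_v:\mathbb K^{\widehat P}\dashrightarrow\mathbb K^{\widehat P}$ is the rational map with $(T_vf)(y)=f(y)$ for $y\ne v$ and $$(T_vf)(v)=\frac{1}{f(v)}\cdot\frac{\sum_{w\in\widehat P,\,w\lessdot v}f(w)}{\sum_{z\in\widehat P,\,z\gtrdot v}1/f(z)}.$$ Birational rowmotion is $\rho_B=T_{v_1}T_{v_2}\cdots T_{v_n}$ where $v_1,\dots,v_n$ is any linear extension of $P$ (so toggling is performed at each element of $P$ from top to bottom). The generic initial labeling assigns an indeterminate $x_{i,j}=x_{ij}$ to each $(i,j)\in P$ and the label $1$ to $\hat 0$ and $\hat 1$. $\rho_B^{n}(i,j)$ denotes the label of $(i,j)$ after $n$ applications of $\rho_B$ to this labeling, a rational function in the $x_{u,v}$; in particular $\rho_B^0(i,j)=x_{ij}$. The $A$-variables. For $(i,j)\in P$ put $A_{ij}=A_{i,j}=\dfrac{x_{i,j-1}+x_{i-1,j}}{x_{ij}}$ for $i,j\ge1$, $A_{i0}=x_{i-1,0}/x_{i,0}$ for $i\ge 1$, $A_{0j}=x_{0,j-1}/x_{0,j}$ for $j\ge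 1$, and $A_{00}=1/x_{00}$. The polynomials $\varphi_k(m,n)$. A lattice path in $P$ is a sequence $v_1,\dots,v_\ell$ of elements of $P$ with each difference $v_t-v_{t-1}\in\{(1,0),(0,1)\}$ for $2\le t\le \ell$; a family of lattice paths is non-intersecting if no two of them share a vertex. For nonnegative integers $k,m,n$ with $k\le\min\{r-m,s-n\}+1$, let $$H^k_{(m,n)}=\{(u,v)\in P: (u,v)\ge(m,n),\ m+n+k-1\le u+v\le r+s-k+1\}.$$ Let $s_\ell=(m+k-\ell,\,n+\ell-1)$ and $t_\ell=(r-\ell+1,\,s-k+\ell)$ for $1\le\ell\le k$ (the $k$ minimal and $k$ maximal elements of $H^k_{(m,n)}$; when $k=0$ there are no $s_\ell$ or $t_\ell$). Let $S_k(m,n)$ be the set of families $\mathcal L=\{L_1,\dots,L_k\}$ of non-intersecting lattice paths in $H^k_{(m,n)}$ from $\{s_1,\dots,s_k\}$ to $\{t_1,\dots,t_k\}$ ($S_0(m,n)$ consists of the empty family only). Define $$\varphi_k(m,n)=\sum_{\mathcal L\in S_k(m,n)}\ \prod_{\substack{(u,v)\in H^k_{(m,n)}\\(u,v)\notin L_1\cup\dots\cup L_k}}A_{uv},$$ with empty products equal to $1$. Shift. $\mu^{(a,b)}$ is the transformation of rational functions in the $A_{u,v}$ which replaces every $A_{u,v}$ by $A_{u-a,v-b}$. *)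

theory Defs
  imports
    "HOL-Library.Poly_Mapping"
    "HOL-Library.Product_Lexorder"
    "HOL-Computational_Algebra.Fraction_Field"
begin

section \<open>The poset\<close>

text \<open>
  Coordinates are integers, so that differences are never truncated. The lexicographic order on
  pairs from \<^theory>\<open>HOL-Library.Product_Lexorder\<close> is only needed to make the polynomial ring
  below an instance of \<^class>\<open>idom\<close>; the componentwise order of the poset is \<open>le_pt\<close>.
\<close>

definition rect :: "int \<Rightarrow> int \<Rightarrow> (int \<times> int) set" where
  "rect r s = {0..r} \<times> {0..s}"

definition le_pt :: "int \<times> int \<Rightarrow> int \<times> int \<Rightarrow> bool" where
  "le_pt p q \<longleftrightarrow> fst p \<le> fst q \<and> snd p \<le> snd q"

definition less_pt :: "int \<times> int \<Rightarrow> int \<times> int \<Rightarrow> bool" where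
  "less_pt p q \<longleftrightarrow> le_pt p q \<and> p \<noteq> q"

datatype hat = Bot | El "int \<times> int" | Top

definition hat_poset :: "int \<Rightarrow> int \<Rightarrow> hat set" where
  "hat_poset r s = {Bot, Top} \<union> El ` rect r s"

fun less_hat :: "hat \<Rightarrow> hat \<Rightarrow> bool" where
  "less_hat Bot y = (y \<noteq> Bot)"
| "less_hat (El p) (El q) = less_pt p q"
| "less_hat (El p) Top = True"
| "less_hat (El p) Bot = False"
| "less_hat Top y = False"

text \<open>\<open>covered_by r s w v\<close>: the element \<open>v\<close> covers \<open>w\<close>.\<close>

definition covered_by :: "int \<Rightarrow> int \<Rightarrow> hat \<Rightarrow> hat \<Rightarrow> bool" where
  "covered_by r s w v \<longleftrightarrow> w \<in> hat_poset r s \<and> v \<in> hat_poset r s \<and> less_hat w v \<and>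
     \<not> (\<exists>u\<in>hat_poset r s. less_hat w u \<and> less_hat u v)"

definition linear_extension :: "int \<Rightarrow> int \<Rightarrow> (int \<times> int) list \<Rightarrow> bool" where
  "linear_extension r s vs \<longleftrightarrow> distinct vs \<and> set vs = rect r s \<and>
     (\<forall>a<length vs. \<forall>b<length vs. less_pt (vs ! a) (vs ! b) \<longrightarrow> a < b)"


section \<open>Birational rowmotion\<close>

text \<open>
  The maps are defined on labelings over any field, with the convention \<open>x / 0 = 0\<close> outside the
  domain of definition of the rational map. They are only applied to the generic labeling, over
  the field of rational functions. Labelings are total functions on \<^typ>\<open>hat\<close>; values outside
  \<^const>\<open>hat_poset\<close> are never used.
\<close>

definition toggle :: "int \<Rightarrow> int \<Rightarrow> int \<times> int \<Rightarrow> (hat \<Rightarrow> 'f::field) \<Rightarrow> hat \<Rightarrow> 'f" where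
  "toggle r s v f = f(El v :=
     1 / f (El v) *
       ((\<Sum>w | covered_by r s w (El v). f w) / (\<Sum>z | covered_by r s (El v) z. 1 / f z)))"

text \<open>For a list \<open>[v\<^sub>1, \<dots>, v\<^sub>n]\<close> this is the composition of the toggles at
  \<open>v\<^sub>1, \<dots>, v\<^sub>n\<close> in which the toggle at \<open>v\<^sub>n\<close> is applied first.\<close>

definition toggles ::
    "int \<Rightarrow> int \<Rightarrow> (int \<times> int) list \<Rightarrow> (hat \<Rightarrow> 'f::field) \<Rightarrow> hat \<Rightarrow> 'f" where
  "toggles r s vs f = foldr (toggle r s) vs f"

text \<open>
  Integer powers of rowmotion, where \<open>vs\<close> is a linear extension. Each toggle is a birational
  involution, so the inverse of rowmotion is the composition of the toggles in reverse order.
\<close>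

definition rowmotion_power ::
    "int \<Rightarrow> int \<Rightarrow> (int \<times> int) list \<Rightarrow> int \<Rightarrow> (hat \<Rightarrow> 'f::field) \<Rightarrow> hat \<Rightarrow> 'f" where
  "rowmotion_power r s vs n =
     (if n \<ge> 0 then toggles r s vs ^^ nat n else toggles r s (rev vs) ^^ nat (- n))"

text \<open>
  \<^typ>\<open>(int \<times> int \<Rightarrow>\<^sub>0 nat) \<Rightarrow>\<^sub>0 'k\<close> is the polynomial ring over \<open>'k\<close> with one indeterminate for
  each pair of integers: monomials are finitely supported exponent functions, polynomials are
  finitely supported functions from monomials to coefficients.
\<close>

type_synonym 'k ratfun = "((int \<times> int \<Rightarrow>\<^sub>0 nat) \<Rightarrow>\<^sub>0 'k) fract"

definition X :: "int \<times> int \<Rightarrow> 'k::field ratfun" where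
  "X p = Fract (Poly_Mapping.single (Poly_Mapping.single p 1) 1) 1"

fun generic_labeling :: "hat \<Rightarrow> 'k::field ratfun" where
  "generic_labeling Bot = 1"
| "generic_labeling (El p) = X p"
| "generic_labeling Top = 1"

definition rho ::
    "int \<Rightarrow> int \<Rightarrow> (int \<times> int) list \<Rightarrow> int \<Rightarrow> int \<times> int \<Rightarrow> 'k::field ratfun" where
  "rho r s vs n p = rowmotion_power r s vs n generic_labeling (El p)"


section \<open>The $A$-variables\<close>

text \<open>Only the values at pairs of nonnegative integers are meaningful.\<close>

definition A_var :: "int \<times> int \<Rightarrow> 'k::field ratfun" where
  "A_var = (\<lambda>(i, j).
     if i \<ge> 1 \<and> j \<ge> 1 then (X (i, j - 1) + X (i - 1, j)) / X (i, j)
     else if i \<ge> 1 \<and> j = 0 then X (i - 1, 0) / X (i, 0)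
     else if i = 0 \<and> j \<ge> 1 then X (0, j - 1) / X (0, j)
     else if i = 0 \<and> j = 0 then 1 / X (0, 0)
     else 0)"


section \<open>The polynomials $\varphi_k(m,n)$ and the shift\<close>

definition lattice_path :: "(int \<times> int) list \<Rightarrow> bool" where
  "lattice_path w \<longleftrightarrow> w \<noteq> [] \<and>
     (\<forall>t. Suc t < length w \<longrightarrow>
        (fst (w ! Suc t) - fst (w ! t), snd (w ! Suc t) - snd (w ! t)) \<in> {(1, 0), (0, 1)})"

definition region :: "int \<Rightarrow> int \<Rightarrow> int \<Rightarrow> int \<Rightarrow> int \<Rightarrow> (int \<times> int) set" where
  "region r s k m n = {(u, v) \<in> rect r s. le_pt (m, n) (u, v) \<and>
     m + n + k - 1 \<le> u + v \<and> u + v \<le> r + s - k + 1}"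

definition sources :: "int \<Rightarrow> int \<Rightarrow> int \<Rightarrow> (int \<times> int) set" where
  "sources k m n = (\<lambda>l. (m + k - l, n + l - 1)) ` {1..k}"

definition sinks :: "int \<Rightarrow> int \<Rightarrow> int \<Rightarrow> (int \<times> int) set" where
  "sinks r s k = (\<lambda>l. (r - l + 1, s - k + l)) ` {1..k}"

definition path_families ::
    "int \<Rightarrow> int \<Rightarrow> int \<Rightarrow> int \<Rightarrow> int \<Rightarrow> (int \<times> int) list set set" where
  "path_families r s k m n = {L. finite L \<and> int (card L) = k \<and>
     (\<forall>w\<in>L. lattice_path w \<and> set w \<subseteq> region r s k m n) \<and>
     (\<forall>w\<in>L. \<forall>w'\<in>L. w \<noteq> w' \<longrightarrow> set w \<inter> set w' = {}) \<and>
     hd ` L = sources k m n \<and> last ` L = sinks r s k}"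

text \<open>
  An expression in the variables \<open>A\<^bsub>uv\<^esub>\<close> is represented by the function sending a family of
  values for these variables to the value of the expression. Replacing each \<open>A\<^bsub>uv\<^esub>\<close> by
  \<open>A\<^bsub>u-a,v-b\<^esub>\<close> then amounts to evaluation at the shifted family.
\<close>

type_synonym 'f A_expr = "(int \<times> int \<Rightarrow> 'f) \<Rightarrow> 'f"

definition phi :: "int \<Rightarrow> int \<Rightarrow> int \<Rightarrow> int \<Rightarrow> int \<Rightarrow> 'f::field A_expr" where
  "phi r s k m n A =
     (\<Sum>L\<in>path_families r s k m n. \<Prod>p\<in>region r s k m n - (\<Union>w\<in>L. set w). A p)"

definition mu :: "int \<Rightarrow> int \<Rightarrow> 'f A_expr \<Rightarrow> 'f A_expr" where
  "mu a b F = (\<lambda>A. F (\<lambda>(u, v). A (u - a, v - b)))"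

definition pos_part :: "int \<Rightarrow> int" where
  "pos_part x = max x 0"

definition M_val :: "int \<Rightarrow> int \<Rightarrow> int \<Rightarrow> int" where
  "M_val k i j = pos_part (k - i) + pos_part (k - j)"

end

theory Submission
  imports "Jordan_Normal_Form.Determinant" Defs
begin

text \<open>
  Write \<open>B = 1 / A\<close>. By the Lindstroem-Gessel-Viennot lemma, \<open>\<phi>\<^sub>k(m, n)\<close> is the product of the
  \<open>A\<^bsub>uv\<^esub>\<close> over the hexagon \<open>H\<close> times a \<open>k \<times> k\<close> determinant of generating functions of lattice paths
  with vertex weights \<open>B\<close>. The linear relations between paths starting (or ending) at neighbouring
  points turn Cramer's rule into quadratic octahedron relations between these determinants. The
  quotients of \<open>\<phi>\<close>'s in the theorem therefore satisfy the recurrence that defines birational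
  rowmotion, with the right initial values. No denominator vanishes, because distinct path families
  give distinct squarefree monomials and these are linearly independent in any characteristic.
  For \<open>k = i + j\<close> the formula reads \<open>\<rho>\<^sup>i\<^sup>+\<^sup>j\<^sup>+\<^sup>1(i, j) = 1 / x\<^bsub>r-i,s-j\<^esub>\<close>, and since inverting all labels
  and rotating the rectangle is a symmetry of the recurrence, this propagates to the reciprocity (b).
\<close>

section \<open>Independence of the $A$-variables\<close>

text \<open>The form of the result becomes clear when the rectangle is allowed to vary. Shifting the
  arguments turns \<open>phi\<close> into \<open>Phi\<close> on a smaller rectangle: as
  \<open>k\<close> grows, the lower sides first move to the axes, and once one of them has arrived,
  an upper side begins to recede. The signs of \<open>k - i\<close> and \<open>k - j\<close> thus
  give four regimes. This is why one recurrence calls for several octahedron relations: at the lower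
  corner, along two opposite sides, or at the upper corner. The boundary data of rowmotion (missing
  covers, the labels 1 of \<open>Bot\<close> and \<open>Top\<close>) turn into values 0 and 1 of the
  same family of determinants.

  Division is total, so the symmetry behind (b) costs nothing forwards in time. Negative powers,
  however, are iterates of the reversed composition of toggles. For \<open>k < i + j\<close> the
  reciprocity has to be propagated backwards in time, and there nonzero labels matter; they come
  from the linear independence of the monomials.\<close>

lemma lookup_single_times_shift:
  fixes b :: "'a::cancel_comm_monoid_add \<Rightarrow>\<^sub>0 'k::semiring_1"
  shows "Poly_Mapping.lookup (Poly_Mapping.single m 1 * b) (m + n) = Poly_Mapping.lookup b n"
proof -
  have "Poly_Mapping.lookup (Poly_Mapping.single m 1 * b) (m + n) =
     (\<Sum>l. (\<Sum>q. Poly_Mapping.lookup b q when m + n = l + q) when m = l)"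
    unfolding lookup_mult lookup_single by (intro Sum_any.cong) (auto simp: when_def)
  also have "\<dots> = (\<Sum>q. Poly_Mapping.lookup b q when m + n = m + q)" by simp
  also have "\<dots> = (\<Sum>q. Poly_Mapping.lookup b q when n = q)" by simp
  also have "\<dots> = Poly_Mapping.lookup b n" by simp
  finally show ?thesis .
qed

section \<open>Subfields generated by sets of indeterminates\<close>

definition poly_in :: "'v set \<Rightarrow> (('v \<Rightarrow>\<^sub>0 nat) \<Rightarrow>\<^sub>0 'k::field) set" where
  "poly_in V = {a. \<forall>m\<in>Poly_Mapping.keys a. Poly_Mapping.keys m \<subseteq> V}"

lemma poly_in_0 [simp]: "0 \<in> poly_in V"
  and poly_in_1 [simp]: "1 \<in> poly_in V"
  by (auto simp: poly_in_def)

lemma poly_in_add: "a \<in> poly_in V \<Longrightarrow> b \<in> poly_in V \<Longrightarrow> a + b \<in> poly_in V"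
  using keys_add[of a b] by (auto simp: poly_in_def)

lemma poly_in_uminus: "a \<in> poly_in V \<Longrightarrow> - a \<in> poly_in V"
  by (auto simp: poly_in_def in_keys_iff)

lemma poly_in_mult:
  assumes "a \<in> poly_in V" "b \<in> poly_in V" shows "a * b \<in> poly_in V"
proof -
  have "Poly_Mapping.keys m \<subseteq> V" if "m \<in> Poly_Mapping.keys (a * b)" for m
  proof -
    from that keys_mult[of a b] obtain x y where
      "m = x + y" "x \<in> Poly_Mapping.keys a" "y \<in> Poly_Mapping.keys b" by auto
    then show ?thesis using assms keys_add[of x y] unfolding poly_in_def by blast
  qed
  then show ?thesis by (auto simp: poly_in_def)
qed

text \<open>Membership asks for one representation over \<open>V\<close>; other representations of
  the same fraction may involve further indeterminates.\<close>

definition ratfun_in :: "(int \<times> int) set \<Rightarrow> 'k::field ratfun set" where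
  "ratfun_in V = {Fract a b | a b. a \<in> poly_in V \<and> b \<in> poly_in V \<and> b \<noteq> 0}"

lemma ratfun_in_0 [simp]: "0 \<in> ratfun_in V"
  and ratfun_in_1 [simp]: "1 \<in> ratfun_in V"
  unfolding ratfun_in_def Zero_fract_def One_fract_def by fastforce+

lemma ratfun_in_add: "f \<in> ratfun_in V \<Longrightarrow> g \<in> ratfun_in V \<Longrightarrow> f + g \<in> ratfun_in V"
  unfolding ratfun_in_def
  by clarsimp (metis no_zero_divisors poly_in_add poly_in_mult)

lemma ratfun_in_mult: "f \<in> ratfun_in V \<Longrightarrow> g \<in> ratfun_in V \<Longrightarrow> f * g \<in> ratfun_in V"
  unfolding ratfun_in_def
  by clarsimp (metis no_zero_divisors poly_in_mult)

lemma ratfun_in_uminus: "f \<in> ratfun_in V \<Longrightarrow> - f \<in> ratfun_in V"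
  unfolding ratfun_in_def by clarsimp (metis poly_in_uminus)

lemma ratfun_in_inverse: "f \<in> ratfun_in V \<Longrightarrow> inverse f \<in> ratfun_in V"
proof -
  assume "f \<in> ratfun_in V"
  then obtain a b where f: "f = Fract a b" "a \<in> poly_in V" "b \<in> poly_in V" "b \<noteq> 0"
    by (auto simp: ratfun_in_def)
  show ?thesis
  proof (cases "a = 0")
    case True
    then have "f = 0" using f by (simp add: Zero_fract_def eq_fract)
    then show ?thesis by simp
  next
    case False
    then show ?thesis using f by (auto simp: ratfun_in_def)
  qed
qed

lemma ratfun_in_divide: "f \<in> ratfun_in V \<Longrightarrow> g \<in> ratfun_in V \<Longrightarrow> f / g \<in> ratfun_in V"
  by (simp add: divide_inverse ratfun_in_mult ratfun_in_inverse)

lemma ratfun_in_sum: "(\<And>x. x \<in> I \<Longrightarrow> f x \<in> ratfun_in V) \<Longrightarrow> sum f I \<in> ratfun_in V"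
  by (induction I rule: infinite_finite_induct) (auto intro: ratfun_in_add)

lemma ratfun_in_prod: "(\<And>x. x \<in> I \<Longrightarrow> f x \<in> ratfun_in V) \<Longrightarrow> prod f I \<in> ratfun_in V"
  by (induction I rule: infinite_finite_induct) (auto intro: ratfun_in_mult)

lemma X_in: "p \<in> V \<Longrightarrow> X p \<in> ratfun_in V"
  unfolding ratfun_in_def X_def
  by (rule CollectI, intro exI conjI, rule refl) (auto simp: poly_in_def)

text \<open>If \<open>X p = a / b\<close>, then \<open>X p * b = a\<close>. Multiplication by a
  monomial merely translates exponents, so any monomial of \<open>b\<close> produces one of
  \<open>a\<close> that contains \<open>p\<close>.\<close>

lemma X_notin:
  assumes "p \<notin> V" shows "(X p :: 'k::field ratfun) \<notin> ratfun_in V"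
proof
  assume "(X p :: 'k ratfun) \<in> ratfun_in V"
  then obtain a b :: "(int \<times> int \<Rightarrow>\<^sub>0 nat) \<Rightarrow>\<^sub>0 'k" where
    ab: "X p = Fract a b" "a \<in> poly_in V" "b \<in> poly_in V" "b \<noteq> 0"
    by (auto simp: ratfun_in_def)
  let ?m = "Poly_Mapping.single p (1::nat)"
  have eq: "Poly_Mapping.single ?m 1 * b = a"
    using ab(1,4) by (simp add: X_def eq_fract)
  obtain n where n: "n \<in> Poly_Mapping.keys b" using ab(4) by (metis keys_eq_empty all_not_in_conv)
  have "Poly_Mapping.lookup a (?m + n) \<noteq> 0"
    using n by (simp add: eq[symmetric] lookup_single_times_shift in_keys_iff)
  then have "Poly_Mapping.keys (?m + n) \<subseteq> V"
    using ab(2) by (auto simp: poly_in_def in_keys_iff)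
  moreover have "p \<in> Poly_Mapping.keys (?m + n)" by (simp add: in_keys_iff lookup_add)
  ultimately show False using assms by blast
qed

lemma X_nonzero [simp]: "X p \<noteq> 0"
  by (metis X_notin empty_iff ratfun_in_0)

text \<open>Distinct indeterminates are required because of characteristic 2.\<close>

lemma X_add_X_nonzero: "p \<noteq> q \<Longrightarrow> X p + X q \<noteq> (0 :: 'k::field ratfun)"
proof
  assume pq: "p \<noteq> q" and "X p + X q = (0 :: 'k ratfun)"
  then have "X p = - (X q :: 'k ratfun)" by (simp add: eq_neg_iff_add_eq_0)
  moreover have "- (X q :: 'k ratfun) \<in> ratfun_in {q}" by (simp add: X_in ratfun_in_uminus)
  ultimately show False using X_notin[of p "{q}"] pq by (metis singletonD)
qed

text \<open>Both lower neighbours of a point precede it lexicographically. The passage from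
  \<open>X\<close> to \<open>A_var\<close> is therefore triangular in this order.\<close>

lemma A_var_decomp:
  assumes "0 \<le> fst p" "0 \<le> snd p"
  obtains c :: "'k::field ratfun" where "A_var p = c / X p" "c \<noteq> 0" "c \<in> ratfun_in {q. q < p}"
proof -
  obtain i j where p: "p = (i, j)" "0 \<le> i" "0 \<le> j" using assms by (cases p) auto
  consider "i \<ge> 1 \<and> j \<ge> 1" | "i \<ge> 1 \<and> j = 0" | "i = 0 \<and> j \<ge> 1" | "i = 0 \<and> j = 0"
    using p by linarith
  then show ?thesis
  proof cases
    case 1
    then show ?thesis
      by (intro that[of "X (i, j - 1) + X (i - 1, j)"])
        (auto simp: p A_var_def less_prod_def X_add_X_nonzero intro!: ratfun_in_add X_in)
  next
    case 2
    then show ?thesis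
      by (intro that[of "X (i - 1, 0)"]) (auto simp: p A_var_def less_prod_def intro!: X_in)
  next
    case 3
    then show ?thesis
      by (intro that[of "X (0, j - 1)"]) (auto simp: p A_var_def less_prod_def intro!: X_in)
  next
    case 4
    then show ?thesis by (intro that[of 1]) (auto simp: p A_var_def)
  qed
qed

lemma A_var_nonzero:
  assumes "0 \<le> fst p" "0 \<le> snd p" shows "(A_var p :: 'k::field ratfun) \<noteq> 0"
  by (rule A_var_decomp[OF assms, where ?'k='k]) auto

lemma A_var_in:
  assumes "0 \<le> fst p" "0 \<le> snd p" "{q. q \<le> p} \<subseteq> V"
  shows "(A_var p :: 'k::field ratfun) \<in> ratfun_in V"
proof (rule A_var_decomp[OF assms(1,2), where ?'k='k])
  fix c :: "'k ratfun"
  assume c: "A_var p = c / X p" "c \<in> ratfun_in {q. q < p}"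
  have "c \<in> ratfun_in V"
    using c(2) assms(3) unfolding ratfun_in_def poly_in_def by (fastforce simp: less_imp_le)
  moreover have "X p \<in> ratfun_in V" using assms(3) by (auto intro: X_in)
  ultimately show ?thesis unfolding c(1) by (rule ratfun_in_divide)
qed

text \<open>Of the variables up to the lexicographically largest point \<open>p\<close>, only \<open>A\<^bsub>p\<^esub>\<close> involves \<open>X p\<close>.\<close>

lemma sum_prod_A_var_nonzero:
  assumes "finite F" "F \<noteq> {}" "\<And>S. S \<in> F \<Longrightarrow> finite S"
    "\<And>p. p \<in> \<Union>F \<Longrightarrow> 0 \<le> fst p \<and> 0 \<le> snd p"
  shows "(\<Sum>S\<in>F. \<Prod>p\<in>S. A_var p) \<noteq> (0 :: 'k::field ratfun)"
  using assms
proof (induction "card (\<Union>F)" arbitrary: F rule: less_induct)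
  case less
  let ?A = "A_var :: _ \<Rightarrow> 'k ratfun"
  have fU: "finite (\<Union>F)" using less.prems by blast
  show ?case
  proof (cases "\<Union>F = {}")
    case True
    then have "F = {{}}" using less.prems(2) by auto
    then show ?thesis by simp
  next
    case False
    define p where "p = Max (\<Union>F)"
    have p: "p \<in> \<Union>F" and pmax: "\<And>q. q \<in> \<Union>F \<Longrightarrow> q \<le> p"
      using Max_in[OF fU False] Max_ge[OF fU] by (auto simp: p_def)
    define F0 where "F0 = {S\<in>F. p \<notin> S}"
    define F1 where "F1 = (\<lambda>S. S - {p}) ` {S\<in>F. p \<in> S}"
    have inj: "inj_on (\<lambda>S. S - {p}) {S\<in>F. p \<in> S}" by (auto simp: inj_on_def)
    have "(\<Sum>S\<in>F. \<Prod>q\<in>S. ?A q) = (\<Sum>S\<in>F0. \<Prod>q\<in>S. ?A q) + (\<Sum>S\<in>{S\<in>F. p \<in> S}. \<Prod>q\<in>S. ?A q)"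
      by (subst sum.union_disjoint[symmetric])
        (use less.prems(1) in \<open>auto simp: F0_def intro!: sum.cong\<close>)
    also have "(\<Sum>S\<in>{S\<in>F. p \<in> S}. \<Prod>q\<in>S. ?A q) = (\<Sum>S\<in>{S\<in>F. p \<in> S}. ?A p * (\<Prod>q\<in>S - {p}. ?A q))"
      by (intro sum.cong refl prod.remove) (use less.prems(3) in auto)
    also have "\<dots> = ?A p * (\<Sum>S\<in>F1. \<Prod>q\<in>S. ?A q)"
      unfolding F1_def by (simp add: sum.reindex[OF inj] sum_distrib_left)
    finally have eq: "(\<Sum>S\<in>F. \<Prod>q\<in>S. ?A q) =
      (\<Sum>S\<in>F0. \<Prod>q\<in>S. ?A q) + ?A p * (\<Sum>S\<in>F1. \<Prod>q\<in>S. ?A q)" .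
    have U1: "\<Union>F1 \<subseteq> \<Union>F - {p}" by (auto simp: F1_def)
    have nz: "(\<Sum>S\<in>F1. \<Prod>q\<in>S. ?A q) \<noteq> 0"
    proof (rule less.hyps)
      show "card (\<Union>F1) < card (\<Union>F)"
        by (rule psubset_card_mono[OF fU]) (use U1 p in blast)
      show "F1 \<noteq> {}" using p by (auto simp: F1_def)
      show "finite F1" using less.prems(1) by (simp add: F1_def)
      show "finite S" if "S \<in> F1" for S using that less.prems(3) by (auto simp: F1_def)
      show "0 \<le> fst q \<and> 0 \<le> snd q" if "q \<in> \<Union>F1" for q using that U1 less.prems(4) by blast
    qed
    have mem: "(\<Sum>S\<in>G. \<Prod>q\<in>S. ?A q) \<in> ratfun_in {q. q < p}" if "\<Union>G \<subseteq> \<Union>F - {p}" for G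
    proof (intro ratfun_in_sum ratfun_in_prod)
      fix S q assume "S \<in> G" "q \<in> S"
      then have "q \<in> \<Union>F" "q \<noteq> p" using that by auto
      then have "q < p" "0 \<le> fst q" "0 \<le> snd q" using pmax[of q] less.prems(4)[of q] by auto
      then show "?A q \<in> ratfun_in {q. q < p}" by (intro A_var_in) auto
    qed
    have nonneg: "0 \<le> fst p" "0 \<le> snd p" using less.prems(4)[OF p] by auto
    show ?thesis
    proof (rule A_var_decomp[OF nonneg, where ?'k='k])
      fix c :: "'k ratfun"
      assume c: "?A p = c / X p" "c \<noteq> 0" "c \<in> ratfun_in {q. q < p}"
      show ?thesis
      proof
        \<comment> \<open>A vanishing sum could be solved for \<open>X p\<close>, which would then
          lie in the subfield of smaller indeterminates. The divisor, the sum over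
          \<open>F0\<close>, is nonzero because the other summand is.\<close>
        assume "(\<Sum>S\<in>F. \<Prod>q\<in>S. ?A q) = 0"
        then have *: "(\<Sum>S\<in>F0. \<Prod>q\<in>S. ?A q) = - (c / X p * (\<Sum>S\<in>F1. \<Prod>q\<in>S. ?A q))"
          using eq c by (simp add: eq_neg_iff_add_eq_0)
        then have "(\<Sum>S\<in>F0. \<Prod>q\<in>S. ?A q) \<noteq> 0" using nz c by simp
        then have "X p = - (c * (\<Sum>S\<in>F1. \<Prod>q\<in>S. ?A q)) / (\<Sum>S\<in>F0. \<Prod>q\<in>S. ?A q)"
          using * by (simp add: nonzero_eq_divide_eq)
        moreover have "- (c * (\<Sum>S\<in>F1. \<Prod>q\<in>S. ?A q)) / (\<Sum>S\<in>F0. \<Prod>q\<in>S. ?A q) \<in> ratfun_in {q. q < p}"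
          by (intro ratfun_in_divide ratfun_in_uminus ratfun_in_mult c mem) (use U1 in \<open>auto simp: F0_def\<close>)
        ultimately show False using X_notin[of p "{q. q < p}", where ?'k='k] by auto
      qed
    qed
  qed
qed

section \<open>Determinants\<close>

text \<open>Entries are given by a function on all indices, so that a row is replaced by
  \<open>f(i := w)\<close> and the size changes without changing the matrix.\<close>

definition fdet :: "nat \<Rightarrow> (nat \<Rightarrow> nat \<Rightarrow> 'a::field) \<Rightarrow> 'a" where
  "fdet n f = det (mat n n (\<lambda>(x, y). f x y))"

lemma fdet_0 [simp]: "fdet 0 f = 1"
  by (simp add: fdet_def)

lemma fdet_cong: "(\<And>x y. x < n \<Longrightarrow> y < n \<Longrightarrow> f x y = g x y) \<Longrightarrow> fdet n f = fdet n g"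
  unfolding fdet_def by (intro arg_cong[where f = det] eq_matI) auto

lemma fdet_transpose: "fdet n (\<lambda>x y. f y x) = fdet n f"
proof -
  have "mat n n (\<lambda>(x, y). f y x) = transpose_mat (mat n n (\<lambda>(x, y). f x y))"
    by (intro eq_matI) auto
  then show ?thesis unfolding fdet_def by (simp add: det_transpose[of _ n])
qed

lemma fdet_scale_rows: "fdet n (\<lambda>x y. c x * f x y) = (\<Prod>x<n. c x) * fdet n f"
proof -
  have "mat n n (\<lambda>(x, y). c x * f x y) = mat\<^sub>r n n (\<lambda>x. c x \<cdot>\<^sub>v vec n (f x))"
    by (intro eq_matI) auto
  moreover have "mat n n (\<lambda>(x, y). f x y) = mat\<^sub>r n n (\<lambda>x. vec n (f x))"
    by (intro eq_matI) auto
  ultimately show ?thesis unfolding fdet_def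
    by (simp add: det_rows_mul lessThan_atLeast0)
qed

lemma fdet_scale_cols: "fdet n (\<lambda>x y. c y * f x y) = (\<Prod>y<n. c y) * fdet n f"
  using fdet_scale_rows[of n c "\<lambda>x y. f y x"] fdet_transpose[of n f]
    fdet_transpose[of n "\<lambda>x y. c x * f y x"] by simp

lemma fdet_mult: "fdet n f * fdet n g = fdet n (\<lambda>x z. \<Sum>y<n. f x y * g y z)"
proof -
  have "mat n n (\<lambda>(x, z). \<Sum>y<n. f x y * g y z) = mat n n (\<lambda>(x, y). f x y) * mat n n (\<lambda>(x, y). g x y)"
    by (intro eq_matI) (auto simp: scalar_prod_def lessThan_atLeast0)
  then show ?thesis unfolding fdet_def by (simp add: det_mult[of _ n])
qed

lemma fdet_equal_rows:
  assumes "x < n" "x' < n" "x \<noteq> x'" "\<And>y. y < n \<Longrightarrow> f x y = f x' y"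
  shows "fdet n f = 0"
  unfolding fdet_def
  by (rule det_identical_rows[OF _ assms(3,1,2)]) (use assms in \<open>auto intro!: eq_vecI\<close>)

definition fcofactor :: "nat \<Rightarrow> (nat \<Rightarrow> nat \<Rightarrow> 'a::field) \<Rightarrow> nat \<Rightarrow> nat \<Rightarrow> 'a" where
  "fcofactor n f x y = cofactor (mat n n (\<lambda>(x, y). f x y)) x y"

text \<open>The cofactors along row \<open>i\<close> do not see that row. One set of coefficients
  therefore serves every \<open>w\<close>, which yields linearity in the row.\<close>

lemma fdet_row_expand:
  assumes "i < n" shows "fdet n (f(i := w)) = (\<Sum>y<n. w y * fcofactor n f i y)"
proof -
  have md: "mat_delete (mat n n (\<lambda>(x, y). (f(i := w)) x y)) i y =
      mat_delete (mat n n (\<lambda>(x, y). f x y)) i y" for y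
    unfolding mat_delete_def by (intro eq_matI) auto
  have "fdet n (f(i := w)) = (\<Sum>y<n. mat n n (\<lambda>(x, y). (f(i := w)) x y) $$ (i, y) *
      cofactor (mat n n (\<lambda>(x, y). (f(i := w)) x y)) i y)"
    unfolding fdet_def by (rule laplace_expansion_row) (use assms in auto)
  also have "\<dots> = (\<Sum>y<n. w y * fcofactor n f i y)"
    using assms by (intro sum.cong refl, simp add: fcofactor_def cofactor_def md del: fun_upd_apply, simp)
  finally show ?thesis .
qed

lemma fdet_row_add:
  assumes "i < n" shows "fdet n (f(i := \<lambda>y. w y + w' y)) = fdet n (f(i := w)) + fdet n (f(i := w'))"
  by (simp add: fdet_row_expand[OF assms] sum.distrib distrib_right)

lemma fdet_row_scale:
  assumes "i < n" shows "fdet n (f(i := \<lambda>y. c * w y)) = c * fdet n (f(i := w))"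
  by (simp add: fdet_row_expand[OF assms] sum_distrib_left mult_ac)

lemma fdet_zero_row:
  assumes "i < n" "\<And>y. y < n \<Longrightarrow> f i y = 0" shows "fdet n f = 0"
proof -
  have "fdet n (f(i := f i)) = 0"
    using assms by (subst fdet_row_expand) auto
  then show ?thesis by simp
qed

lemma fdet_last_unit: "fdet (Suc n) (f(n := \<lambda>y. if y = n then 1 else 0)) = fdet n f"
proof -
  have "fdet (Suc n) (f(n := \<lambda>y. if y = n then 1 else 0)) = fcofactor (Suc n) f n n"
    by (subst fdet_row_expand) simp_all
  also have "mat_delete (mat (Suc n) (Suc n) (\<lambda>(x, y). f x y)) n n = mat n n (\<lambda>(x, y). f x y)"
    unfolding mat_delete_def by (intro eq_matI) auto
  then have "fcofactor (Suc n) f n n = fdet n f"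
    unfolding fcofactor_def cofactor_def fdet_def by (simp add: mult_2[symmetric])
  finally show ?thesis .
qed

text \<open>A division-free form of Cramer's rule, from \<open>adj M * M = det M * 1\<close>: it
  expands \<open>w\<close> in the rows of \<open>f\<close>, even if these are dependent.\<close>

lemma fdet_cramer:
  assumes "z < n" shows "fdet n f * w z = (\<Sum>x<n. fdet n (f(x := w)) * f x z)"
proof -
  let ?M = "mat n n (\<lambda>(x, y). f x y)"
  have adj: "adj_mat ?M * ?M = det ?M \<cdot>\<^sub>m 1\<^sub>m n" by (rule adj_mat(3)) simp
  have *: "(\<Sum>x<n. fcofactor n f x y * f x z) = (if y = z then fdet n f else 0)" if "y < n" for y
  proof -
    have "(\<Sum>x<n. fcofactor n f x y * f x z) = (adj_mat ?M * ?M) $$ (y, z)"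
      using that assms
      by (auto simp: adj_mat_def scalar_prod_def fcofactor_def lessThan_atLeast0 intro!: sum.cong)
    also have "\<dots> = (if y = z then fdet n f else 0)"
      unfolding adj using that assms by (simp add: fdet_def)
    finally show ?thesis .
  qed
  have "(\<Sum>x<n. fdet n (f(x := w)) * f x z) = (\<Sum>x<n. \<Sum>y<n. w y * (fcofactor n f x y * f x z))"
    by (intro sum.cong refl) (simp add: fdet_row_expand sum_distrib_right sum_distrib_left mult_ac)
  also have "\<dots> = (\<Sum>y<n. w y * (\<Sum>x<n. fcofactor n f x y * f x z))"
    by (subst sum.swap) (simp add: sum_distrib_left)
  also have "\<dots> = (\<Sum>y<n. if y = z then w z * fdet n f else 0)"
    by (intro sum.cong refl) (auto simp: *)
  also have "\<dots> = w z * fdet n f" using assms by simp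
  finally show ?thesis by (simp add: mult_ac)
qed

text \<open>As a function of \<open>w\<close>, the second determinant is a linear form; it is
  applied to the expansion of \<open>w\<close> in \<open>fdet_cramer\<close>. This is a Pluecker
  exchange relation.\<close>

lemma fdet_exchange:
  assumes "i < n"
  shows "fdet n f * fdet n (g(i := w)) = (\<Sum>x<n. fdet n (f(x := w)) * fdet n (g(i := f x)))"
proof -
  have "fdet n f * fdet n (g(i := w)) = (\<Sum>z<n. (fdet n f * w z) * fcofactor n g i z)"
    by (simp add: fdet_row_expand[OF assms] sum_distrib_left mult_ac)
  also have "\<dots> = (\<Sum>z<n. \<Sum>x<n. fdet n (f(x := w)) * (f x z * fcofactor n g i z))"
    by (intro sum.cong refl) (subst fdet_cramer, auto simp: sum_distrib_right mult.assoc)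
  also have "\<dots> = (\<Sum>x<n. fdet n (f(x := w)) * fdet n (g(i := f x)))"
    by (subst sum.swap) (simp add: fdet_row_expand[OF assms] sum_distrib_left)
  finally show ?thesis .
qed

text \<open>\<open>case_nat w f\<close> puts \<open>w\<close> in front of the rows of
  \<open>f\<close>; the last row passes \<open>n\<close> others on its way there.\<close>

lemma fdet_rotate: "fdet (Suc n) (case_nat w f) = (-1) ^ n * fdet (Suc n) (f(n := w))"
proof -
  let ?M = "mat (Suc n) (Suc n) (\<lambda>(x, y). (f(n := w)) x y)"
  have "swap_row_to_front ?M n = mat (Suc n) (Suc n) (\<lambda>(x, y). (case_nat w f) x y)"
    by (subst swap_row_to_front_result[of _ "Suc n" "Suc n"])
      (auto intro!: eq_matI split: nat.split)
  moreover have "det (swap_row_to_front ?M n) = (-1) ^ n * det ?M"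
    by (rule swap_row_to_front_det[of _ "Suc n"]) auto
  ultimately show ?thesis unfolding fdet_def by (simp only:)
qed

text \<open>When all sources move by one step, each row of the old path matrix is, up to a vertex
  weight, the sum of two adjacent rows of the new one. \<open>col_sum\<close> does the same for
  sinks.\<close>

definition row_sum :: "(nat \<Rightarrow> nat \<Rightarrow> 'a::field) \<Rightarrow> nat \<Rightarrow> nat \<Rightarrow> 'a" where
  "row_sum f x y = f x y + f (Suc x) y"

definition col_sum :: "(nat \<Rightarrow> nat \<Rightarrow> 'a::field) \<Rightarrow> nat \<Rightarrow> nat \<Rightarrow> 'a" where
  "col_sum f x y = f x y + f x (Suc y)"

text \<open>The row of alternating signs is annihilated by adding adjacent columns, so adjoining it
  compensates for the column that this operation loses.\<close>

lemma fdet_col_sum: "fdet n (col_sum f) = fdet (Suc n) (f(n := \<lambda>y. (-1) ^ (y + n)))"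
proof -
  \<comment> \<open>Right multiplication by \<open>U\<close> adds to each column its successor,
    which the last column lacks. The alternating last row becomes
    \<open>(0, ..., 0, 1)\<close>.\<close>
  define U :: "nat \<Rightarrow> nat \<Rightarrow> 'a" where "U = (\<lambda>y z. if y = z \<or> y = Suc z then 1 else 0)"
  define g where "g = (\<lambda>x z. if z < n then col_sum f x z else f x z)"
  let ?F = "f(n := \<lambda>y. (-1) ^ (y + n))"
  have "fdet (Suc n) U = 1"
  proof -
    have "det (mat (Suc n) (Suc n) (\<lambda>(x, y). U x y)) =
        prod_list (diag_mat (mat (Suc n) (Suc n) (\<lambda>(x, y). U x y)))"
      by (rule det_lower_triangular[of "Suc n"]) (auto simp: U_def)
    also have "diag_mat (mat (Suc n) (Suc n) (\<lambda>(x, y). U x y)) = replicate (Suc n) 1"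
      by (intro nth_equalityI) (auto simp: diag_mat_def U_def simp del: replicate_Suc upt_Suc)
    finally show ?thesis unfolding fdet_def by simp
  qed
  then have "fdet (Suc n) ?F = fdet (Suc n) (\<lambda>x z. \<Sum>y<Suc n. ?F x y * U y z)"
    using fdet_mult[of "Suc n" ?F U] by simp
  also have "\<dots> = fdet (Suc n) (g(n := \<lambda>y. if y = n then 1 else 0))"
  proof (rule fdet_cong)
    fix x z assume xz: "x < Suc n" "z < Suc n"
    have "(\<Sum>y<Suc n. ?F x y * U y z) =
      (\<Sum>y<Suc n. (if y = z then ?F x z else 0) + (if y = Suc z then ?F x (Suc z) else 0))"
      by (intro sum.cong) (auto simp: U_def)
    also have "\<dots> = ?F x z + (if z < n then ?F x (Suc z) else 0)"
      using xz by (subst sum.distrib) simp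
    also have "\<dots> = (g(n := \<lambda>y. if y = n then 1 else 0)) x z"
      using xz by (auto simp: g_def col_sum_def mult_2[symmetric] less_Suc_eq)
    finally show "(\<Sum>y<Suc n. ?F x y * U y z) = (g(n := \<lambda>y. if y = n then 1 else 0)) x z" .
  qed
  also have "\<dots> = fdet n g" by (rule fdet_last_unit)
  also have "\<dots> = fdet n (col_sum f)" by (intro fdet_cong) (simp add: g_def)
  finally show ?thesis by simp
qed

lemma fdet_rotate': "fdet (Suc n) (f(0 := w)) = (-1) ^ n * fdet (Suc n) ((\<lambda>x. f (Suc x))(n := w))"
proof -
  have "fdet (Suc n) (f(0 := w)) = fdet (Suc n) (case_nat w (\<lambda>x. f (Suc x)))"
    by (intro fdet_cong) (auto split: nat.split)
  then show ?thesis by (simp only: fdet_rotate)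
qed

lemma sum_adjacent_telescope:
  assumes "\<And>x. 0 < x \<Longrightarrow> x \<le> n \<Longrightarrow> (l x :: 'a::field) = 0"
  shows "(\<Sum>x<Suc n. d x * (l x + l (Suc x))) = d 0 * l 0 + d n * l (Suc n)"
proof (cases n)
  case (Suc m)
  have "(\<Sum>x<Suc n. d x * (l x + l (Suc x))) =
    (\<Sum>x<Suc n. (if x = 0 then d 0 * l 0 else 0) + (if x = n then d n * l (Suc n) else 0))"
    using Suc assms by (intro sum.cong refl) auto
  then show ?thesis by (simp add: sum.distrib)
qed (simp add: algebra_simps)

text \<open>Both quadratic relations come from expanding the row \<open>w\<close> in the rows of the first determinant
  (Cramer's rule) and applying the linear form \<open>lam\<close>. This form vanishes on the inner rows of \<open>e\<close>,
  so that only the two end terms of the expansion survive.\<close>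

lemma fdet_octahedron_square:
  "fdet (Suc n) (row_sum e) * fdet n (\<lambda>x. col_sum e (Suc x)) =
   fdet n (\<lambda>x. col_sum (row_sum e) (Suc x)) * fdet (Suc n) e +
   fdet n (col_sum (row_sum e)) * fdet (Suc n) (\<lambda>x. e (Suc x))"
proof -
  define w :: "nat \<Rightarrow> 'a" where "w = (\<lambda>y. (-1) ^ (y + n))"
  define lam where "lam = (\<lambda>v. fdet (Suc n) ((\<lambda>x. e (Suc x))(n := v)))"
  define d where "d = (\<lambda>x. fdet (Suc n) ((row_sum e)(x := w)))"
  have lam0: "lam (e x) = 0" if "0 < x" "x \<le> n" for x
    unfolding lam_def by (rule fdet_equal_rows[of n _ "x - 1"]) (use that in auto)
  have lam_last: "lam (e (Suc n)) = fdet (Suc n) (\<lambda>x. e (Suc x))"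
    unfolding lam_def by (intro arg_cong[where f = "fdet (Suc n)"]) auto
  have lam_first: "lam (e 0) = (-1) ^ n * fdet (Suc n) e"
  proof -
    have "fdet (Suc n) (e(0 := e 0)) = (-1) ^ n * lam (e 0)" unfolding lam_def by (rule fdet_rotate')
    then have "(-1) ^ n * fdet (Suc n) e = ((-1) ^ n * (-1) ^ n) * lam (e 0)" by simp
    then show ?thesis by simp
  qed
  have d_first: "d 0 = (-1) ^ n * fdet n (\<lambda>x. col_sum (row_sum e) (Suc x))"
  proof -
    have "fdet n (\<lambda>x. col_sum (row_sum e) (Suc x)) = fdet n (col_sum (\<lambda>x. row_sum e (Suc x)))"
      by (intro fdet_cong) (simp add: col_sum_def)
    then show ?thesis unfolding d_def by (subst fdet_rotate') (simp add: fdet_col_sum w_def)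
  qed
  have "fdet (Suc n) (row_sum e) * lam w = (\<Sum>x<Suc n. d x * lam (row_sum e x))"
    unfolding lam_def d_def by (rule fdet_exchange) simp
  also have "\<dots> = (\<Sum>x<Suc n. d x * (lam (e x) + lam (e (Suc x))))"
    unfolding lam_def row_sum_def by (subst fdet_row_add) simp_all
  also have "\<dots> = d 0 * lam (e 0) + d n * lam (e (Suc n))"
    by (rule sum_adjacent_telescope) (rule lam0)
  also have "lam w = fdet n (\<lambda>x. col_sum e (Suc x))"
  proof -
    have "fdet n (\<lambda>x. col_sum e (Suc x)) = fdet n (col_sum (\<lambda>x. e (Suc x)))"
      by (intro fdet_cong) (simp add: col_sum_def)
    then show ?thesis unfolding lam_def w_def by (simp add: fdet_col_sum)
  qed
  also have "d n = fdet n (col_sum (row_sum e))"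
    unfolding d_def w_def by (simp add: fdet_col_sum)
  finally show ?thesis
    unfolding lam_first lam_last d_first by simp
qed

lemma fdet_octahedron_dodgson:
  "fdet (Suc n) (row_sum e) * fdet (Suc n) (\<lambda>x. col_sum e (Suc x)) =
   fdet n (\<lambda>x. col_sum (row_sum e) (Suc x)) * fdet (Suc (Suc n)) e +
   fdet (Suc n) (col_sum (row_sum e)) * fdet (Suc n) (\<lambda>x. e (Suc x))"
proof -
  define w :: "nat \<Rightarrow> 'a" where "w = (\<lambda>y. (-1) ^ (y + Suc n))"
  \<comment> \<open>Here \<open>lam\<close> annihilates \<open>e (Suc n)\<close> as well, so the
    upper end of the row sums contributes nothing. The bordering row \<open>t\<close>, which makes
    the sizes agree, supplies the second product instead.\<close>
  define t :: "nat \<Rightarrow> 'a" where "t = (\<lambda>y. if y = Suc n then 1 else 0)"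
  define f where "f = (row_sum e)(Suc n := t)"
  define lam where "lam = (\<lambda>v. fdet (Suc (Suc n)) ((\<lambda>x. e (Suc x))(Suc n := v)))"
  define d where "d = (\<lambda>x. fdet (Suc (Suc n)) (f(x := w)))"
  have lam0: "lam (e x) = 0" if "0 < x" "x \<le> Suc n" for x
    unfolding lam_def by (rule fdet_equal_rows[of "Suc n" _ "x - 1"]) (use that in auto)
  have lam_first: "lam (e 0) = (-1) ^ Suc n * fdet (Suc (Suc n)) e"
  proof -
    have "fdet (Suc (Suc n)) (e(0 := e 0)) = (-1) ^ Suc n * lam (e 0)" unfolding lam_def by (rule fdet_rotate')
    then have "(-1) ^ Suc n * fdet (Suc (Suc n)) e = ((-1) ^ Suc n * (-1) ^ Suc n) * lam (e 0)"
      by (simp only: fun_upd_triv mult.assoc)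
    then show ?thesis by simp
  qed
  have d_first: "d 0 = - ((-1) ^ n) * fdet n (\<lambda>x. col_sum (row_sum e) (Suc x))"
  proof -
    have *: "fdet n (\<lambda>x. col_sum (row_sum e) (Suc x)) = fdet n (col_sum (\<lambda>x. row_sum e (Suc x)))"
      by (intro fdet_cong) (simp add: col_sum_def)
    have "d 0 = fdet (Suc (Suc n)) ((f(0 := w))(Suc n := t))"
      unfolding d_def f_def by (intro arg_cong[where f = "fdet (Suc (Suc n))"]) auto
    also have "\<dots> = fdet (Suc n) (f(0 := w))" unfolding t_def by (rule fdet_last_unit)
    also have "\<dots> = fdet (Suc n) ((row_sum e)(0 := w))" by (intro fdet_cong) (auto simp: f_def)
    also have "\<dots> = (-1) ^ n * fdet (Suc n) ((\<lambda>x. row_sum e (Suc x))(n := w))" by (rule fdet_rotate')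
    also have "w = (\<lambda>y. (-1) * (-1) ^ (y + n))" by (simp add: w_def)
    also have "fdet (Suc n) ((\<lambda>x. row_sum e (Suc x))(n := \<lambda>y. (-1) * (-1) ^ (y + n))) =
        (-1) * fdet n (col_sum (\<lambda>x. row_sum e (Suc x)))"
      unfolding fdet_col_sum by (rule fdet_row_scale) simp
    finally show ?thesis by (simp add: *)
  qed
  have f_row: "f x = row_sum e x" if "x < Suc n" for x using that by (simp add: f_def)
  have "fdet (Suc (Suc n)) f * lam w = (\<Sum>x<Suc (Suc n). d x * lam (f x))"
    unfolding lam_def d_def by (rule fdet_exchange) simp
  also have "\<dots> = (\<Sum>x<Suc n. d x * (lam (e x) + lam (e (Suc x)))) + d (Suc n) * lam t"
  proof -
    have "lam (f x) = lam (e x) + lam (e (Suc x))" if "x < Suc n" for x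
      unfolding f_row[OF that] unfolding lam_def row_sum_def by (rule fdet_row_add) simp
    then show ?thesis by (simp add: f_def)
  qed
  also have "(\<Sum>x<Suc n. d x * (lam (e x) + lam (e (Suc x)))) = d 0 * lam (e 0) + d n * lam (e (Suc n))"
    by (rule sum_adjacent_telescope) (rule lam0, auto)
  also have "lam (e (Suc n)) = 0" by (rule lam0) auto
  also have "lam w = fdet (Suc n) (\<lambda>x. col_sum e (Suc x))"
  proof -
    have "fdet (Suc n) (\<lambda>x. col_sum e (Suc x)) = fdet (Suc n) (col_sum (\<lambda>x. e (Suc x)))"
      by (intro fdet_cong) (simp add: col_sum_def)
    then show ?thesis unfolding lam_def w_def by (simp add: fdet_col_sum)
  qed
  also have "d (Suc n) = fdet (Suc n) (col_sum (row_sum e))"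
    unfolding d_def w_def f_def by (simp add: fdet_col_sum)
  also have "lam t = fdet (Suc n) (\<lambda>x. e (Suc x))"
    unfolding lam_def t_def by (rule fdet_last_unit)
  also have "fdet (Suc (Suc n)) f = fdet (Suc n) (row_sum e)"
    unfolding f_def t_def by (rule fdet_last_unit)
  finally show ?thesis
    unfolding lam_first d_first by simp
qed

section \<open>Families of nonintersecting lattice paths\<close>

definition diag :: "int \<times> int \<Rightarrow> int" where "diag p = fst p + snd p"
definition east :: "int \<times> int \<Rightarrow> int \<times> int" where "east p = (fst p + 1, snd p)"
definition north :: "int \<times> int \<Rightarrow> int \<times> int" where "north p = (fst p, snd p + 1)"

lemma diag_east [simp]: "diag (east p) = diag p + 1"
  and diag_north [simp]: "diag (north p) = diag p + 1"
  by (simp_all add: diag_def east_def north_def)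

lemma east_neq_north: "east p \<noteq> north p"
  by (simp add: east_def north_def)

lemma lattice_path_singleton [simp]: "lattice_path [p]"
  by (simp add: lattice_path_def)

lemma lattice_path_Cons:
  assumes "w \<noteq> []"
  shows "lattice_path (v # w) \<longleftrightarrow> lattice_path w \<and> hd w \<in> {east v, north v}"
proof -
  have step: "(fst (hd w) - fst v, snd (hd w) - snd v) \<in> {(1, 0), (0, 1)} \<longleftrightarrow> hd w \<in> {east v, north v}"
    by (cases "hd w"; cases v) (auto simp: east_def north_def)
  have all_nat: "(\<forall>t. Q t) \<longleftrightarrow> Q 0 \<and> (\<forall>t. Q (Suc t))" for Q :: "nat \<Rightarrow> bool"
    by (metis not0_implies_Suc)
  have "lattice_path (v # w) \<longleftrightarrow>
    (\<forall>t. t < length w \<longrightarrow> (fst (w ! t) - fst ((v # w) ! t), snd (w ! t) - snd ((v # w) ! t)) \<in> {(1, 0), (0, 1)})"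
    by (simp add: lattice_path_def)
  also have "\<dots> \<longleftrightarrow> (fst (w ! 0) - fst v, snd (w ! 0) - snd v) \<in> {(1, 0), (0, 1)} \<and>
    (\<forall>t. Suc t < length w \<longrightarrow> (fst (w ! Suc t) - fst (w ! t), snd (w ! Suc t) - snd (w ! t)) \<in> {(1, 0), (0, 1)})"
    using assms by (subst all_nat) auto
  finally show ?thesis using assms step by (simp add: hd_conv_nth lattice_path_def conj_commute)
qed

lemma lattice_path_nonempty: "lattice_path w \<Longrightarrow> w \<noteq> []"
  by (simp add: lattice_path_def)

lemma lattice_path_hd_le:
  "lattice_path w \<Longrightarrow> p \<in> set w \<Longrightarrow> le_pt (hd w) p"
proof (induction w)
  case (Cons v w)
  then show ?case
    by (cases "w = []") (auto simp: lattice_path_Cons le_pt_def east_def north_def)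
qed simp

lemma lattice_path_le_last:
  "lattice_path w \<Longrightarrow> p \<in> set w \<Longrightarrow> le_pt p (last w)"
proof (induction w)
  case (Cons v w)
  show ?case
  proof (cases "w = []")
    case True
    then show ?thesis using Cons.prems by (simp add: le_pt_def)
  next
    case False
    then have "lattice_path w" "hd w \<in> {east v, north v}" using Cons.prems by (auto simp: lattice_path_Cons)
    moreover have "le_pt (hd w) (last w)" using lattice_path_hd_le \<open>lattice_path w\<close> False by simp
    ultimately show ?thesis
      using Cons.IH Cons.prems False by (auto simp: le_pt_def east_def north_def)
  qed
qed simp

lemma lattice_path_length: "lattice_path w \<Longrightarrow> diag (last w) = diag (hd w) + int (length w) - 1"
proof (induction w)
  case (Cons v w)
  then show ?case by (cases "w = []") (auto simp: lattice_path_Cons)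
qed (simp add: lattice_path_def)

text \<open>Arbitrary end points are allowed so that sources can be moved one at a time. For the end
  points of a hexagon this agrees with \<open>path_families\<close>.\<close>

definition families :: "(int \<times> int) set \<Rightarrow> (int \<times> int) set \<Rightarrow> (int \<times> int) list set set" where
  "families S T = {L. (\<forall>w\<in>L. lattice_path w) \<and>
     (\<forall>w\<in>L. \<forall>w'\<in>L. w \<noteq> w' \<longrightarrow> set w \<inter> set w' = {}) \<and> hd ` L = S \<and> last ` L = T}"

abbreviation support :: "'a list set \<Rightarrow> 'a set" where
  "support L \<equiv> \<Union>w\<in>L. set w"

lemma familiesD:
  assumes "L \<in> families S T"
  shows "\<And>w. w \<in> L \<Longrightarrow> lattice_path w"
    and "\<And>w. w \<in> L \<Longrightarrow> w \<noteq> []"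
    and "\<And>w w' p. w \<in> L \<Longrightarrow> w' \<in> L \<Longrightarrow> p \<in> set w \<Longrightarrow> p \<in> set w' \<Longrightarrow> w = w'"
    and "hd ` L = S" and "last ` L = T"
proof -
  have *: "\<forall>w\<in>L. \<forall>w'\<in>L. w \<noteq> w' \<longrightarrow> set w \<inter> set w' = {}"
    and **: "\<forall>w\<in>L. lattice_path w" "hd ` L = S" "last ` L = T"
    using assms unfolding families_def by blast+
  show "w = w'" if "w \<in> L" "w' \<in> L" "p \<in> set w" "p \<in> set w'" for w w' p
    using * that by blast
  show "lattice_path w" "w \<noteq> []" if "w \<in> L" for w
    using ** that by (auto dest: lattice_path_nonempty)
  show "hd ` L = S" "last ` L = T" by fact+
qed

lemma families_inj_hd: "L \<in> families S T \<Longrightarrow> inj_on hd L"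
  by (intro inj_onI) (metis familiesD(2,3) hd_in_set)

definition extend :: "'a \<Rightarrow> 'a \<Rightarrow> 'a list set \<Rightarrow> 'a list set" where
  "extend v c L = (\<lambda>w. if hd w = c then v # w else w) ` L"

lemma extend_inverse:
  assumes "v \<notin> hd ` L"
  shows "(\<lambda>w. if hd w = v then tl w else w) ` extend v c L = L"
proof -
  have "(\<lambda>w. if hd w = v then tl w else w) ` extend v c L = (\<lambda>w. w) ` L"
    unfolding extend_def image_image using assms by (intro image_cong) auto
  then show ?thesis by simp
qed

lemma support_extend:
  assumes "c \<in> hd ` L" shows "support (extend v c L) = insert v (support L)"
proof -
  have "support (extend v c L) = (\<Union>w\<in>L. set (if hd w = c then v # w else w))"
    by (simp only: extend_def image_image)
  also have "\<dots> = insert v (support L)"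
    using assms by (auto split: if_splits)
  finally show ?thesis .
qed

section \<open>Moving one minimal source by one step\<close>

context
  fixes S T :: "(int \<times> int) set" and v :: "int \<times> int"
  assumes v: "v \<in> S" "v \<notin> T" and minimal: "\<And>p. p \<in> S - {v} \<Longrightarrow> \<not> le_pt p v"
begin

text \<open>A path through \<open>v\<close> would start weakly below \<open>v\<close>. The new
  source \<open>c\<close> lies strictly above \<open>v\<close>, and the other sources are excluded
  by minimality.\<close>

lemma not_in_support_step:
  assumes "c \<in> {east v, north v}" "L \<in> families (insert c (S - {v})) T"
  shows "v \<notin> support L"
proof
  assume "v \<in> support L"
  then obtain w where w: "w \<in> L" "v \<in> set w" by auto
  then have "le_pt (hd w) v" using familiesD(1)[OF assms(2)] lattice_path_hd_le by blast
  moreover have "hd w \<in> insert c (S - {v})" using familiesD(4)[OF assms(2)] w by blast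
  moreover have "\<not> le_pt c v" using assms(1) by (auto simp: le_pt_def east_def north_def)
  ultimately show False using minimal by blast
qed

lemma extend_in_families:
  assumes c: "c \<in> {east v, north v}" "c \<notin> S" and L: "L \<in> families (insert c (S - {v})) T"
  shows "extend v c L \<in> families S T"
proof -
  have vL: "v \<notin> set w" if "w \<in> L" for w using not_in_support_step[OF c(1) L] that by auto
  have cv: "c \<noteq> v" using c v by auto
  show ?thesis
    unfolding families_def
  proof (intro CollectI conjI ballI impI)
    fix w assume "w \<in> extend v c L"
    then obtain w' where "w' \<in> L" "w = (if hd w' = c then v # w' else w')" by (auto simp: extend_def)
    then show "lattice_path w"
      using c familiesD(1,2)[OF L] by (auto simp: lattice_path_Cons)
  next
    fix w1 w2 assume w: "w1 \<in> extend v c L" "w2 \<in> extend v c L" "w1 \<noteq> w2"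
    obtain w1' where w1: "w1' \<in> L" "w1 = (if hd w1' = c then v # w1' else w1')"
      using w(1) by (auto simp: extend_def)
    obtain w2' where w2: "w2' \<in> L" "w2 = (if hd w2' = c then v # w2' else w2')"
      using w(2) by (auto simp: extend_def)
    have "w1' \<noteq> w2'" using w w1 w2 by auto
    then have "set w1' \<inter> set w2' = {}" using familiesD(3)[OF L] w1 w2 by blast
    moreover have "\<not> (hd w1' = c \<and> hd w2' = c)"
      using inj_onD[OF families_inj_hd[OF L]] w1 w2 \<open>w1' \<noteq> w2'\<close> by metis
    ultimately show "set w1 \<inter> set w2 = {}" using w1 w2 vL by auto
  next
    have "hd ` extend v c L = (\<lambda>q. if q = c then v else q) ` (hd ` L)"
      unfolding extend_def image_image by (intro image_cong) auto
    also have "\<dots> = S" unfolding familiesD(4)[OF L] using c v by auto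
    finally show "hd ` extend v c L = S" .
    have "last ` extend v c L = last ` L"
      unfolding extend_def image_image using familiesD(2)[OF L] by (intro image_cong) auto
    then show "last ` extend v c L = T" using familiesD(5)[OF L] by simp
  qed
qed

text \<open>The path from \<open>v\<close> has a second vertex because \<open>v\<close> is no sink,
  and this vertex is no source because the paths are disjoint. Deleting \<open>v\<close> inverts
  \<open>extend\<close>.\<close>

lemma families_step:
  "families S T = (\<Union>c\<in>{east v, north v} - S. extend v c ` families (insert c (S - {v})) T)"
proof (intro equalityI subsetI)
  fix L assume L: "L \<in> families S T"
  obtain w where w: "w \<in> L" "hd w = v" using familiesD(4)[OF L] v by force
  have "last w \<noteq> v" using familiesD(5)[OF L] v w by blast
  then have "w \<noteq> [v]" by auto
  then obtain w' where w': "w = v # w'" "w' \<noteq> []"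
    using familiesD(2)[OF L] w by (metis list.collapse)
  define c where "c = hd w'"
  have lp: "lattice_path w'" "c \<in> {east v, north v}"
    using familiesD(1)[OF L w(1)] w' by (auto simp: lattice_path_Cons c_def)
  have cw: "c \<in> set w" "c \<noteq> v" using w' lp by (auto simp: c_def east_def north_def prod_eq_iff)
  have cS: "c \<notin> S"
  proof
    assume "c \<in> S"
    then obtain w2 where "w2 \<in> L" "hd w2 = c" using familiesD(4)[OF L] by force
    then have "w2 = w" using familiesD(3)[OF L, of w2 w c] familiesD(2)[OF L] w cw by fastforce
    then show False using \<open>hd w2 = c\<close> w cw by simp
  qed
  define L' where "L' = insert w' (L - {w})"
  have hdL: "hd ` (L - {w}) = S - {v}"
    using families_inj_hd[OF L] w familiesD(4)[OF L]
    by (subst inj_on_image_set_diff[of hd L]) auto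
  have "L' \<in> families (insert c (S - {v})) T"
    unfolding families_def
  proof (intro CollectI conjI ballI impI)
    show "lattice_path x" if "x \<in> L'" for x using that lp familiesD(1)[OF L] by (auto simp: L'_def)
    show "hd ` L' = insert c (S - {v})" unfolding L'_def using hdL by (simp add: c_def)
    have "last ` L' = insert (last w) (last ` (L - {w}))" unfolding L'_def using w' by simp
    also have "\<dots> = last ` L" using w(1) by blast
    finally show "last ` L' = T" using familiesD(5)[OF L] by simp
  next
    fix x y assume xy: "x \<in> L'" "y \<in> L'" "x \<noteq> y"
    have "set w' \<subseteq> set w" using w' by auto
    then show "set x \<inter> set y = {}"
      using xy familiesD(3)[OF L] w(1) unfolding L'_def by blast
  qed
  moreover have "extend v c L' = L"
  proof -
    have "extend v c L' = insert w ((\<lambda>w. if hd w = c then v # w else w) ` (L - {w}))"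
      unfolding extend_def L'_def by (simp add: c_def[symmetric] w')
    also have "(\<lambda>w. if hd w = c then v # w else w) ` (L - {w}) = (\<lambda>w. w) ` (L - {w})"
    proof (intro image_cong refl)
      fix x assume "x \<in> L - {w}"
      then have "hd x \<in> S" using hdL by blast
      then show "(if hd x = c then v # x else x) = x" using cS by auto
    qed
    finally show ?thesis using w by auto
  qed
  ultimately show "L \<in> (\<Union>c\<in>{east v, north v} - S. extend v c ` families (insert c (S - {v})) T)"
    using lp(2) cS by blast
qed (auto intro: extend_in_families)

lemma extend_disjoint:
  assumes "c \<in> {east v, north v}" "c' \<in> {east v, north v}" "c \<noteq> c'" "c \<notin> S" "c' \<notin> S"
    and "L \<in> families (insert c (S - {v})) T" "L' \<in> families (insert c' (S - {v})) T"
  shows "extend v c L \<noteq> extend v c' L'"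
proof
  assume eq: "extend v c L = extend v c' L'"
  have mem: "extend v c L \<in> families S T" using extend_in_families assms by blast
  have "c \<in> hd ` L" "c' \<in> hd ` L'" using familiesD(4)[OF assms(6)] familiesD(4)[OF assms(7)] by simp_all
  then obtain w w' where w: "w \<in> L" "hd w = c" and w': "w' \<in> L'" "hd w' = c'" by auto
  have "v # w \<in> extend v c L" using w by (force simp: extend_def)
  moreover have "v # w' \<in> extend v c L" using w' unfolding eq by (force simp: extend_def)
  ultimately have "v # w = v # w'" using familiesD(3)[OF mem, of "v # w" "v # w'" v] by simp
  then show False using w w' assms(3) by auto
qed

lemma extend_inj:
  assumes "c \<in> {east v, north v}"
  shows "inj_on (extend v c) (families (insert c (S - {v})) T)"
proof (rule inj_on_inverseI)
  fix L assume L: "L \<in> families (insert c (S - {v})) T"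
  have "v \<notin> hd ` L" using familiesD(4)[OF L] assms by (auto simp: east_def north_def prod_eq_iff)
  then show "(\<lambda>w. if hd w = v then tl w else w) ` extend v c L = L" by (rule extend_inverse)
qed

lemma sum_families_step:
  assumes fin: "\<And>c. c \<in> {east v, north v} - S \<Longrightarrow> finite (families (insert c (S - {v})) T)"
    and finS: "finite S"
  shows "finite (families S T)"
    and "(\<Sum>L\<in>families S T. \<Prod>p\<in>support L. (B p :: 'a::field)) =
      (\<Sum>c\<in>{east v, north v} - S.
         B v * (\<Sum>L\<in>families (insert c (S - {v})) T. \<Prod>p\<in>support L. B p))"
proof -
  show "finite (families S T)" unfolding families_step using fin by auto
  have "(\<Sum>L\<in>families S T. \<Prod>p\<in>support L. B p) =
    (\<Sum>c\<in>{east v, north v} - S. \<Sum>L\<in>extend v c ` families (insert c (S - {v})) T. \<Prod>p\<in>support L. B p)"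
    unfolding families_step
  proof (rule sum.UNION_disjoint)
    show "\<forall>c\<in>{east v, north v} - S. \<forall>c'\<in>{east v, north v} - S. c \<noteq> c' \<longrightarrow>
      extend v c ` families (insert c (S - {v})) T \<inter> extend v c' ` families (insert c' (S - {v})) T = {}"
      using extend_disjoint by blast
  qed (use fin in auto)
  also have "\<dots> = (\<Sum>c\<in>{east v, north v} - S.
         B v * (\<Sum>L\<in>families (insert c (S - {v})) T. \<Prod>p\<in>support L. B p))"
  proof (intro sum.cong refl)
    fix c assume c: "c \<in> {east v, north v} - S"
    have "(\<Sum>L\<in>extend v c ` families (insert c (S - {v})) T. \<Prod>p\<in>support L. B p) =
      (\<Sum>L\<in>families (insert c (S - {v})) T. \<Prod>p\<in>support (extend v c L). B p)"
      using c by (subst sum.reindex[OF extend_inj]) auto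
    also have "\<dots> = (\<Sum>L\<in>families (insert c (S - {v})) T. B v * (\<Prod>p\<in>support L. B p))"
    proof (intro sum.cong refl)
      fix L assume L: "L \<in> families (insert c (S - {v})) T"
      have "finite L"
        using finite_imageD[OF _ families_inj_hd[OF L]] familiesD(4)[OF L] finS by simp
      moreover have "c \<in> hd ` L" using familiesD(4)[OF L] by simp
      moreover have "v \<notin> support L" using not_in_support_step[OF _ L] c by blast
      ultimately show "(\<Prod>p\<in>support (extend v c L). B p) = B v * (\<Prod>p\<in>support L. B p)"
        by (subst support_extend) auto
    qed
    finally show "(\<Sum>L\<in>extend v c ` families (insert c (S - {v})) T. \<Prod>p\<in>support L. B p) =
      B v * (\<Sum>L\<in>families (insert c (S - {v})) T. \<Prod>p\<in>support L. B p)"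
      by (simp add: sum_distrib_left)
  qed
  finally show "(\<Sum>L\<in>families S T. \<Prod>p\<in>support L. B p) = (\<Sum>c\<in>{east v, north v} - S.
         B v * (\<Sum>L\<in>families (insert c (S - {v})) T. \<Prod>p\<in>support L. B p))" .
qed

end

text \<open>Each path has length 1, since its length is read off from the antidiagonals of its ends.
  The inductions over moving sources stop here.\<close>

lemma families_antidiagonal:
  assumes "\<And>p. p \<in> S \<Longrightarrow> diag p = D" "\<And>t. t \<in> T \<Longrightarrow> diag t = D"
  shows "families S T = (if S = T then {(\<lambda>p. [p]) ` S} else {})"
proof -
  have *: "S = T \<and> L = (\<lambda>p. [p]) ` S" if L: "L \<in> families S T" for L
  proof -
    have w: "w = [hd w]" "last w = hd w" if "w \<in> L" for w
    proof -
      have "hd w \<in> S" "last w \<in> T" using familiesD(4,5)[OF L] that by auto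
      then have "int (length w) = 1"
        using lattice_path_length[OF familiesD(1)[OF L that]] assms by fastforce
      then show "w = [hd w]" by (cases w) auto
      then show "last w = hd w" by (metis last.simps)
    qed
    have "T = S" using familiesD(4,5)[OF L] w(2) by (metis image_cong)
    moreover have "L = (\<lambda>w. [hd w]) ` L" using w(1) by force
    then have "L = (\<lambda>p. [p]) ` (hd ` L)" by (simp add: image_image)
    ultimately show ?thesis using familiesD(4)[OF L] by simp
  qed
  have "(\<lambda>p. [p]) ` S \<in> families S S"
    unfolding families_def by (auto simp: image_image)
  then show ?thesis using * by auto
qed

text \<open>The vertex set determines the family. The source \<open>v\<close> to be moved is the northwesternmost one on
  the lowest antidiagonal: if its path goes east, then no other path can reach \<open>north v\<close>.\<close>

lemma support_inj:
  assumes "finite S" "\<And>p. p \<in> S \<Longrightarrow> diag p \<le> D" "\<And>t. t \<in> T \<Longrightarrow> diag t = D"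
  shows "inj_on support (families S T)"
  using assms(1,2)
proof (induction "\<Sum>p\<in>S. nat (D - diag p)" arbitrary: S rule: less_induct)
  case less
  show ?case
  proof (cases "\<forall>p\<in>S. diag p = D")
    case True
    then have "families S T = (if S = T then {(\<lambda>p. [p]) ` S} else {})"
      by (intro families_antidiagonal[where D = D]) (use assms(3) in auto)
    then show ?thesis by auto
  next
    case False
    define d where "d = Min (diag ` S)"
    have "S \<noteq> {}" using False by auto
    then have "d \<in> diag ` S" unfolding d_def using less.prems(1) by (intro Min_in) auto
    have dmin: "d \<le> diag p" if "p \<in> S" for p using that less.prems(1) by (simp add: d_def)
    have "d < D" using False dmin less.prems(2) by force
    define Sd where "Sd = {p\<in>S. diag p = d}"
    have Sd: "Sd \<noteq> {}" "finite Sd" using \<open>d \<in> diag ` S\<close> less.prems(1) by (auto simp: Sd_def)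
    have "Max (snd ` Sd) \<in> snd ` Sd" using Sd by (intro Max_in) auto
    then obtain v where v: "v \<in> Sd" "snd v = Max (snd ` Sd)" by auto
    have vmax: "snd p \<le> snd v" if "p \<in> Sd" for p using that Sd v(2) by simp
    have vS: "v \<in> S" "diag v = d" using v(1) by (auto simp: Sd_def)
    have vT: "v \<notin> T" using vS \<open>d < D\<close> assms(3)[of v] by auto
    have minimal: "\<not> le_pt p v" if "p \<in> S - {v}" for p
      using dmin[of p] that vS by (auto simp: le_pt_def diag_def prod_eq_iff)
    have step: "families S T = (\<Union>c\<in>{east v, north v} - S. extend v c ` families (insert c (S - {v})) T)"
      by (rule families_step[OF vS(1) vT]) (rule minimal)
    have supp: "support (extend v c L) = insert v (support L)" "v \<notin> support L"
      if "c \<in> {east v, north v}" "L \<in> families (insert c (S - {v})) T" for c L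
      using support_extend[of c L v] familiesD(4)[OF that(2)]
        not_in_support_step[OF vS(1) vT minimal that] by simp_all
    have IH: "inj_on support (families (insert c (S - {v})) T)"
      if c: "c \<in> {east v, north v} - S" for c
    proof (rule less.hyps)
      have "diag c = diag v + 1" using c by auto
      then show "diag p \<le> D" if "p \<in> insert c (S - {v})" for p
        using that less.prems(2)[of p] vS \<open>d < D\<close> by auto
      have "(\<Sum>p\<in>insert c (S - {v}). nat (D - diag p)) =
        nat (D - diag c) + (\<Sum>p\<in>S - {v}. nat (D - diag p))"
        using c less.prems(1) by (subst sum.insert) auto
      also have "\<dots> < nat (D - diag v) + (\<Sum>p\<in>S - {v}. nat (D - diag p))"
        using \<open>diag c = diag v + 1\<close> \<open>d < D\<close> vS by simp
      also have "\<dots> = (\<Sum>p\<in>S. nat (D - diag p))"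
        using less.prems(1) vS(1) by (simp add: sum.remove)
      finally show "(\<Sum>p\<in>insert c (S - {v}). nat (D - diag p)) < (\<Sum>p\<in>S. nat (D - diag p))" .
    qed (use less.prems(1) in auto)
    have north: "north v \<notin> support L"
      if L: "L \<in> families (insert (east v) (S - {v})) T" and "north v \<notin> S" for L
    proof
      assume "north v \<in> support L"
      then obtain w where w: "w \<in> L" "north v \<in> set w" by auto
      then have le: "le_pt (hd w) (north v)" using familiesD(1)[OF L] lattice_path_hd_le by blast
      have hd: "hd w \<in> insert (east v) (S - {v})" using familiesD(4)[OF L] w by blast
      have "hd w \<noteq> east v" using le by (auto simp: le_pt_def east_def north_def)
      then have *: "hd w \<in> S" "hd w \<noteq> v" "hd w \<noteq> north v" using hd that(2) by auto
      then have "diag (hd w) < diag (north v)"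
        using le by (auto simp: le_pt_def diag_def north_def prod_eq_iff)
      then have "diag (hd w) = d" using dmin[OF *(1)] vS by simp
      then have "snd (hd w) \<le> snd v" using * vmax by (simp add: Sd_def)
      then show False using le \<open>diag (hd w) = d\<close> *(2) vS
        by (auto simp: le_pt_def diag_def north_def prod_eq_iff)
    qed
    show ?thesis
    proof (rule inj_onI)
      fix L1 L2 assume L: "L1 \<in> families S T" "L2 \<in> families S T" and eq: "support L1 = support L2"
      have ex: "\<exists>c L'. c \<in> {east v, north v} - S \<and> L' \<in> families (insert c (S - {v})) T \<and>
        L = extend v c L'" if "L \<in> families S T" for L
        using that unfolding step by (elim UN_E imageE) (intro exI conjI)
      obtain c1 L1' where L1: "c1 \<in> {east v, north v} - S"
        "L1' \<in> families (insert c1 (S - {v})) T" "L1 = extend v c1 L1'" using ex[OF L(1)] by auto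
      obtain c2 L2' where L2: "c2 \<in> {east v, north v} - S"
        "L2' \<in> families (insert c2 (S - {v})) T" "L2 = extend v c2 L2'" using ex[OF L(2)] by auto
      have supp_eq: "support L1' = support L2'"
        using eq supp[OF _ L1(2)] supp[OF _ L2(2)] L1 L2 by auto
      have c_in: "c1 \<in> support L1'" "c2 \<in> support L2'"
        using familiesD(2,4)[OF L1(2)] familiesD(2,4)[OF L2(2)]
        by (metis UN_I hd_in_set imageE insertI1)+
      have "c1 = c2"
      proof (rule ccontr)
        assume "c1 \<noteq> c2"
        then consider "c1 = east v" "c2 = north v" | "c1 = north v" "c2 = east v" using L1 L2 by auto
        then show False
        proof cases
          case 1
          then show False using north[of L1'] L1 L2 c_in supp_eq by auto
        next
          case 2
          then show False using north[of L2'] L1 L2 c_in supp_eq by auto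
        qed
      qed
      then show "L1 = L2" using inj_onD[OF IH[OF L1(1)] supp_eq L1(2)] L1 L2 by simp
    qed
  qed
qed

section \<open>Generating functions of single paths\<close>

primrec path_sum_len :: "(int \<times> int \<Rightarrow> 'a::field) \<Rightarrow> nat \<Rightarrow> int \<times> int \<Rightarrow> int \<times> int \<Rightarrow> 'a" where
  "path_sum_len B 0 p q = (if p = q then B p else 0)"
| "path_sum_len B (Suc n) p q = B p * (path_sum_len B n (east p) q + path_sum_len B n (north p) q)"

text \<open>All paths from \<open>p\<close> to \<open>q\<close> have \<open>diag q - diag p\<close>
  steps, so fixing the number of steps loses none.\<close>

definition path_sum :: "(int \<times> int \<Rightarrow> 'a::field) \<Rightarrow> int \<times> int \<Rightarrow> int \<times> int \<Rightarrow> 'a" where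
  "path_sum B p q = (if diag p \<le> diag q then path_sum_len B (nat (diag q - diag p)) p q else 0)"

text \<open>The recursion read from the other end, as needed for moving sinks.\<close>

lemma path_sum_len_last:
  "path_sum_len B (Suc n) p q = (path_sum_len B n p (fst q - 1, snd q) + path_sum_len B n p (fst q, snd q - 1)) * B q"
proof (induction n arbitrary: p)
  case 0
  have "east p = q \<longleftrightarrow> p = (fst q - 1, snd q)" "north p = q \<longleftrightarrow> p = (fst q, snd q - 1)"
    by (auto simp: east_def north_def prod_eq_iff)
  then show ?case by (auto simp: algebra_simps)
next
  case (Suc n)
  have "path_sum_len B (Suc (Suc n)) p q = B p * (path_sum_len B (Suc n) (east p) q + path_sum_len B (Suc n) (north p) q)"
    by (rule path_sum_len.simps)
  then show ?case unfolding Suc.IH by (simp add: algebra_simps)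
qed

lemma path_sum_first:
  assumes "diag p < diag q" shows "path_sum B p q = B p * (path_sum B (east p) q + path_sum B (north p) q)"
proof -
  have "nat (diag q - diag p) = Suc (nat (diag q - (diag p + 1)))" using assms by simp
  then show ?thesis using assms by (simp add: path_sum_def)
qed

lemma path_sum_last:
  assumes "diag p < diag q"
  shows "path_sum B p q = B q * (path_sum B p (fst q - 1, snd q) + path_sum B p (fst q, snd q - 1))"
proof -
  have n: "nat (diag q - diag p) = Suc (nat (diag q - 1 - diag p))" using assms by simp
  have "diag (fst q - 1, snd q) = diag q - 1" "diag (fst q, snd q - 1) = diag q - 1"
    by (simp_all add: diag_def)
  then show ?thesis using assms unfolding path_sum_def n path_sum_len_last by simp
qed

lemma path_sum_diag: "diag p = diag q \<Longrightarrow> path_sum B p q = (if p = q then B p else 0)"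
  by (simp add: path_sum_def)

lemma path_sum_len_not_le: "\<not> le_pt p q \<Longrightarrow> path_sum_len B n p q = 0"
  by (induction n arbitrary: p) (auto simp: le_pt_def east_def north_def)

lemma path_sum_not_le: "\<not> le_pt p q \<Longrightarrow> path_sum B p q = 0"
  by (simp add: path_sum_def path_sum_len_not_le)

lemma path_sum_len_transform:
  assumes "\<And>p. \<tau> (east p) = east (\<tau> p)" "\<And>p. \<tau> (north p) = north (\<tau> p)" "inj \<tau>"
  shows "path_sum_len (\<lambda>p. B (\<tau> p)) n p q = path_sum_len B n (\<tau> p) (\<tau> q)"
  using assms(3) by (induction n arbitrary: p) (auto simp: assms inj_eq)

lemma path_sum_shift:
  "path_sum (\<lambda>(u, v). B (u - a, v - b)) p q = path_sum B (fst p - a, snd p - b) (fst q - a, snd q - b)"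
proof -
  have "path_sum_len (\<lambda>p. B (fst p - a, snd p - b)) n p q = path_sum_len B n (fst p - a, snd p - b) (fst q - a, snd q - b)" for n
    by (rule path_sum_len_transform) (auto simp: east_def north_def inj_def prod_eq_iff)
  then have "path_sum_len (\<lambda>(u, v). B (u - a, v - b)) n p q = path_sum_len B n (fst p - a, snd p - b) (fst q - a, snd q - b)" for n
    by (simp add: case_prod_beta')
  then show ?thesis by (simp add: path_sum_def diag_def algebra_simps)
qed

lemma path_sum_len_swap: "path_sum_len (\<lambda>p. B (prod.swap p)) n p q = path_sum_len B n (prod.swap p) (prod.swap q)"
proof (induction n arbitrary: p)
  case (Suc n)
  have "prod.swap (east p) = north (prod.swap p)" "prod.swap (north p) = east (prod.swap p)"
    by (simp_all add: east_def north_def prod.swap_def)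
  then show ?case by (simp add: Suc add.commute)
qed (auto simp: prod_eq_iff)

lemma path_sum_swap: "path_sum (\<lambda>p. B (prod.swap p)) p q = path_sum B (prod.swap p) (prod.swap q)"
  by (simp add: path_sum_def path_sum_len_swap diag_def add.commute)

text \<open>Reflecting a path in the origin and traversing it backwards gives a lattice path again,
  with its ends exchanged.\<close>

lemma path_sum_len_uminus:
  "path_sum_len (\<lambda>p. B (- fst p, - snd p)) n p q = path_sum_len B n (- fst q, - snd q) (- fst p, - snd p)"
proof (induction n arbitrary: p)
  case (Suc n)
  show ?case unfolding path_sum_len_last[of B n "(- fst q, - snd q)"]
    by (simp add: Suc) (simp add: east_def north_def mult.commute)
qed (auto simp: prod_eq_iff)

lemma path_sum_uminus:
  "path_sum (\<lambda>p. B (- fst p, - snd p)) p q = path_sum B (- fst q, - snd q) (- fst p, - snd p)"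
  by (simp add: path_sum_def path_sum_len_uminus diag_def algebra_simps)

text \<open>The order runs from southeast to northwest. It is weak in each coordinate because moved
  sources lie on different antidiagonals and may share a row or a column.\<close>

definition chain :: "(int \<times> int) list \<Rightarrow> bool" where
  "chain ps \<longleftrightarrow> (\<forall>i j. i < j \<longrightarrow> j < length ps \<longrightarrow>
     fst (ps ! j) \<le> fst (ps ! i) \<and> snd (ps ! i) \<le> snd (ps ! j) \<and> ps ! i \<noteq> ps ! j)"

lemma chain_distinct: "chain ps \<Longrightarrow> distinct ps"
  unfolding chain_def distinct_conv_nth by (metis nat_neq_iff)

lemma chain_antidiagonal_unique:
  assumes "chain ps" "chain qs" "\<And>p. p \<in> set ps \<Longrightarrow> diag p = D" "set ps = set qs"
  shows "ps = qs"
proof -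
  have mono: "sorted_wrt (<) (map snd xs)" if "chain xs" "\<And>p. p \<in> set xs \<Longrightarrow> diag p = D" for xs
    unfolding sorted_wrt_iff_nth_less
  proof (intro allI impI)
    fix i j assume ij: "i < j" "j < length (map snd xs)"
    then have "diag (xs ! i) = D" "diag (xs ! j) = D" using that(2) by auto
    moreover have "snd (xs ! i) \<le> snd (xs ! j) \<and> xs ! i \<noteq> xs ! j"
      using that(1) ij by (simp add: chain_def)
    ultimately show "map snd xs ! i < map snd xs ! j"
      using ij by (auto simp: diag_def prod_eq_iff)
  qed
  have "map snd ps = map snd qs"
    by (rule strict_sorted_equal) (use mono assms in auto)
  then have "length ps = length qs" "\<And>i. i < length ps \<Longrightarrow> snd (ps ! i) = snd (qs ! i)"
    by (metis length_map, metis length_map nth_map)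
  moreover have "ps ! i = qs ! i" if "i < length ps" for i
  proof -
    have "ps ! i \<in> set ps" "qs ! i \<in> set qs" using calculation(1) that by (simp_all only: nth_mem)
    then have "diag (ps ! i) = D" "diag (qs ! i) = D" unfolding assms(4)[symmetric] by (simp_all only: assms(3))
    then show ?thesis using calculation(2)[OF that] by (auto simp: diag_def prod_eq_iff)
  qed
  ultimately show ?thesis by (intro nth_equalityI)
qed

text \<open>No other source is on a lower antidiagonal, so one to the northwest is strictly further
  north, and one to the southeast strictly further east. A unit step then preserves the order unless
  two sources collide.\<close>

lemma chain_update:
  assumes "chain ps" "i < length ps" "\<And>p. p \<in> set ps \<Longrightarrow> diag (ps ! i) \<le> diag p"
    and "c \<in> {east (ps ! i), north (ps ! i)}" "c \<notin> set ps"
  shows "chain (ps[i := c])"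
  unfolding chain_def
proof (intro allI impI)
  fix j k assume jk: "j < k" "k < length (ps[i := c])"
  then have kl: "k < length ps" "j < length ps" by auto
  have ord: "fst (ps ! k) \<le> fst (ps ! j) \<and> snd (ps ! j) \<le> snd (ps ! k) \<and> ps ! j \<noteq> ps ! k"
    using assms(1) jk kl by (simp add: chain_def)
  have mem: "ps ! j \<in> set ps" "ps ! k \<in> set ps" using kl by auto
  have ne: "ps ! j \<noteq> c" "ps ! k \<noteq> c" using mem assms(5) by auto
  show "fst (ps[i := c] ! k) \<le> fst (ps[i := c] ! j) \<and> snd (ps[i := c] ! j) \<le> snd (ps[i := c] ! k) \<and>
    ps[i := c] ! j \<noteq> ps[i := c] ! k"
  proof -
    consider "i = j" | "i = k" | "i \<noteq> j" "i \<noteq> k" by blast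
    then show ?thesis
    proof cases
      case 1
      then show ?thesis using jk kl ord ne assms(3)[OF mem(2)] assms(4)
        by (auto simp: east_def north_def diag_def prod_eq_iff)
    next
      case 2
      then show ?thesis using jk kl ord ne assms(3)[OF mem(1)] assms(4)
        by (auto simp: east_def north_def diag_def prod_eq_iff)
    next
      case 3
      then show ?thesis using ord by simp
    qed
  qed
qed

text \<open>A source on the lowest antidiagonal is moved one step at a time. On the determinant side this is
  linearity in one row, and a collision of two sources gives two equal rows; no sign-reversing
  involution is needed, because the sources remain in the same order throughout.\<close>

theorem lindstroem_gessel_viennot:
  assumes "length ps = n" "length ts = n" "chain ps" "chain ts"
    and "\<And>t. t \<in> set ts \<Longrightarrow> diag t = D" "\<And>p. p \<in> set ps \<Longrightarrow> diag p \<le> D"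
  shows "finite (families (set ps) (set ts)) \<and>
    (\<Sum>L\<in>families (set ps) (set ts). \<Prod>p\<in>support L. B p) = fdet n (\<lambda>x y. path_sum B (ps ! x) (ts ! y))"
  using assms(1,3,6)
proof (induction "\<Sum>x<n. nat (D - diag (ps ! x))" arbitrary: ps rule: less_induct)
  case less
  show ?case
  proof (cases "\<forall>p\<in>set ps. diag p = D")
    case True
    have fam: "families (set ps) (set ts) = (if set ps = set ts then {(\<lambda>p. [p]) ` set ps} else {})"
      by (rule families_antidiagonal[where D = D]) (use True assms in auto)
    show ?thesis
    proof (cases "set ps = set ts")
      case eq: True
      have "ps = ts" using chain_antidiagonal_unique[OF less.prems(2) assms(4)] True eq by blast
      have "fdet n (\<lambda>x y. path_sum B (ps ! x) (ts ! y)) = fdet n (\<lambda>x y. B (ps ! x) * (if x = y then 1 else 0))"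
      proof (rule fdet_cong)
        fix x y assume xy: "x < n" "y < n"
        then have "diag (ps ! x) = diag (ps ! y)" using True less.prems(1) by auto
        moreover have "ps ! x = ps ! y \<longleftrightarrow> x = y"
          using chain_distinct[OF less.prems(2)] xy less.prems(1) by (simp add: nth_eq_iff_index_eq)
        ultimately show "path_sum B (ps ! x) (ts ! y) = B (ps ! x) * (if x = y then 1 else 0)"
          using \<open>ps = ts\<close> by (auto simp: path_sum_diag)
      qed
      also have "\<dots> = (\<Prod>x<n. B (ps ! x)) * fdet n (\<lambda>x y. if x = y then 1 else 0)"
        by (rule fdet_scale_rows)
      also have "fdet n (\<lambda>x y. if x = y then 1 else (0::'a)) = 1"
        unfolding fdet_def by (metis one_mat_def det_one)
      also have "(\<Prod>x<n. B (ps ! x)) = (\<Prod>p\<in>set ps. B p)"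
        using chain_distinct[OF less.prems(2)] less.prems(1)
        by (simp add: prod.distinct_set_conv_list prod.list_conv_set_nth lessThan_atLeast0)
      finally show ?thesis unfolding fam using eq by simp
    next
      case False
      \<comment> \<open>Both lists have \<open>n\<close> distinct entries, so different sets leave
        some source that is no sink; its row vanishes.\<close>
      have "\<not> set ps \<subseteq> set ts"
        using False card_subset_eq[of "set ts" "set ps"] chain_distinct less.prems assms
        by (auto simp: distinct_card)
      then obtain p where "p \<in> set ps" "p \<notin> set ts" by blast
      then obtain x where x: "x < n" "ps ! x \<notin> set ts"
        using less.prems(1) by (metis in_set_conv_nth)
      have "fdet n (\<lambda>x y. path_sum B (ps ! x) (ts ! y)) = 0"
      proof (rule fdet_zero_row[OF x(1)])
        fix y assume y: "y < n"
        then have "ts ! y \<in> set ts" using assms(2) by simp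
        then have "ps ! x \<noteq> ts ! y" "diag (ts ! y) = D" using x assms(5) by auto
        moreover have "diag (ps ! x) = D" using True x less.prems(1) by auto
        ultimately show "path_sum B (ps ! x) (ts ! y) = 0" by (simp add: path_sum_diag)
      qed
      then show ?thesis unfolding fam using False by simp
    qed
  next
    case False
    define d where "d = Min (diag ` set ps)"
    have "set ps \<noteq> {}" using False by auto
    then have "d \<in> diag ` set ps" unfolding d_def by (intro Min_in) auto
    have dmin: "d \<le> diag p" if "p \<in> set ps" for p using that by (simp add: d_def)
    have "d < D" using False dmin less.prems(3) by force
    obtain i where i: "i < n" "diag (ps ! i) = d"
      using \<open>d \<in> diag ` set ps\<close> less.prems(1) by (auto simp: in_set_conv_nth)
    define v where "v = ps ! i"
    have vS: "v \<in> set ps" "diag v = d" using i less.prems(1) by (auto simp: v_def)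
    have vT: "v \<notin> set ts" using vS \<open>d < D\<close> assms(5)[of v] by auto
    have minimal: "\<not> le_pt p v" if "p \<in> set ps - {v}" for p
      using dmin[of p] that vS by (auto simp: le_pt_def diag_def prod_eq_iff)
    let ?f = "\<lambda>x y. path_sum B (ps ! x) (ts ! y)"
    have set_upd: "set (ps[i := c]) = insert c (set ps - {v})" for c
      using i less.prems(1) chain_distinct[OF less.prems(2)] by (simp add: set_update_distinct v_def)
    have fdet_upd: "fdet n (?f(i := \<lambda>y. path_sum B c (ts ! y))) = fdet n (\<lambda>x y. path_sum B (ps[i := c] ! x) (ts ! y))" for c
      using i less.prems(1) by (intro fdet_cong) (auto simp: nth_list_update)
    have IH: "finite (families (insert c (set ps - {v})) (set ts)) \<and>
      (\<Sum>L\<in>families (insert c (set ps - {v})) (set ts). \<Prod>p\<in>support L. B p) =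
        fdet n (?f(i := \<lambda>y. path_sum B c (ts ! y)))" if c: "c \<in> {east v, north v} - set ps" for c
      unfolding fdet_upd set_upd[symmetric]
    proof (rule less.hyps)
      show "length (ps[i := c]) = n" using less.prems(1) by simp
      show "chain (ps[i := c])"
        by (rule chain_update) (use c i less.prems dmin v_def in auto)
      have dc: "diag c = d + 1" using c vS by auto
      show "diag p \<le> D" if "p \<in> set (ps[i := c])" for p
        using that less.prems(3)[of p] dc \<open>d < D\<close> unfolding set_upd by auto
      show "(\<Sum>x<n. nat (D - diag (ps[i := c] ! x))) < (\<Sum>x<n. nat (D - diag (ps ! x)))"
        by (rule sum_strict_mono_ex1)
          (use i dc \<open>d < D\<close> less.prems(1) in \<open>auto simp: nth_list_update intro!: bexI[of _ i]\<close>)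
    qed
    have zero: "fdet n (?f(i := \<lambda>y. path_sum B c (ts ! y))) = 0" if c: "c \<in> {east v, north v}" "c \<in> set ps" for c
    proof -
      obtain j where j: "j < n" "ps ! j = c" using c less.prems(1) by (auto simp: in_set_conv_nth)
      have "j \<noteq> i" using j c by (auto simp: v_def east_def north_def prod_eq_iff)
      then show ?thesis using i j by (intro fdet_equal_rows[of i n j]) auto
    qed
    have fin: "finite (families (set ps) (set ts))"
      by (rule sum_families_step(1)[OF vS(1) vT minimal]) (use IH in auto)
    have "(\<Sum>L\<in>families (set ps) (set ts). \<Prod>p\<in>support L. B p) =
      (\<Sum>c\<in>{east v, north v} - set ps.
         B v * (\<Sum>L\<in>families (insert c (set ps - {v})) (set ts). \<Prod>p\<in>support L. B p))"
      by (rule sum_families_step(2)[OF vS(1) vT minimal]) (use IH in auto)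
    also have "\<dots> = (\<Sum>c\<in>{east v, north v} - set ps. B v * fdet n (?f(i := \<lambda>y. path_sum B c (ts ! y))))"
      using IH by (intro sum.cong refl) simp
    also have "\<dots> = (\<Sum>c\<in>{east v, north v}. B v * fdet n (?f(i := \<lambda>y. path_sum B c (ts ! y))))"
      by (rule sum.mono_neutral_left) (use zero in auto)
    also have "\<dots> = B v * (fdet n (?f(i := \<lambda>y. path_sum B (east v) (ts ! y))) +
        fdet n (?f(i := \<lambda>y. path_sum B (north v) (ts ! y))))"
      using east_neq_north[of v] by (simp add: distrib_left)
    also have "\<dots> = fdet n (?f(i := \<lambda>y. B v * (path_sum B (east v) (ts ! y) + path_sum B (north v) (ts ! y))))"
      using i(1) by (simp add: fdet_row_scale fdet_row_add)
    also have "\<dots> = fdet n ?f"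
    proof (rule fdet_cong)
      fix x y assume "x < n" "y < n"
      then have "diag (ts ! y) = D" using assms(2,5) by auto
      then show "(?f(i := \<lambda>y. B v * (path_sum B (east v) (ts ! y) + path_sum B (north v) (ts ! y)))) x y = ?f x y"
        using path_sum_first[of v "ts ! y" B] vS \<open>d < D\<close> by (auto simp: v_def)
    qed
    finally show ?thesis using fin by blast
  qed
qed

text \<open>Prefixing every path by the same step keeps the family disjoint: the new vertices are
  translates of distinct heads and lie on an antidiagonal below all old paths.\<close>

lemma families_nonempty_step:
  assumes e: "step = east \<or> step = north" and S: "\<And>p. p \<in> S \<Longrightarrow> diag p = d"
    and ne: "families (step ` S) T \<noteq> {}"
  shows "families S T \<noteq> {}"
proof -
  obtain L where L: "L \<in> families (step ` S) T" using ne by auto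
  define prev where "prev = inv_into UNIV step"
  have "inj step" using e by (auto simp: inj_def east_def north_def prod_eq_iff)
  then have prev: "prev (step p) = p" for p by (simp add: prev_def)
  have hdS: "hd w \<in> step ` S" if "w \<in> L" for w using familiesD(4)[OF L] that by blast
  have bS: "prev (hd w) \<in> S" "step (prev (hd w)) = hd w" if "w \<in> L" for w
    using hdS[OF that] prev by auto
  have notin: "prev (hd w) \<notin> set w'" if "w \<in> L" "w' \<in> L" for w w'
  proof
    assume "prev (hd w) \<in> set w'"
    then have "le_pt (hd w') (prev (hd w))" using lattice_path_hd_le familiesD(1)[OF L that(2)] by blast
    then have "diag (hd w') \<le> d" using S[OF bS(1)[OF that(1)]] by (auto simp: le_pt_def diag_def)
    moreover have "diag (hd w') = d + 1" using hdS[OF that(2)] S e by auto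
    ultimately show False by simp
  qed
  have "(\<lambda>w. prev (hd w) # w) ` L \<in> families S T"
    unfolding families_def
  proof (intro CollectI conjI ballI impI)
    fix w assume "w \<in> (\<lambda>w. prev (hd w) # w) ` L"
    then obtain w' where w': "w' \<in> L" "w = prev (hd w') # w'" by auto
    then show "lattice_path w"
      using familiesD(1,2)[OF L w'(1)] bS(2)[OF w'(1)] e by (auto simp: lattice_path_Cons)
  next
    fix w1 w2 assume w: "w1 \<in> (\<lambda>w. prev (hd w) # w) ` L" "w2 \<in> (\<lambda>w. prev (hd w) # w) ` L" "w1 \<noteq> w2"
    obtain w1' w2' where w': "w1' \<in> L" "w1 = prev (hd w1') # w1'" "w2' \<in> L" "w2 = prev (hd w2') # w2'"
      using w by auto
    then have "w1' \<noteq> w2'" using w by auto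
    then have "set w1' \<inter> set w2' = {}" "hd w1' \<noteq> hd w2'"
      using familiesD(3)[OF L] inj_onD[OF families_inj_hd[OF L]] w' by blast+
    moreover have "prev (hd w1') \<noteq> prev (hd w2')" using calculation(2) bS(2) w' by metis
    ultimately show "set w1 \<inter> set w2 = {}" using w' notin by auto
  next
    have "hd ` (\<lambda>w. prev (hd w) # w) ` L = prev ` (hd ` L)" by (simp add: image_image)
    also have "\<dots> = S" unfolding familiesD(4)[OF L] by (simp add: image_image prev)
    finally show "hd ` (\<lambda>w. prev (hd w) # w) ` L = S" .
    have "last ` (\<lambda>w. prev (hd w) # w) ` L = last ` L"
      unfolding image_image using familiesD(2)[OF L] by (intro image_cong) auto
    then show "last ` (\<lambda>w. prev (hd w) # w) ` L = T" using familiesD(5)[OF L] by simp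
  qed
  then show ?thesis by auto
qed

text \<open>The sources are pushed in a direction with room left until they coincide with the sinks.
  Nonvanishing of \<open>Phi\<close> needs at least one monomial.\<close>

lemma families_sources_sinks_nonempty:
  assumes "K \<le> b - a + 1" "K \<le> d - c + 1"
  shows "families (sources K a c) (sinks b d K) \<noteq> {}"
  using assms
proof (induction "nat (b - a) + nat (d - c)" arbitrary: a c rule: less_induct)
  case less
  have source: "diag p = a + c + K - 1" if "p \<in> sources K a c" for p
    using that by (auto simp: sources_def diag_def)
  show ?case
  proof (cases "K \<ge> 1")
    case False
    then show ?thesis
      using families_antidiagonal[of "{}" 0 "{}"] by (simp add: sources_def sinks_def)
  next
    case True
    consider "K \<le> b - a" | "K \<le> d - c" | "K = b - a + 1" "K = d - c + 1" using less.prems by linarith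
    then show ?thesis
    proof cases
      case 1
      have "families (sources K (a + 1) c) (sinks b d K) \<noteq> {}"
        by (rule less.hyps) (use 1 True less.prems in auto)
      moreover have "sources K (a + 1) c = east ` sources K a c"
        unfolding sources_def image_image by (intro image_cong) (auto simp: east_def)
      ultimately show ?thesis using families_nonempty_step source by metis
    next
      case 2
      have "families (sources K a (c + 1)) (sinks b d K) \<noteq> {}"
        by (rule less.hyps) (use 2 True less.prems in auto)
      moreover have "sources K a (c + 1) = north ` sources K a c"
        unfolding sources_def image_image by (intro image_cong) (auto simp: north_def)
      ultimately show ?thesis using families_nonempty_step source by metis
    next
      case 3
      have "sources K a c = sinks b d K"
        unfolding sources_def sinks_def using 3 by (intro image_cong) auto
      then show ?thesis using families_antidiagonal[of "sources K a c" _ "sources K a c"] source by simp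
    qed
  qed
qed

section \<open>The polynomials as determinants\<close>

text \<open>The reversal \<open>J\<close> is multiplied on both sides, so its sign cancels by
  \<open>J * J = 1\<close>.\<close>

lemma fdet_reverse: "fdet n (\<lambda>x y. f (n - 1 - x) (n - 1 - y)) = fdet n f"
proof -
  define J :: "nat \<Rightarrow> nat \<Rightarrow> 'a" where "J = (\<lambda>x y. if y = n - 1 - x then 1 else 0)"
  have J: "(\<Sum>y<n. J x y * g y) = g (n - 1 - x)" if "x < n" for x g
  proof -
    have "(\<Sum>y<n. J x y * g y) = (\<Sum>y<n. if y = n - 1 - x then g y else 0)"
      by (intro sum.cong) (auto simp: J_def)
    then show ?thesis using that by simp
  qed
  have "fdet n J * fdet n J = fdet n (\<lambda>x z. if x = z then 1 else 0)"
    unfolding fdet_mult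
  proof (rule fdet_cong)
    fix x z assume xz: "x < n" "z < n"
    then have "(\<Sum>y<n. J x y * J y z) = J (n - 1 - x) z" by (simp only: J)
    also have "\<dots> = (if x = z then 1 else 0)" using xz by (auto simp: J_def)
    finally show "(\<Sum>y<n. J x y * J y z) = (if x = z then 1 else 0)" .
  qed
  also have "\<dots> = 1" unfolding fdet_def by (metis one_mat_def det_one)
  finally have JJ: "fdet n J * fdet n J = 1" .
  have "fdet n J * (fdet n f * fdet n J) = fdet n (\<lambda>x y. f (n - 1 - x) (n - 1 - y))"
    unfolding fdet_mult
  proof (rule fdet_cong)
    fix x z assume xz: "x < n" "z < n"
    have "(\<Sum>y<n. f y' y * J y z) = f y' (n - 1 - z)" for y'
    proof -
      have "(\<Sum>y<n. f y' y * J y z) = (\<Sum>y<n. if y = n - 1 - z then f y' y else 0)"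
        using xz by (intro sum.cong) (auto simp: J_def)
      then show ?thesis using xz by simp
    qed
    then show "(\<Sum>y<n. J x y * (\<Sum>y'<n. f y y' * J y' z)) = f (n - 1 - x) (n - 1 - z)"
      using xz by (simp add: J)
  qed
  then show ?thesis using JJ by (simp add: mult_ac) (metis mult.assoc mult_1)
qed

text \<open>Both corners of the rectangle are free, because a shift of the variables moves the upper
  corner too.\<close>

definition hexagon :: "int \<Rightarrow> int \<Rightarrow> int \<Rightarrow> int \<Rightarrow> int \<Rightarrow> (int \<times> int) set" where
  "hexagon K a b c d = {(u, v). a \<le> u \<and> u \<le> b \<and> c \<le> v \<and> v \<le> d \<and>
     a + c + K - 1 \<le> u + v \<and> u + v \<le> b + d - K + 1}"

definition source :: "int \<Rightarrow> int \<Rightarrow> int \<Rightarrow> nat \<Rightarrow> int \<times> int" where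
  "source K a c x = (a + K - 1 - int x, c + int x)"

definition sink :: "int \<Rightarrow> int \<Rightarrow> int \<Rightarrow> nat \<Rightarrow> int \<times> int" where
  "sink K b d y = (b - int y, d - K + 1 + int y)"

definition path_det :: "(int \<times> int \<Rightarrow> 'f::field) \<Rightarrow> int \<Rightarrow> int \<Rightarrow> int \<Rightarrow> int \<Rightarrow> int \<Rightarrow> 'f" where
  "path_det B K a b c d = fdet (nat K) (\<lambda>x y. path_sum B (source K a c x) (sink K b d y))"

text \<open>The determinant makes sense also when \<open>K\<close> paths do not fit, and is then 0
  (\<open>Phi_eq_0\<close>). In this form the octahedron relations persist up to the
  boundary.\<close>

definition Phi :: "(int \<times> int \<Rightarrow> 'f::field) \<Rightarrow> int \<Rightarrow> int \<Rightarrow> int \<Rightarrow> int \<Rightarrow> int \<Rightarrow> 'f" where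
  "Phi A K a b c d = (\<Prod>p\<in>hexagon K a b c d. A p) * path_det (\<lambda>p. 1 / A p) K a b c d"

lemma hexagon_subset: "hexagon K a b c d \<subseteq> {a..b} \<times> {c..d}"
  by (auto simp: hexagon_def)

lemma finite_hexagon [simp]: "finite (hexagon K a b c d)"
  using hexagon_subset by (rule finite_subset) simp

lemma image_int_index: "0 \<le> K \<Longrightarrow> (\<lambda>l. f (l - 1)) ` {1..K} = (\<lambda>x. f (int x)) ` {..<nat K}"
proof (intro equalityI subsetI)
  fix p assume "p \<in> (\<lambda>l. f (l - 1)) ` {1..K}"
  then obtain l where "1 \<le> l" "l \<le> K" "p = f (l - 1)" by auto
  then show "p \<in> (\<lambda>x. f (int x)) ` {..<nat K}" by (intro image_eqI[of _ _ "nat (l - 1)"]) auto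
next
  fix p assume "p \<in> (\<lambda>x. f (int x)) ` {..<nat K}"
  then obtain x where "x < nat K" "p = f (int x)" by auto
  then show "p \<in> (\<lambda>l. f (l - 1)) ` {1..K}" by (intro image_eqI[of _ _ "int x + 1"]) auto
qed

lemma set_source: "0 \<le> K \<Longrightarrow> set (map (source K a c) [0..<nat K]) = sources K a c"
  using image_int_index[of K "\<lambda>x. (a + K - 1 - x, c + x)"]
  by (simp add: sources_def source_def atLeast0LessThan algebra_simps)

lemma set_sink: "0 \<le> K \<Longrightarrow> set (map (sink K b d) [0..<nat K]) = sinks b d K"
  using image_int_index[of K "\<lambda>x. (b - x, d - K + 1 + x)"]
  by (simp add: sinks_def sink_def atLeast0LessThan algebra_simps)

lemma families_support_subset:
  assumes "L \<in> families (sources K a c) (sinks b d K)"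
  shows "support L \<subseteq> hexagon K a b c d"
proof
  fix p assume "p \<in> support L"
  then obtain w where w: "w \<in> L" "p \<in> set w" by auto
  have "le_pt (hd w) p" "le_pt p (last w)"
    using w familiesD(1)[OF assms] lattice_path_hd_le lattice_path_le_last by blast+
  moreover have "hd w \<in> sources K a c" "last w \<in> sinks b d K"
    using familiesD(4,5)[OF assms] w by blast+
  ultimately show "p \<in> hexagon K a b c d"
    by (auto simp: hexagon_def sources_def sinks_def le_pt_def)
qed

text \<open>Disjoint paths have different heads, so the sources fix the number of paths. A path from
  a source to a sink cannot leave the hexagon.\<close>

lemma path_families_eq:
  assumes "0 \<le> m" "0 \<le> n" "0 \<le> K"
  shows "path_families r s K m n = families (sources K m n) (sinks r s K)"
    and "region r s K m n = hexagon K m r n s"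
proof -
  show region: "region r s K m n = hexagon K m r n s"
    using assms by (auto simp: region_def hexagon_def rect_def le_pt_def)
  have inj: "inj_on (\<lambda>l. (m + K - l, n + l - 1)) {1..K}" by (auto simp: inj_on_def)
  have card: "finite (sources K m n)" "int (card (sources K m n)) = K"
    unfolding sources_def using assms(3) by (auto simp: card_image[OF inj])
  have "L \<in> path_families r s K m n" if L: "L \<in> families (sources K m n) (sinks r s K)" for L
  proof -
    have inj: "inj_on hd L" by (rule families_inj_hd[OF L])
    have "finite L" using finite_imageD[OF _ inj] familiesD(4)[OF L] card by simp
    moreover have "int (card L) = K" using card_image[OF inj] familiesD(4)[OF L] card by simp
    moreover have "set w \<subseteq> region r s K m n" if "w \<in> L" for w
      using families_support_subset[OF L] that unfolding region by blast
    ultimately show ?thesis using L by (simp add: families_def path_families_def)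
  qed
  moreover have "L \<in> families (sources K m n) (sinks r s K)" if "L \<in> path_families r s K m n" for L
    using that by (simp add: families_def path_families_def)
  ultimately show "path_families r s K m n = families (sources K m n) (sinks r s K)" by blast
qed

lemma Phi_families:
  assumes "0 \<le> K" "K \<le> b - a + 1" "K \<le> d - c + 1"
    and nz: "\<And>p. p \<in> hexagon K a b c d \<Longrightarrow> A p \<noteq> (0::'f::field)"
  shows "finite (families (sources K a c) (sinks b d K))"
    and "Phi A K a b c d =
      (\<Sum>L\<in>families (sources K a c) (sinks b d K). \<Prod>p\<in>hexagon K a b c d - support L. A p)"
proof -
  let ?ps = "map (source K a c) [0..<nat K]" and ?ts = "map (sink K b d) [0..<nat K]"
  have lgv: "finite (families (set ?ps) (set ?ts)) \<and>
    (\<Sum>L\<in>families (set ?ps) (set ?ts). \<Prod>p\<in>support L. 1 / A p) =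
    fdet (nat K) (\<lambda>x y. path_sum (\<lambda>p. 1 / A p) (?ps ! x) (?ts ! y))"
    by (rule lindstroem_gessel_viennot[where D = "b + d - K + 1"])
      (use assms(1-3) in \<open>auto simp: chain_def source_def sink_def diag_def\<close>)
  then show "finite (families (sources K a c) (sinks b d K))"
    unfolding set_source[OF assms(1)] set_sink[OF assms(1)] by simp
  have "path_det (\<lambda>p. 1 / A p) K a b c d = fdet (nat K) (\<lambda>x y. path_sum (\<lambda>p. 1 / A p) (?ps ! x) (?ts ! y))"
    unfolding path_det_def by (rule fdet_cong) simp
  also have "\<dots> = (\<Sum>L\<in>families (sources K a c) (sinks b d K). \<Prod>p\<in>support L. 1 / A p)"
    using conjunct2[OF lgv] unfolding set_source[OF assms(1)] set_sink[OF assms(1)] by (rule sym)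
  finally have path_det: "path_det (\<lambda>p. 1 / A p) K a b c d = \<dots>" .
  have "Phi A K a b c d = (\<Sum>L\<in>families (sources K a c) (sinks b d K).
      (\<Prod>p\<in>hexagon K a b c d. A p) * (\<Prod>p\<in>support L. 1 / A p))"
    unfolding Phi_def path_det by (rule sum_distrib_left)
  also have "\<dots> = (\<Sum>L\<in>families (sources K a c) (sinks b d K). \<Prod>p\<in>hexagon K a b c d - support L. A p)"
  proof (rule sum.cong[OF refl])
    fix L assume L: "L \<in> families (sources K a c) (sinks b d K)"
    have sub: "support L \<subseteq> hexagon K a b c d" by (rule families_support_subset[OF L])
    have "(\<Prod>p\<in>support L. A p) * (\<Prod>p\<in>support L. 1 / A p) = 1"
      unfolding prod.distrib[symmetric] using nz sub by (intro prod.neutral) auto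
    moreover have "(\<Prod>p\<in>hexagon K a b c d. A p) =
        (\<Prod>p\<in>hexagon K a b c d - support L. A p) * (\<Prod>p\<in>support L. A p)"
      by (rule prod.subset_diff[OF sub]) simp
    ultimately show "(\<Prod>p\<in>hexagon K a b c d. A p) * (\<Prod>p\<in>support L. 1 / A p) =
        (\<Prod>p\<in>hexagon K a b c d - support L. A p)"
      by (simp only: mult.assoc mult_1_right)
  qed
  finally show "Phi A K a b c d =
      (\<Sum>L\<in>families (sources K a c) (sinks b d K). \<Prod>p\<in>hexagon K a b c d - support L. A p)" .
qed

lemma phi_eq_Phi:
  assumes "0 \<le> m" "0 \<le> n" "0 \<le> K" "K \<le> r - m + 1" "K \<le> s - n + 1"
    and "\<And>p. p \<in> hexagon K m r n s \<Longrightarrow> A p \<noteq> (0::'f::field)"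
  shows "phi r s K m n A = Phi A K m r n s"
  using Phi_families(2)[of K r m s n A] assms unfolding phi_def path_families_eq[OF assms(1-3)]
  by simp

section \<open>Symmetries, vanishing and nonvanishing of \<open>Phi\<close>\<close>

lemma Phi_shift:
  "Phi (\<lambda>(u, v). A (u - a', v - b')) K a b c d = Phi A K (a - a') (b - a') (c - b') (d - b')"
proof -
  have "path_det (\<lambda>p. 1 / (case p of (u, v) \<Rightarrow> A (u - a', v - b'))) K a b c d =
    path_det (\<lambda>(u, v). (\<lambda>p. 1 / A p) (u - a', v - b')) K a b c d"
    by (intro arg_cong[where f = "\<lambda>B. path_det B K a b c d"]) auto
  also have "\<dots> = path_det (\<lambda>p. 1 / A p) K (a - a') (b - a') (c - b') (d - b')"
    unfolding path_det_def path_sum_shift[of "\<lambda>p. 1 / A p"] by (simp add: source_def sink_def algebra_simps)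
  finally have 1: "path_det (\<lambda>p. 1 / (case p of (u, v) \<Rightarrow> A (u - a', v - b'))) K a b c d =
    path_det (\<lambda>p. 1 / A p) K (a - a') (b - a') (c - b') (d - b')" .
  have "(\<Prod>p\<in>hexagon K a b c d. (case p of (u, v) \<Rightarrow> A (u - a', v - b'))) =
     (\<Prod>p\<in>hexagon K (a - a') (b - a') (c - b') (d - b'). A p)"
    by (rule prod.reindex_bij_witness[of _ "\<lambda>(u, v). (u + a', v + b')" "\<lambda>(u, v). (u - a', v - b')"])
      (auto simp: hexagon_def)
  then show ?thesis unfolding Phi_def 1 by simp
qed

text \<open>Swapping coordinates reverses the order of the sources and of the sinks;
  \<open>fdet_reverse\<close> undoes both at once.\<close>

lemma Phi_swap: "Phi (\<lambda>p. A (prod.swap p)) K a b c d = Phi A K c d a b"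
proof -
  have "path_det (\<lambda>p. (\<lambda>p. 1 / A p) (prod.swap p)) K a b c d =
    fdet (nat K) (\<lambda>x y. (\<lambda>x y. path_sum (\<lambda>p. 1 / A p) (source K c a x) (sink K d b y)) (nat K - 1 - x) (nat K - 1 - y))"
    unfolding path_det_def path_sum_swap[of "\<lambda>p. 1 / A p"] by (intro fdet_cong, cases "0 \<le> K") (simp_all add: source_def sink_def of_nat_diff algebra_simps)
  also have "\<dots> = path_det (\<lambda>p. 1 / A p) K c d a b"
    unfolding path_det_def by (rule fdet_reverse[of "nat K" "\<lambda>x y. path_sum (\<lambda>p. 1 / A p) (source K c a x) (sink K d b y)"])
  finally have 1: "path_det (\<lambda>p. 1 / A (prod.swap p)) K a b c d = path_det (\<lambda>p. 1 / A p) K c d a b" .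
  have "(\<Prod>p\<in>hexagon K a b c d. A (prod.swap p)) = (\<Prod>p\<in>hexagon K c d a b. A p)"
    by (rule prod.reindex_bij_witness[of _ prod.swap prod.swap]) (auto simp: hexagon_def)
  then show ?thesis unfolding Phi_def 1 by simp
qed

text \<open>Reflection in the origin exchanges sources and sinks, hence a transposition besides the
  reversal.\<close>

lemma Phi_uminus:
  "Phi (\<lambda>p. A (- fst p, - snd p)) K a b c d = Phi A K (- b) (- a) (- d) (- c)"
proof -
  have "path_det (\<lambda>p. (\<lambda>p. 1 / A p) (- fst p, - snd p)) K a b c d =
    fdet (nat K) (\<lambda>x y. (\<lambda>x y. path_sum (\<lambda>p. 1 / A p) (source K (- b) (- d) y) (sink K (- a) (- c) x))
      (nat K - 1 - x) (nat K - 1 - y))"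
    unfolding path_det_def path_sum_uminus[of "\<lambda>p. 1 / A p"] by (intro fdet_cong, cases "0 \<le> K") (simp_all add: source_def sink_def of_nat_diff algebra_simps)
  also have "\<dots> = fdet (nat K) (\<lambda>x y. path_sum (\<lambda>p. 1 / A p) (source K (- b) (- d) y) (sink K (- a) (- c) x))"
    by (rule fdet_reverse[of "nat K" "\<lambda>x y. path_sum (\<lambda>p. 1 / A p) (source K (- b) (- d) y) (sink K (- a) (- c) x)"])
  also have "\<dots> = path_det (\<lambda>p. 1 / A p) K (- b) (- a) (- d) (- c)"
    unfolding path_det_def by (rule fdet_transpose)
  finally have 1: "path_det (\<lambda>p. 1 / A (- fst p, - snd p)) K a b c d = path_det (\<lambda>p. 1 / A p) K (- b) (- a) (- d) (- c)" .
  have "(\<Prod>p\<in>hexagon K a b c d. A (- fst p, - snd p)) = (\<Prod>p\<in>hexagon K (- b) (- a) (- d) (- c). A p)"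
    by (rule prod.reindex_bij_witness[of _ "\<lambda>p. (- fst p, - snd p)" "\<lambda>p. (- fst p, - snd p)"])
      (auto simp: hexagon_def)
  then show ?thesis unfolding Phi_def 1 by simp
qed

text \<open>In a rectangle that is too narrow, the last sink is west of all sources; in one that is
  too low, the last source is north of all sinks. This gives a zero column or a zero row.\<close>

lemma Phi_eq_0:
  assumes "K \<ge> 1" "K > b - a + 1 \<or> K > d - c + 1" shows "Phi A K a b c d = 0"
proof -
  have "path_det B K a b c d = 0" for B :: "int \<times> int \<Rightarrow> 'a"
  proof (cases "K > b - a + 1")
    case True
    have "fdet (nat K) (\<lambda>y x. path_sum B (source K a c x) (sink K b d y)) = 0"
      by (rule fdet_zero_row[of "nat K - 1"])
        (use assms True in \<open>auto intro!: path_sum_not_le simp: le_pt_def source_def sink_def of_nat_diff\<close>)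
    then show ?thesis
      unfolding path_det_def using fdet_transpose[of "nat K" "\<lambda>x y. path_sum B (source K a c x) (sink K b d y)"] by simp
  next
    case False
    then show ?thesis unfolding path_det_def
      by (intro fdet_zero_row[of "nat K - 1"])
        (use assms in \<open>auto intro!: path_sum_not_le simp: le_pt_def source_def sink_def of_nat_diff\<close>)
  qed
  then show ?thesis by (simp add: Phi_def)
qed

lemma Phi_A_var_nonzero:
  assumes "0 \<le> a" "0 \<le> c" "0 \<le> K" "K \<le> b - a + 1" "K \<le> d - c + 1"
  shows "Phi (A_var :: _ \<Rightarrow> 'k::field ratfun) K a b c d \<noteq> 0"
proof -
  let ?A = "A_var :: _ \<Rightarrow> 'k ratfun" and ?H = "hexagon K a b c d"
  let ?F = "families (sources K a c) (sinks b d K)"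
  have pos: "0 \<le> fst p \<and> 0 \<le> snd p" if "p \<in> ?H" for p
    using that assms by (auto simp: hexagon_def)
  have nz: "?A p \<noteq> 0" if "p \<in> ?H" for p using pos[OF that] A_var_nonzero by blast
  have fin: "finite ?F" using Phi_families(1)[OF assms(3-5), of ?A] nz by blast
  have inj: "inj_on support ?F"
    by (rule support_inj[where D = "b + d - K + 1"])
      (use assms in \<open>auto simp: sources_def sinks_def diag_def\<close>)
  have inj': "inj_on (\<lambda>L. ?H - support L) ?F"
  proof (rule inj_onI)
    fix L1 L2 assume L: "L1 \<in> ?F" "L2 \<in> ?F" "?H - support L1 = ?H - support L2"
    then have "support L1 = support L2"
      using families_support_subset[OF L(1)] families_support_subset[OF L(2)] by blast
    then show "L1 = L2" using inj L by (auto dest: inj_onD)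
  qed
  have "Phi ?A K a b c d = (\<Sum>L\<in>?F. \<Prod>p\<in>?H - support L. ?A p)"
    using Phi_families(2)[OF assms(3-5), of ?A] nz by blast
  also have "\<dots> = (\<Sum>U\<in>(\<lambda>L. ?H - support L) ` ?F. \<Prod>p\<in>U. ?A p)"
    by (simp add: sum.reindex[OF inj'])
  also have "\<dots> \<noteq> 0"
    by (rule sum_prod_A_var_nonzero)
      (use fin families_sources_sinks_nonempty[OF assms(4,5)] pos in auto)
  finally show ?thesis .
qed

section \<open>Vertex counts for pairs of hexagons\<close>

lemma prod_eq_of_mset_eq:
  assumes "mset_set S1 + mset_set S2 = mset_set S3 + mset_set S4 + N"
  shows "prod A S1 * prod A S2 = prod A S3 * prod A S4 * (prod_mset (image_mset A N) :: 'a::comm_monoid_mult)"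
  using arg_cong[OF assms, of "\<lambda>M. prod_mset (image_mset A M)"]
  by (simp add: prod_unfold_prod_mset)

lemma mem_hexagon: "(u, v) \<in> hexagon K a b c d \<longleftrightarrow> a \<le> u \<and> u \<le> b \<and> c \<le> v \<and> v \<le> d \<and>
     a + c + K - 1 \<le> u + v \<and> u + v \<le> b + d - K + 1"
  by (simp add: hexagon_def)

lemma mset_set_pair_eqI:
  assumes "finite S1" "finite S2" "finite S3" "finite S4"
    and "\<And>u v. (u, v) \<in> S1 \<or> (u, v) \<in> S2 \<longleftrightarrow> (u, v) \<in> S3 \<or> (u, v) \<in> S4 \<or> (u, v) \<in> T"
    and "\<And>u v. (u, v) \<in> S1 \<and> (u, v) \<in> S2 \<longleftrightarrow> (u, v) \<in> S3 \<and> (u, v) \<in> S4"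
    and "\<And>u v. (u, v) \<in> T \<Longrightarrow> (u, v) \<notin> S3 \<and> (u, v) \<notin> S4"
    and "finite T"
  shows "mset_set S1 + mset_set S2 = mset_set S3 + mset_set S4 + mset_set (T :: ('a \<times> 'b) set)"
proof (rule multiset_eqI)
  fix p :: "'a \<times> 'b"
  obtain u v where p: "p = (u, v)" by (cases p)
  show "count (mset_set S1 + mset_set S2) p = count (mset_set S3 + mset_set S4 + mset_set T) p"
    using assms(5,6,7)[of u v] assms(1-4,8)
    by (cases "p \<in> S1"; cases "p \<in> S2"; cases "p \<in> S3"; cases "p \<in> S4"; cases "p \<in> T")
      (simp_all add: p)
qed

text \<open>The left-over vertex is the southeastern source. Its weight is the coefficient of the
  matching term in \<open>path_det_octahedron_square\<close>, so that no coefficient remains for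
  \<open>Phi\<close>. The primed version treats the northwestern source.\<close>

lemma hexagon_mset_square:
  assumes "1 \<le> K" "K \<le> b - a" "K \<le> d - c + 1"
  shows "mset_set (hexagon K a b c d) + mset_set (hexagon (K - 1) (a + 1) b (c + 1) d) =
    mset_set (hexagon (K - 1) a b (c + 1) d) + mset_set (hexagon K (a + 1) b c d) +
    mset_set {(a + K - 1, c)}"
  by (rule mset_set_pair_eqI)
   (use assms in \<open>simp_all only: mem_hexagon finite_hexagon insert_iff empty_iff prod.inject finite.intros, smt+\<close>)

lemma hexagon_mset_square':
  assumes "1 \<le> K" "K \<le> b - a + 1" "K \<le> d - c"
  shows "mset_set (hexagon K a b c d) + mset_set (hexagon (K - 1) (a + 1) b (c + 1) d) =
    mset_set (hexagon (K - 1) (a + 1) b c d) + mset_set (hexagon K a b (c + 1) d) +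
    mset_set {(a, c + K - 1)}"
  by (rule mset_set_pair_eqI)
   (use assms in \<open>simp_all only: mem_hexagon finite_hexagon insert_iff empty_iff prod.inject finite.intros, smt+\<close>)

text \<open>The left-over vertices are the first source and the last sink of the shifted rectangle;
  their weights form the coefficient in \<open>path_det_octahedron_dodgson\<close>.\<close>

lemma hexagon_mset_dodgson:
  assumes "1 \<le> K" "K \<le> b - a" "K \<le> d - c + 1"
  shows "mset_set (hexagon K a b c d) + mset_set (hexagon K a b (c + 1) (d + 1)) =
    mset_set (hexagon (K - 1) a b (c + 1) d) + mset_set (hexagon (K + 1) a b c (d + 1)) +
    mset_set {(a + K - 1, c), (b - K + 1, d + 1)}"
  by (rule mset_set_pair_eqI)
   (use assms in \<open>simp_all only: mem_hexagon finite_hexagon insert_iff empty_iff prod.inject finite.intros, smt+\<close>)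

lemma hexagon_mset_dodgson':
  assumes "0 \<le> K" "K \<le> b - a + 1" "K \<le> d - c"
  shows "mset_set (hexagon K a b c d) + mset_set (hexagon K a b (c + 1) (d + 1)) =
    mset_set (hexagon K a b c (d + 1)) + mset_set (hexagon K a b (c + 1) d) + mset_set {}"
  by (rule mset_set_pair_eqI)
   (use assms in \<open>simp_all only: mem_hexagon finite_hexagon insert_iff empty_iff prod.inject finite.intros, smt+\<close>)

section \<open>Octahedron recurrences\<close>

lemma path_det_as_fdet:
  assumes "nat K = n" "\<And>x y. x < n \<Longrightarrow> y < n \<Longrightarrow> path_sum B (source K a c x) (sink K b d y) = g x * h y * f x y"
  shows "path_det B K a b c d = (\<Prod>x<n. g x) * (\<Prod>y<n. h y) * fdet n f"
proof -
  have "path_det B K a b c d = fdet n (\<lambda>x y. g x * (h y * f x y))"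
    unfolding path_det_def assms(1) by (intro fdet_cong) (simp add: assms(2) mult.assoc)
  then show ?thesis by (simp add: fdet_scale_rows fdet_scale_cols)
qed

text \<open>Both successors of source \<open>x\<close> are sources of the rectangle with western
  side \<open>a + 1\<close>, numbered \<open>x\<close> and \<open>Suc x\<close>.\<close>

lemma path_sum_source:
  assumes "a + c + K - 1 < diag q"
  shows "path_sum B (source K a c x) q = B (source K a c x) * (path_sum B (source K (a + 1) c x) q + path_sum B (source K (a + 1) c (Suc x)) q)"
proof -
  have "east (source K a c x) = source K (a + 1) c x" "north (source K a c x) = source K (a + 1) c (Suc x)"
    by (simp_all add: source_def east_def north_def)
  moreover have "diag (source K a c x) < diag q" using assms by (simp add: source_def diag_def)
  ultimately show ?thesis by (simp add: path_sum_first)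
qed

lemma path_sum_sink:
  assumes "diag p < b + d - K + 2"
  shows "path_sum B p (sink (K - 1) b d y) =
    B (sink (K - 1) b d y) * (path_sum B p (sink K b d y) + path_sum B p (sink K b d (Suc y)))"
proof -
  have "(fst (sink (K - 1) b d y) - 1, snd (sink (K - 1) b d y)) = sink K b d (Suc y)"
    "(fst (sink (K - 1) b d y), snd (sink (K - 1) b d y) - 1) = sink K b d y"
    by (simp_all add: sink_def)
  moreover have "diag p < diag (sink (K - 1) b d y)" using assms by (simp add: sink_def diag_def)
  ultimately show ?thesis by (simp add: path_sum_last add.commute)
qed

lemma path_sum_source_sink:
  assumes "a + c + K - 1 < b + d - K' + 1"
  shows "path_sum B (source K a c x) (sink (K' - 1) b d y) = B (source K a c x) * B (sink (K' - 1) b d y) *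
    col_sum (row_sum (\<lambda>x y. path_sum B (source K (a + 1) c x) (sink K' b d y))) x y"
proof -
  have "path_sum B (source K a c x) (sink K' b d y) = B (source K a c x) *
      row_sum (\<lambda>x y. path_sum B (source K (a + 1) c x) (sink K' b d y)) x y" for y
    by (subst path_sum_source) (use assms in \<open>simp_all add: row_sum_def sink_def diag_def\<close>)
  then show ?thesis
    by (subst path_sum_sink) (use assms in \<open>simp_all add: col_sum_def source_def diag_def algebra_simps\<close>)
qed

text \<open>The same points are sources of several rectangles, so one matrix \<open>e\<close> can
  serve all determinants in a relation.\<close>

lemma source_shift: "source K a c (Suc x) = source K (a - 1) (c + 1) x"
  and source_K: "source (K - 1) a c x = source K (a - 1) c x"
  by (simp_all add: source_def)

lemma path_det_octahedron_square:
  assumes "1 \<le> K" "a + c + K - 1 < b + d - K + 1"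
  shows "path_det B K a b c d * path_det B (K - 1) (a + 1) b (c + 1) d =
    B (a + K - 1, c) * (path_det B (K - 1) a b (c + 1) d * path_det B K (a + 1) b c d) +
    B (a, c + K - 1) * (path_det B (K - 1) (a + 1) b c d * path_det B K a b (c + 1) d)"
proof -
  define n where "n = nat (K - 1)"
  have nK: "nat K = Suc n" "nat (K - 1) = n" "K = int n + 1" using assms by (simp_all add: n_def)
  \<comment> \<open>Up to the weights \<open>Bs\<close> at sources and \<open>Bt\<close> at sinks,
    all six determinants arise from \<open>e\<close> by row sums, column sums or dropping row
    0.\<close>
  define e where "e = (\<lambda>x y. path_sum B (source K (a + 1) c x) (sink K b d y))"
  define Bs where "Bs = (\<lambda>x. B (source K a c x))"
  define Bt where "Bt = (\<lambda>y. B (sink (K - 1) b d y))"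
  have E0: "path_det B K a b c d = (\<Prod>x<Suc n. Bs x) * (\<Prod>y<Suc n. 1) * fdet (Suc n) (row_sum e)"
    by (rule path_det_as_fdet[OF nK(1)])
      (subst path_sum_source, use assms in \<open>simp_all add: e_def Bs_def row_sum_def sink_def diag_def\<close>)
  have E1: "path_det B (K - 1) (a + 1) b (c + 1) d = (\<Prod>x<n. 1) * (\<Prod>y<n. Bt y) * fdet n (\<lambda>x. col_sum e (Suc x))"
    by (rule path_det_as_fdet[OF nK(2)])
      (subst path_sum_sink, use assms in \<open>simp_all add: e_def Bt_def col_sum_def source_shift source_K, simp add: source_def diag_def\<close>)
  have E2: "path_det B (K - 1) a b (c + 1) d =
      (\<Prod>x<n. Bs (Suc x)) * (\<Prod>y<n. Bt y) * fdet n (\<lambda>x. col_sum (row_sum e) (Suc x))"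
    by (rule path_det_as_fdet[OF nK(2)])
      (use path_sum_source_sink[OF assms(2), of B "Suc _"] in \<open>simp add: e_def Bs_def Bt_def source_shift source_K\<close>)
  have E3: "path_det B K (a + 1) b c d = (\<Prod>x<Suc n. 1) * (\<Prod>y<Suc n. 1) * fdet (Suc n) e"
    by (rule path_det_as_fdet[OF nK(1)]) (simp add: e_def)
  have E4: "path_det B (K - 1) (a + 1) b c d = (\<Prod>x<n. Bs x) * (\<Prod>y<n. Bt y) * fdet n (col_sum (row_sum e))"
    by (rule path_det_as_fdet[OF nK(2)])
      (use path_sum_source_sink[OF assms(2), of B] in \<open>simp add: e_def Bs_def Bt_def source_K\<close>)
  have E5: "path_det B K a b (c + 1) d = (\<Prod>x<Suc n. 1) * (\<Prod>y<Suc n. 1) * fdet (Suc n) (\<lambda>x. e (Suc x))"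
    by (rule path_det_as_fdet[OF nK(1)]) (simp add: e_def source_shift)
  have Bs: "Bs 0 = B (a + K - 1, c)" "Bs n = B (a, c + K - 1)"
    by (simp_all add: Bs_def source_def nK(3))
  \<comment> \<open>Splitting off the first or the last source weight produces the two coefficients
    of the relation.\<close>
  have p1: "(\<Prod>x<Suc n. Bs x) = Bs 0 * (\<Prod>x<n. Bs (Suc x))" by (rule prod.lessThan_Suc_shift)
  have p2: "(\<Prod>x<Suc n. Bs x) = Bs n * (\<Prod>x<n. Bs x)" by (simp add: mult.commute)
  have "path_det B K a b c d * path_det B (K - 1) (a + 1) b (c + 1) d =
    (\<Prod>x<Suc n. Bs x) * (\<Prod>y<n. Bt y) * (fdet (Suc n) (row_sum e) * fdet n (\<lambda>x. col_sum e (Suc x)))"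
    unfolding E0 E1 by (simp add: mult_ac del: prod.lessThan_Suc)
  also have "\<dots> = (\<Prod>x<Suc n. Bs x) * ((\<Prod>y<n. Bt y) * (fdet n (\<lambda>x. col_sum (row_sum e) (Suc x)) * fdet (Suc n) e)) +
     (\<Prod>x<Suc n. Bs x) * ((\<Prod>y<n. Bt y) * (fdet n (col_sum (row_sum e)) * fdet (Suc n) (\<lambda>x. e (Suc x))))"
    unfolding fdet_octahedron_square by (simp only: distrib_left mult.assoc)
  also have "(\<Prod>x<Suc n. Bs x) * ((\<Prod>y<n. Bt y) * (fdet n (\<lambda>x. col_sum (row_sum e) (Suc x)) * fdet (Suc n) e)) =
     B (a + K - 1, c) * (path_det B (K - 1) a b (c + 1) d * path_det B K (a + 1) b c d)"
    unfolding E2 E3 p1 Bs(1)[symmetric] by (simp add: mult_ac)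
  also have "(\<Prod>x<Suc n. Bs x) * ((\<Prod>y<n. Bt y) * (fdet n (col_sum (row_sum e)) * fdet (Suc n) (\<lambda>x. e (Suc x)))) =
     B (a, c + K - 1) * (path_det B (K - 1) (a + 1) b c d * path_det B K a b (c + 1) d)"
    unfolding E4 E5 p2 Bs(2)[symmetric] by (simp add: mult_ac)
  finally show ?thesis .
qed

lemma path_det_octahedron_dodgson:
  assumes "1 \<le> K" "a + c + K - 1 < b + d - K + 1"
  shows "path_det B K a b c d * path_det B K a b (c + 1) (d + 1) =
    B (a + K - 1, c) * B (b - K + 1, d + 1) * (path_det B (K - 1) a b (c + 1) d * path_det B (K + 1) a b c (d + 1)) +
    path_det B K a b c (d + 1) * path_det B K a b (c + 1) d"
proof -
  define n where "n = nat (K - 1)"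
  have nK: "nat K = Suc n" "nat (K - 1) = n" "nat (K + 1) = Suc (Suc n)" "K = int n + 1"
    using assms by (simp_all add: n_def)
  \<comment> \<open>\<open>e\<close> is the matrix of the largest determinant, with
    \<open>K + 1\<close> paths; by \<open>e_eq\<close> it also describes \<open>K\<close> paths in
    smaller rectangles.\<close>
  define e where "e = (\<lambda>x y. path_sum B (source (K + 1) a c x) (sink (K + 1) b (d + 1) y))"
  define Bs where "Bs = (\<lambda>x. B (source K a c x))"
  define Bt where "Bt = (\<lambda>y. B (sink K b (d + 1) y))"
  have e_eq: "e x y = path_sum B (source K (a + 1) c x) (sink K b d y)" for x y
    by (simp add: e_def source_def sink_def)
  have snkK: "sink (K - 1) b d y = sink K b (d + 1) y" "sink (K + 1) b (d + 1) y = sink K b d y" for y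
    by (simp_all add: sink_def)
  have rc: "path_sum B (source K a c x) (sink K b (d + 1) y) = Bs x * Bt y * col_sum (row_sum e) x y" for x y
    using path_sum_source_sink[OF assms(2), of B x y] by (simp add: e_eq[abs_def] Bs_def Bt_def snkK)
  have E0: "path_det B K a b c d = (\<Prod>x<Suc n. Bs x) * (\<Prod>y<Suc n. 1) * fdet (Suc n) (row_sum e)"
    by (rule path_det_as_fdet[OF nK(1)])
      (subst path_sum_source, use assms in \<open>simp_all add: e_eq Bs_def row_sum_def sink_def diag_def\<close>)
  have E1: "path_det B K a b (c + 1) (d + 1) = (\<Prod>x<Suc n. 1) * (\<Prod>y<Suc n. Bt y) * fdet (Suc n) (\<lambda>x. col_sum e (Suc x))"
  proof (rule path_det_as_fdet[OF nK(1)])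
    fix x y
    have "path_sum B (source K a (c + 1) x) (sink (K - 1) b d y) =
      B (sink (K - 1) b d y) * (path_sum B (source K a (c + 1) x) (sink K b d y) + path_sum B (source K a (c + 1) x) (sink K b d (Suc y)))"
      by (rule path_sum_sink) (use assms in \<open>simp add: source_def diag_def\<close>)
    then show "path_sum B (source K a (c + 1) x) (sink K b (d + 1) y) = 1 * Bt y * col_sum e (Suc x) y"
      by (simp add: e_eq Bt_def snkK col_sum_def source_shift)
  qed
  have E2: "path_det B (K - 1) a b (c + 1) d =
      (\<Prod>x<n. Bs (Suc x)) * (\<Prod>y<n. Bt y) * fdet n (\<lambda>x. col_sum (row_sum e) (Suc x))"
    by (rule path_det_as_fdet[OF nK(2)])
      (use rc[of "Suc _"] in \<open>simp add: Bs_def Bt_def source_shift source_K snkK\<close>)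
  have E3: "path_det B (K + 1) a b c (d + 1) = (\<Prod>x<Suc (Suc n). 1) * (\<Prod>y<Suc (Suc n). 1) * fdet (Suc (Suc n)) e"
    by (rule path_det_as_fdet[OF nK(3)]) (simp add: e_def)
  have E4: "path_det B K a b c (d + 1) = (\<Prod>x<Suc n. Bs x) * (\<Prod>y<Suc n. Bt y) * fdet (Suc n) (col_sum (row_sum e))"
    by (rule path_det_as_fdet[OF nK(1)]) (simp add: rc)
  have E5: "path_det B K a b (c + 1) d = (\<Prod>x<Suc n. 1) * (\<Prod>y<Suc n. 1) * fdet (Suc n) (\<lambda>x. e (Suc x))"
    by (rule path_det_as_fdet[OF nK(1)]) (simp add: e_eq source_shift)
  have Bs: "Bs 0 = B (a + K - 1, c)" "Bt n = B (b - K + 1, d + 1)"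
    by (simp_all add: Bs_def Bt_def source_def sink_def nK(4))
  have p1: "(\<Prod>x<Suc n. Bs x) = Bs 0 * (\<Prod>x<n. Bs (Suc x))" by (rule prod.lessThan_Suc_shift)
  have p2: "(\<Prod>x<Suc n. Bt x) = Bt n * (\<Prod>x<n. Bt x)" by (simp add: mult.commute)
  have "path_det B K a b c d * path_det B K a b (c + 1) (d + 1) =
    (\<Prod>x<Suc n. Bs x) * (\<Prod>y<Suc n. Bt y) * (fdet (Suc n) (row_sum e) * fdet (Suc n) (\<lambda>x. col_sum e (Suc x)))"
    unfolding E0 E1 by (simp add: mult_ac del: prod.lessThan_Suc)
  also have "\<dots> = (\<Prod>x<Suc n. Bs x) * ((\<Prod>y<Suc n. Bt y) * (fdet n (\<lambda>x. col_sum (row_sum e) (Suc x)) * fdet (Suc (Suc n)) e)) +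
     (\<Prod>x<Suc n. Bs x) * ((\<Prod>y<Suc n. Bt y) * (fdet (Suc n) (col_sum (row_sum e)) * fdet (Suc n) (\<lambda>x. e (Suc x))))"
    unfolding fdet_octahedron_dodgson by (simp only: distrib_left mult.assoc)
  also have "(\<Prod>x<Suc n. Bs x) * ((\<Prod>y<Suc n. Bt y) * (fdet n (\<lambda>x. col_sum (row_sum e) (Suc x)) * fdet (Suc (Suc n)) e)) =
     B (a + K - 1, c) * B (b - K + 1, d + 1) * (path_det B (K - 1) a b (c + 1) d * path_det B (K + 1) a b c (d + 1))"
    unfolding E2 E3 p1 p2 Bs[symmetric] by (simp add: mult_ac)
  also have "(\<Prod>x<Suc n. Bs x) * ((\<Prod>y<Suc n. Bt y) * (fdet (Suc n) (col_sum (row_sum e)) * fdet (Suc n) (\<lambda>x. e (Suc x)))) =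
     path_det B K a b c (d + 1) * path_det B K a b (c + 1) d"
    unfolding E4 E5 by (simp add: mult_ac del: prod.lessThan_Suc)
  finally show ?thesis .
qed

text \<open>The excluded case is the one in which the sources are the sinks, where \<open>path_sum_first\<close> fails.\<close>

lemma Phi_octahedron_square:
  assumes K: "1 \<le> K" "K \<le> b - a + 1" "K \<le> d - c + 1" "\<not> (K = b - a + 1 \<and> K = d - c + 1)"
    and nz: "\<And>u v. a \<le> u \<Longrightarrow> u \<le> b \<Longrightarrow> c \<le> v \<Longrightarrow> v \<le> d \<Longrightarrow> A (u, v) \<noteq> 0"
  shows "Phi A K a b c d * Phi A (K - 1) (a + 1) b (c + 1) d =
    Phi A (K - 1) a b (c + 1) d * Phi A K (a + 1) b c d +
    Phi A (K - 1) (a + 1) b c d * Phi A K a b (c + 1) d"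
proof -
  define P where "P = (\<lambda>K a b c d. prod A (hexagon K a b c d))"
  let ?E = "path_det (\<lambda>p. 1 / A p)"
  have Phi: "Phi A K a b c d = P K a b c d * ?E K a b c d" for K a b c d
    by (simp add: Phi_def P_def)
  let ?P0 = "P K a b c d * P (K - 1) (a + 1) b (c + 1) d"
  have 1: "?P0 * (1 / A (a + K - 1, c) * (?E (K - 1) a b (c + 1) d * ?E K (a + 1) b c d)) =
    Phi A (K - 1) a b (c + 1) d * Phi A K (a + 1) b c d"
  proof (cases "K \<le> b - a")
    case True
    have "?P0 = P (K - 1) a b (c + 1) d * P K (a + 1) b c d * A (a + K - 1, c)"
      using prod_eq_of_mset_eq[OF hexagon_mset_square[OF K(1) True K(3)], of A] by (simp add: P_def mult_ac)
    moreover have "A (a + K - 1, c) \<noteq> 0" by (rule nz) (use K in auto)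
    ultimately show ?thesis by (simp add: Phi mult_ac)
  next
    case False
    \<comment> \<open>The vertex count fails for this \<open>K\<close>, but both sides are 0. The
      determinant itself vanishes because the product of the \<open>A p\<close> does not.\<close>
    then have *: "Phi A K (a + 1) b c d = 0" using K by (intro Phi_eq_0) auto
    moreover have "(P K (a + 1) b c d) \<noteq> 0" using nz by (auto simp: P_def mem_hexagon)
    ultimately have "?E K (a + 1) b c d = 0" by (simp add: Phi)
    then show ?thesis using * by simp
  qed
  have 2: "?P0 * (1 / A (a, c + K - 1) * (?E (K - 1) (a + 1) b c d * ?E K a b (c + 1) d)) =
    Phi A (K - 1) (a + 1) b c d * Phi A K a b (c + 1) d"
  proof (cases "K \<le> d - c")
    case True
    have "?P0 = P (K - 1) (a + 1) b c d * P K a b (c + 1) d * A (a, c + K - 1)"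
      using prod_eq_of_mset_eq[OF hexagon_mset_square'[OF K(1,2) True], of A] by (simp add: P_def mult_ac)
    moreover have "A (a, c + K - 1) \<noteq> 0" by (rule nz) (use K in auto)
    ultimately show ?thesis by (simp add: Phi mult_ac)
  next
    case False
    then have *: "Phi A K a b (c + 1) d = 0" using K by (intro Phi_eq_0) auto
    moreover have "(P K a b (c + 1) d) \<noteq> 0" using nz by (auto simp: P_def mem_hexagon)
    ultimately have "?E K a b (c + 1) d = 0" by (simp add: Phi)
    then show ?thesis using * by simp
  qed
  have "Phi A K a b c d * Phi A (K - 1) (a + 1) b (c + 1) d =
    ?P0 * (?E K a b c d * ?E (K - 1) (a + 1) b (c + 1) d)"
    by (simp add: Phi mult_ac)
  also have "?E K a b c d * ?E (K - 1) (a + 1) b (c + 1) d =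
    1 / A (a + K - 1, c) * (?E (K - 1) a b (c + 1) d * ?E K (a + 1) b c d) +
    1 / A (a, c + K - 1) * (?E (K - 1) (a + 1) b c d * ?E K a b (c + 1) d)"
    by (rule path_det_octahedron_square) (use K in linarith)+
  finally show ?thesis unfolding distrib_left 1 2 .
qed

text \<open>For \<open>K = 0\<close> the term with \<open>K - 1\<close> paths must be replaced by 0:
  as \<open>nat (- 1) = 0\<close>, the formula for \<open>Phi\<close> would give an empty
  determinant, that is 1. This matches \<open>tau_eq_0\<close>.\<close>

lemma Phi_octahedron_dodgson:
  assumes "c \<le> d" and K: "0 \<le> K" "K \<le> b - a + 1" "K \<le> d - c + 1" "\<not> (K = b - a + 1 \<and> K = d - c + 1)"
    and nz: "\<And>u v. a \<le> u \<Longrightarrow> u \<le> b \<Longrightarrow> c \<le> v \<Longrightarrow> v \<le> d + 1 \<Longrightarrow> A (u, v) \<noteq> 0"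
  shows "Phi A K a b c d * Phi A K a b (c + 1) (d + 1) =
    (if K = 0 then 0 else Phi A (K - 1) a b (c + 1) d * Phi A (K + 1) a b c (d + 1)) +
    Phi A K a b c (d + 1) * Phi A K a b (c + 1) d"
proof -
  define P where "P = (\<lambda>K a b c d. prod A (hexagon K a b c d))"
  let ?E = "path_det (\<lambda>p. 1 / A p)"
  have Phi: "Phi A K a b c d = P K a b c d * ?E K a b c d" for K a b c d
    by (simp add: Phi_def P_def)
  let ?P0 = "P K a b c d * P K a b (c + 1) (d + 1)"
  have 2: "?P0 * (?E K a b c (d + 1) * ?E K a b (c + 1) d) =
    Phi A K a b c (d + 1) * Phi A K a b (c + 1) d"
  proof (cases "K \<le> d - c")
    case True
    have "?P0 = P K a b c (d + 1) * P K a b (c + 1) d"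
      using prod_eq_of_mset_eq[OF hexagon_mset_dodgson'[OF K(1,2) True], of A] by (simp add: P_def mult_ac)
    then show ?thesis by (simp add: Phi mult_ac)
  next
    case False
    then have "1 \<le> K" using K \<open>c \<le> d\<close> by simp
    then have *: "Phi A K a b (c + 1) d = 0" using K False by (intro Phi_eq_0) auto
    moreover have "P K a b (c + 1) d \<noteq> 0" using nz by (auto simp: P_def mem_hexagon)
    ultimately have "?E K a b (c + 1) d = 0" by (simp add: Phi)
    then show ?thesis using * by simp
  qed
  have eq: "Phi A K a b c d * Phi A K a b (c + 1) (d + 1) =
    ?P0 * (?E K a b c d * ?E K a b (c + 1) (d + 1))"
    by (simp add: Phi mult_ac)
  show ?thesis
  proof (cases "K = 0")
    case True
    then have "?E K a b c d * ?E K a b (c + 1) (d + 1) = ?E K a b c (d + 1) * ?E K a b (c + 1) d"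
      by (simp add: path_det_def)
    then show ?thesis unfolding eq using 2 True by simp
  next
    case False
    then have K1: "1 \<le> K" using K by simp
    have 1: "?P0 * (1 / A (a + K - 1, c) * (1 / A (b - K + 1, d + 1)) *
        (?E (K - 1) a b (c + 1) d * ?E (K + 1) a b c (d + 1))) =
      Phi A (K - 1) a b (c + 1) d * Phi A (K + 1) a b c (d + 1)"
    proof (cases "K \<le> b - a")
      case True
      have "(a + K - 1, c) \<noteq> (b - K + 1, d + 1)" using K K1 by auto
      then have "?P0 = P (K - 1) a b (c + 1) d * P (K + 1) a b c (d + 1) *
          (A (a + K - 1, c) * A (b - K + 1, d + 1))"
        using prod_eq_of_mset_eq[OF hexagon_mset_dodgson[OF K1 True K(3)], of A] by (simp add: P_def mult_ac)
      moreover have "A (a + K - 1, c) \<noteq> 0" "A (b - K + 1, d + 1) \<noteq> 0"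
        by (rule nz; use K K1 in linarith)+
      ultimately show ?thesis by (simp add: Phi mult_ac)
    next
      case False
      then have *: "Phi A (K + 1) a b c (d + 1) = 0" using K by (intro Phi_eq_0) auto
      moreover have "(P (K + 1) a b c (d + 1)) \<noteq> 0" using nz by (auto simp: P_def mem_hexagon)
      ultimately have "?E (K + 1) a b c (d + 1) = 0" by (simp add: Phi)
      then show ?thesis using * by simp
    qed
    have "?E K a b c d * ?E K a b (c + 1) (d + 1) =
      1 / A (a + K - 1, c) * (1 / A (b - K + 1, d + 1)) *
        (?E (K - 1) a b (c + 1) d * ?E (K + 1) a b c (d + 1)) +
      ?E K a b c (d + 1) * ?E K a b (c + 1) d"
      by (rule path_det_octahedron_dodgson) (use K K1 in linarith)+
    then show ?thesis unfolding eq using 1 2 False by (simp only: distrib_left if_False)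
  qed
qed

section \<open>Values on the boundary and transformed relations\<close>

lemma Phi_square_eq_1:
  assumes "0 \<le> K" "K = b - a + 1" "K = d - c + 1"
    and "\<And>p. p \<in> hexagon K a b c d \<Longrightarrow> A p \<noteq> 0"
  shows "Phi A K a b c d = 1"
proof -
  let ?S = "sources K a c"
  have sinks: "sinks b d K = ?S"
    unfolding sources_def sinks_def using assms(2,3) by (intro image_cong) auto
  have fam: "families ?S (sinks b d K) = {(\<lambda>p. [p]) ` ?S}"
    unfolding sinks by (subst families_antidiagonal[of ?S "a + c + K - 1" ?S]) (auto simp: sources_def diag_def)
  \<comment> \<open>The hexagon degenerates to the antidiagonal of sources, all of which are
    covered.\<close>
  have "hexagon K a b c d \<subseteq> ?S"
  proof
    fix p assume "p \<in> hexagon K a b c d"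
    then show "p \<in> ?S" using assms(2,3)
      by (auto simp: hexagon_def sources_def intro!: image_eqI[of _ _ "snd p - c + 1"])
  qed
  then have "hexagon K a b c d - support ((\<lambda>p. [p]) ` ?S) = {}" by auto
  then have "(\<Sum>L\<in>{(\<lambda>p. [p]) ` ?S}. \<Prod>p\<in>hexagon K a b c d - support L. A p) = 1"
    by (simp only: sum.insert finite.emptyI empty_iff not_False_eq_True sum.empty prod.empty add_0_right)
  then show ?thesis
    using Phi_families(2)[of K b a d c A] assms unfolding fam by simp
qed

text \<open>Combinatorially, \<open>K\<close> disjoint paths fill a hexagon of width
  \<open>K\<close>. Here the product with the narrower rectangle vanishes in the octahedron
  relation, and induction makes the other factors 1.\<close>

lemma Phi_full_width_eq_1:
  assumes "0 \<le> K" "K = b - a + 1" "K \<le> d - c + 1"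
    and "\<And>u v. a \<le> u \<Longrightarrow> u \<le> b \<Longrightarrow> c \<le> v \<Longrightarrow> v \<le> d \<Longrightarrow> A (u, v) \<noteq> 0"
  shows "Phi A K a b c d = 1"
  using assms
proof (induction "nat K + nat (d - c + 1)" arbitrary: K a c rule: less_induct)
  case less
  show ?case
  proof (cases "K = d - c + 1")
    case True
    show ?thesis by (rule Phi_square_eq_1) (use less.prems True in \<open>auto simp: hexagon_def\<close>)
  next
    case False
    show ?thesis
    proof (cases "K = 0")
      case True
      then have "hexagon K a b c d = {}" using less.prems by (auto simp: hexagon_def)
      then show ?thesis using True by (simp add: Phi_def path_det_def)
    next
      case nonzero: False
      have "Phi A K a b c d * Phi A (K - 1) (a + 1) b (c + 1) d =
        Phi A (K - 1) a b (c + 1) d * Phi A K (a + 1) b c d +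
        Phi A (K - 1) (a + 1) b c d * Phi A K a b (c + 1) d"
        by (rule Phi_octahedron_square) (use less.prems False nonzero in auto)
      moreover have "Phi A K (a + 1) b c d = 0" using less.prems nonzero by (intro Phi_eq_0) auto
      moreover have "Phi A (K - 1) (a + 1) b (c + 1) d = 1"
        by (rule less.hyps) (use less.prems False nonzero in auto)
      moreover have "Phi A (K - 1) (a + 1) b c d = 1"
        by (rule less.hyps) (use less.prems False nonzero in auto)
      moreover have "Phi A K a b (c + 1) d = 1"
        by (rule less.hyps) (use less.prems False nonzero in auto)
      ultimately show ?thesis by simp
    qed
  qed
qed

lemma Phi_full_height_eq_1:
  assumes "0 \<le> K" "K \<le> b - a + 1" "K = d - c + 1"
    and "\<And>u v. a \<le> u \<Longrightarrow> u \<le> b \<Longrightarrow> c \<le> v \<Longrightarrow> v \<le> d \<Longrightarrow> A (u, v) \<noteq> 0"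
  shows "Phi A K a b c d = 1"
proof -
  have "Phi (\<lambda>p. A (prod.swap p)) K c d a b = 1"
    by (rule Phi_full_width_eq_1) (use assms in auto)
  then show ?thesis by (simp add: Phi_swap)
qed

text \<open>The relation at the lower corner, reflected in the origin.\<close>

lemma Phi_octahedron_square_upper:
  assumes K: "1 \<le> K" "K \<le> b - a + 1" "K \<le> d - c + 1" "\<not> (K = b - a + 1 \<and> K = d - c + 1)"
    and nz: "\<And>u v. a \<le> u \<Longrightarrow> u \<le> b \<Longrightarrow> c \<le> v \<Longrightarrow> v \<le> d \<Longrightarrow> A (u, v) \<noteq> 0"
  shows "Phi A K a b c d * Phi A (K - 1) a (b - 1) c (d - 1) =
    Phi A (K - 1) a b c (d - 1) * Phi A K a (b - 1) c d +
    Phi A (K - 1) a (b - 1) c d * Phi A K a b c (d - 1)"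
proof -
  let ?A = "\<lambda>p. A (- fst p, - snd p)"
  have "Phi ?A K (- b) (- a) (- d) (- c) * Phi ?A (K - 1) (- b + 1) (- a) (- d + 1) (- c) =
    Phi ?A (K - 1) (- b) (- a) (- d + 1) (- c) * Phi ?A K (- b + 1) (- a) (- d) (- c) +
    Phi ?A (K - 1) (- b + 1) (- a) (- d) (- c) * Phi ?A K (- b) (- a) (- d + 1) (- c)"
    by (rule Phi_octahedron_square) (use K nz in auto)
  then show ?thesis by (simp add: Phi_uminus)
qed

lemma Phi_octahedron_dodgson_swap:
  assumes "a \<le> b" and K: "0 \<le> K" "K \<le> b - a + 1" "K \<le> d - c + 1" "\<not> (K = b - a + 1 \<and> K = d - c + 1)"
    and nz: "\<And>u v. a \<le> u \<Longrightarrow> u \<le> b + 1 \<Longrightarrow> c \<le> v \<Longrightarrow> v \<le> d \<Longrightarrow> A (u, v) \<noteq> 0"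
  shows "Phi A K a b c d * Phi A K (a + 1) (b + 1) c d =
    (if K = 0 then 0 else Phi A (K - 1) (a + 1) b c d * Phi A (K + 1) a (b + 1) c d) +
    Phi A K a (b + 1) c d * Phi A K (a + 1) b c d"
  using Phi_octahedron_dodgson[of a b K d c "\<lambda>p. A (prod.swap p)"] assms
  by (simp add: Phi_swap[of A] conj_commute)

section \<open>Rowmotion as a recurrence in time\<close>

text \<open>The value 1 at \<open>(0, 0)\<close> is the label of \<open>Bot\<close>; in
  \<open>upper_sum\<close> the value 1 at \<open>(r, s)\<close> comes from
  \<open>Top\<close>.\<close>

definition lower_sum :: "(int \<times> int \<Rightarrow> 'f::field) \<Rightarrow> int \<Rightarrow> int \<Rightarrow> 'f" where
  "lower_sum g i j = (if i = 0 \<and> j = 0 then 1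
     else (if 0 < i then g (i - 1, j) else 0) + (if 0 < j then g (i, j - 1) else 0))"

definition upper_sum :: "int \<Rightarrow> int \<Rightarrow> (int \<times> int \<Rightarrow> 'f::field) \<Rightarrow> int \<Rightarrow> int \<Rightarrow> 'f" where
  "upper_sum r s g i j = (if i = r \<and> j = s then 1
     else (if i < r then 1 / g (i + 1, j) else 0) + (if j < s then 1 / g (i, j + 1) else 0))"

lemma covered_by_El_El:
  "covered_by r s (El p) (El q) \<longleftrightarrow> p \<in> rect r s \<and> q \<in> rect r s \<and> q \<in> {east p, north p}"
proof
  assume cov: "covered_by r s (El p) (El q)"
  then have pq: "p \<in> rect r s" "q \<in> rect r s" "less_pt p q"
    and nb: "\<And>u. u \<in> rect r s \<Longrightarrow> \<not> (less_pt p u \<and> less_pt u q)"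
    by (auto simp: covered_by_def hat_poset_def)
  \<comment> \<open>The first step from \<open>p\<close> towards \<open>q\<close> stays in the
    rectangle, so it must already be \<open>q\<close>.\<close>
  define c where "c = (if fst p < fst q then east p else north p)"
  have c: "c \<in> rect r s" "less_pt p c" "le_pt c q" "c \<in> {east p, north p}"
    using pq by (auto simp: c_def rect_def less_pt_def le_pt_def east_def north_def prod_eq_iff)
  then have "c = q" using nb[of c] by (auto simp: less_pt_def)
  then show "p \<in> rect r s \<and> q \<in> rect r s \<and> q \<in> {east p, north p}" using pq c by simp
next
  assume "p \<in> rect r s \<and> q \<in> rect r s \<and> q \<in> {east p, north p}"
  moreover from this have "less_pt p q" "\<not> (less_pt p u \<and> less_pt u q)" for u
    by (auto simp: less_pt_def le_pt_def east_def north_def prod_eq_iff)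
  ultimately show "covered_by r s (El p) (El q)"
    by (auto simp: covered_by_def hat_poset_def)
qed

lemma covered_by_Bot_El:
  assumes "0 \<le> r" "0 \<le> s"
  shows "covered_by r s Bot (El q) \<longleftrightarrow> q = (0, 0)"
proof
  assume cov: "covered_by r s Bot (El q)"
  have "El (0, 0) \<in> hat_poset r s" using assms by (auto simp: hat_poset_def rect_def)
  then have "\<not> less_pt (0, 0) q" using cov by (auto simp: covered_by_def)
  moreover have "q \<in> rect r s" using cov by (auto simp: covered_by_def hat_poset_def)
  ultimately show "q = (0, 0)" by (auto simp: less_pt_def le_pt_def rect_def)
next
  assume "q = (0, 0)"
  then show "covered_by r s Bot (El q)"
    using assms by (auto simp: covered_by_def hat_poset_def rect_def less_pt_def le_pt_def)
qed

lemma covered_by_El_Top: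
  assumes "0 \<le> r" "0 \<le> s"
  shows "covered_by r s (El q) Top \<longleftrightarrow> q = (r, s)"
proof
  assume cov: "covered_by r s (El q) Top"
  have "El (r, s) \<in> hat_poset r s" using assms by (auto simp: hat_poset_def rect_def)
  then have "\<not> less_pt q (r, s)" using cov by (auto simp: covered_by_def)
  moreover have "q \<in> rect r s" using cov by (auto simp: covered_by_def hat_poset_def)
  ultimately show "q = (r, s)" by (auto simp: less_pt_def le_pt_def rect_def)
next
  assume "q = (r, s)"
  then show "covered_by r s (El q) Top"
    using assms by (auto simp: covered_by_def hat_poset_def rect_def less_pt_def le_pt_def)
qed

lemma not_covered_by [simp]: "\<not> covered_by r s Top x" "\<not> covered_by r s x Bot"
  by (auto simp: covered_by_def) (metis less_hat.simps hat.exhaust)+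

lemma sum_lower_covers:
  assumes "(i, j) \<in> rect r s" "f Bot = 1"
  shows "(\<Sum>w | covered_by r s w (El (i, j)). f w) = lower_sum (\<lambda>p. f (El p)) i j"
proof -
  have rs: "0 \<le> r" "0 \<le> s" "0 \<le> i" "0 \<le> j" "i \<le> r" "j \<le> s" using assms(1) by (auto simp: rect_def)
  have "covered_by r s w (El (i, j)) \<longleftrightarrow> w \<in> (if i = 0 \<and> j = 0 then {Bot} else {}) \<union>
     (if 0 < i then {El (i - 1, j)} else {}) \<union> (if 0 < j then {El (i, j - 1)} else {})" for w
  proof (cases w)
    case (El p)
    then show ?thesis using rs assms(1)
      by (cases p) (auto simp: covered_by_El_El rect_def east_def north_def)
  qed (use rs in \<open>auto simp: covered_by_Bot_El\<close>)
  then have "{w. covered_by r s w (El (i, j))} = (if i = 0 \<and> j = 0 then {Bot} else {}) \<union>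
     (if 0 < i then {El (i - 1, j)} else {}) \<union> (if 0 < j then {El (i, j - 1)} else {})"
    by blast
  then show ?thesis using rs assms(2) by (simp add: lower_sum_def)
qed

lemma sum_upper_covers:
  assumes "(i, j) \<in> rect r s" "f Top = 1"
  shows "(\<Sum>z | covered_by r s (El (i, j)) z. 1 / f z) = upper_sum r s (\<lambda>p. f (El p)) i j"
proof -
  have rs: "0 \<le> r" "0 \<le> s" "0 \<le> i" "0 \<le> j" "i \<le> r" "j \<le> s" using assms(1) by (auto simp: rect_def)
  have "covered_by r s (El (i, j)) z \<longleftrightarrow> z \<in> (if i = r \<and> j = s then {Top} else {}) \<union>
     (if i < r then {El (i + 1, j)} else {}) \<union> (if j < s then {El (i, j + 1)} else {})" for z
  proof (cases z)
    case (El p)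
    then show ?thesis using rs assms(1)
      by (cases p) (auto simp: covered_by_El_El rect_def east_def north_def)
  qed (use rs in \<open>auto simp: covered_by_El_Top\<close>)
  then have "{z. covered_by r s (El (i, j)) z} = (if i = r \<and> j = s then {Top} else {}) \<union>
     (if i < r then {El (i + 1, j)} else {}) \<union> (if j < s then {El (i, j + 1)} else {})"
    by blast
  then show ?thesis using rs assms(2) by (simp add: upper_sum_def)
qed

section \<open>Composed toggles as an implicit recursion\<close>

lemma toggles_Nil [simp]: "toggles r s [] f = f"
  and toggles_Cons: "toggles r s (v # vs) f = toggle r s v (toggles r s vs f)"
  by (simp_all add: toggles_def)

lemma toggle_other: "x \<noteq> El v \<Longrightarrow> toggle r s v f x = f x"
  by (simp add: toggle_def)

lemma toggles_other: "x \<notin> El ` set vs \<Longrightarrow> toggles r s vs f x = f x"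
  by (induction vs) (auto simp: toggles_Cons toggle_other)

lemma covered_by_less_pt: "covered_by r s (El p) (El q) \<Longrightarrow> less_pt p q"
  by (auto simp: covered_by_def)

lemma not_covered_by_self: "\<not> covered_by r s (El p) (El p)"
  by (auto simp: covered_by_def less_pt_def)

text \<open>When \<open>v\<close> is toggled, its upper covers have their final values and its lower
  covers are untouched. In \<open>toggles_ascending\<close> the roles are exchanged.\<close>

lemma toggles_descending:
  assumes "sorted_wrt (\<lambda>p q. p \<noteq> q \<and> \<not> less_pt q p) vs" "v \<in> set vs"
  shows "toggles r s vs f (El v) = 1 / f (El v) *
    ((\<Sum>w | covered_by r s w (El v). f w) / (\<Sum>z | covered_by r s (El v) z. 1 / toggles r s vs f z))"
  using assms
proof (induction vs)
  case (Cons u vs)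
  let ?g = "toggles r s vs f" and ?h = "toggles r s (u # vs) f"
  have h: "?h x = ?g x" if "x \<noteq> El u" for x using that by (simp add: toggles_Cons toggle_other)
  show ?case
  proof (cases "v = u")
    case True
    have "?h (El v) = 1 / ?g (El v) *
      ((\<Sum>w | covered_by r s w (El v). ?g w) / (\<Sum>z | covered_by r s (El v) z. 1 / ?g z))"
      by (simp add: toggles_Cons toggle_def True)
    also have "?g (El v) = f (El v)"
      using Cons.prems(1) True by (intro toggles_other) auto
    also have "(\<Sum>w | covered_by r s w (El v). ?g w) = (\<Sum>w | covered_by r s w (El v). f w)"
    proof (intro sum.cong refl toggles_other)
      fix w assume "w \<in> {w. covered_by r s w (El v)}"
      then show "w \<notin> El ` set vs" using Cons.prems(1) True by (auto dest: covered_by_less_pt)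
    qed
    also have "(\<Sum>z | covered_by r s (El v) z. 1 / ?g z) = (\<Sum>z | covered_by r s (El v) z. 1 / ?h z)"
      using True by (intro sum.cong refl) (subst h, auto simp: not_covered_by_self)
    finally show ?thesis .
  next
    case False
    then have v: "v \<in> set vs" using Cons.prems(2) by simp
    have "\<not> covered_by r s (El v) (El u)"
      using Cons.prems(1) v by (auto dest: covered_by_less_pt)
    then have "(\<Sum>z | covered_by r s (El v) z. 1 / ?h z) = (\<Sum>z | covered_by r s (El v) z. 1 / ?g z)"
      by (intro sum.cong refl) (subst h, auto)
    then show ?thesis using Cons v False h by simp
  qed
qed simp

lemma toggles_ascending:
  assumes "sorted_wrt (\<lambda>p q. p \<noteq> q \<and> \<not> less_pt p q) vs" "v \<in> set vs"
  shows "toggles r s vs f (El v) = 1 / f (El v) *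
    ((\<Sum>w | covered_by r s w (El v). toggles r s vs f w) / (\<Sum>z | covered_by r s (El v) z. 1 / f z))"
  using assms
proof (induction vs)
  case (Cons u vs)
  let ?g = "toggles r s vs f" and ?h = "toggles r s (u # vs) f"
  have h: "?h x = ?g x" if "x \<noteq> El u" for x using that by (simp add: toggles_Cons toggle_other)
  show ?case
  proof (cases "v = u")
    case True
    have "?h (El v) = 1 / ?g (El v) *
      ((\<Sum>w | covered_by r s w (El v). ?g w) / (\<Sum>z | covered_by r s (El v) z. 1 / ?g z))"
      by (simp add: toggles_Cons toggle_def True)
    also have "?g (El v) = f (El v)"
      using Cons.prems(1) True by (intro toggles_other) auto
    also have "(\<Sum>z | covered_by r s (El v) z. 1 / ?g z) = (\<Sum>z | covered_by r s (El v) z. 1 / f z)"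
    proof (intro sum.cong refl arg_cong[where f = "\<lambda>x. 1 / x"] toggles_other)
      fix z assume "z \<in> {z. covered_by r s (El v) z}"
      then show "z \<notin> El ` set vs" using Cons.prems(1) True by (auto dest: covered_by_less_pt)
    qed
    also have "(\<Sum>w | covered_by r s w (El v). ?g w) = (\<Sum>w | covered_by r s w (El v). ?h w)"
      using True by (intro sum.cong refl) (subst h, auto simp: not_covered_by_self)
    finally show ?thesis .
  next
    case False
    then have v: "v \<in> set vs" using Cons.prems(2) by simp
    have "\<not> covered_by r s (El u) (El v)"
      using Cons.prems(1) v by (auto dest: covered_by_less_pt)
    then have "(\<Sum>w | covered_by r s w (El v). ?h w) = (\<Sum>w | covered_by r s w (El v). ?g w)"
      by (intro sum.cong refl) (subst h, auto)
    then show ?thesis using Cons v False h by simp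
  qed
qed simp

lemma linear_extension_sorted:
  assumes "linear_extension r s vs"
  shows "sorted_wrt (\<lambda>p q. p \<noteq> q \<and> \<not> less_pt q p) vs"
    and "sorted_wrt (\<lambda>p q. p \<noteq> q \<and> \<not> less_pt p q) (rev vs)"
proof -
  show *: "sorted_wrt (\<lambda>p q. p \<noteq> q \<and> \<not> less_pt q p) vs"
    unfolding sorted_wrt_iff_nth_less
  proof (intro allI impI)
    fix a b assume ab: "a < b" "b < length vs"
    then have "vs ! a \<noteq> vs ! b"
      using assms by (auto simp: linear_extension_def nth_eq_iff_index_eq)
    moreover have "\<not> less_pt (vs ! b) (vs ! a)"
      using assms ab unfolding linear_extension_def by (meson less_trans less_asym)
    ultimately show "vs ! a \<noteq> vs ! b \<and> \<not> less_pt (vs ! b) (vs ! a)" by simp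
  qed
  then show "sorted_wrt (\<lambda>p q. p \<noteq> q \<and> \<not> less_pt p q) (rev vs)"
    unfolding sorted_wrt_rev by (simp add: eq_commute)
qed

lemma rowmotion_power_step:
  "0 \<le> n \<Longrightarrow> rowmotion_power r s vs (n + 1) f = toggles r s vs (rowmotion_power r s vs n f)"
  "n \<le> 0 \<Longrightarrow> rowmotion_power r s vs (n - 1) f = toggles r s (rev vs) (rowmotion_power r s vs n f)"
proof -
  assume "0 \<le> n"
  then have "nat (n + 1) = Suc (nat n)" by simp
  then show "rowmotion_power r s vs (n + 1) f = toggles r s vs (rowmotion_power r s vs n f)"
    using \<open>0 \<le> n\<close> by (simp add: rowmotion_power_def)
next
  assume "n \<le> 0"
  then have "nat (- (n - 1)) = Suc (nat (- n))" by simp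
  then show "rowmotion_power r s vs (n - 1) f = toggles r s (rev vs) (rowmotion_power r s vs n f)"
    using \<open>n \<le> 0\<close> by (cases "n = 0") (simp_all add: rowmotion_power_def)
qed

lemma rowmotion_power_other:
  assumes "x \<notin> El ` set vs" shows "rowmotion_power r s vs n f x = f x"
proof -
  have "(toggles r s ws ^^ m) f x = f x" if "set ws = set vs" for m ws
    using assms that by (induction m) (simp_all add: toggles_other)
  then show ?thesis by (simp add: rowmotion_power_def)
qed

lemma rho_0: "rho r s vs 0 p = X p"
  by (simp add: rho_def rowmotion_power_def)

context
  fixes r s :: int and vs :: "(int \<times> int) list"
  assumes le: "linear_extension r s vs"
begin

lemma rowmotion_power_Bot_Top [simp]:
  "rowmotion_power r s vs n generic_labeling Bot = 1"
  "rowmotion_power r s vs n generic_labeling Top = 1"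
  by (subst rowmotion_power_other; force)+

lemma rho_step:
  assumes "0 \<le> n" "(i, j) \<in> rect r s"
  shows "rho r s vs (n + 1) (i, j) = 1 / rho r s vs n (i, j) *
    (lower_sum (rho r s vs n) i j / upper_sum r s (rho r s vs (n + 1)) i j)"
proof -
  have "(i, j) \<in> set vs" using le assms(2) by (simp add: linear_extension_def)
  note * = toggles_descending[OF linear_extension_sorted(1)[OF le] this]
  have "rho r s vs (n + 1) (i, j) = 1 / rho r s vs n (i, j) *
    ((\<Sum>w | covered_by r s w (El (i, j)). rowmotion_power r s vs n generic_labeling w) /
    (\<Sum>z | covered_by r s (El (i, j)) z. 1 / rowmotion_power r s vs (n + 1) generic_labeling z))"
    unfolding rho_def rowmotion_power_step(1)[OF assms(1)] by (rule *)
  then show ?thesis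
    unfolding sum_lower_covers[OF assms(2), of "rowmotion_power r s vs (n) generic_labeling", OF rowmotion_power_Bot_Top(1)]
      sum_upper_covers[OF assms(2), of "rowmotion_power r s vs (n + 1) generic_labeling", OF rowmotion_power_Bot_Top(2)] by (simp add: rho_def[abs_def])
qed

text \<open>The equation of \<open>rho_step\<close> between times \<open>n - 1\<close> and
  \<open>n\<close>, solved for the earlier label. It is read off from the reversed composition of
  toggles, so no label has to be cancelled.\<close>

lemma rho_step_back:
  assumes "n \<le> 0" "(i, j) \<in> rect r s"
  shows "rho r s vs (n - 1) (i, j) = 1 / rho r s vs n (i, j) *
    (lower_sum (rho r s vs (n - 1)) i j / upper_sum r s (rho r s vs n) i j)"
proof -
  have "(i, j) \<in> set (rev vs)" using le assms(2) by (simp add: linear_extension_def)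
  note * = toggles_ascending[OF linear_extension_sorted(2)[OF le] this]
  have "rho r s vs (n - 1) (i, j) = 1 / rho r s vs n (i, j) *
    ((\<Sum>w | covered_by r s w (El (i, j)). rowmotion_power r s vs (n - 1) generic_labeling w) /
    (\<Sum>z | covered_by r s (El (i, j)) z. 1 / rowmotion_power r s vs n generic_labeling z))"
    unfolding rho_def rowmotion_power_step(2)[OF assms(1)] by (rule *)
  then show ?thesis
    unfolding sum_lower_covers[OF assms(2), of "rowmotion_power r s vs (n - 1) generic_labeling", OF rowmotion_power_Bot_Top(1)]
      sum_upper_covers[OF assms(2), of "rowmotion_power r s vs (n) generic_labeling", OF rowmotion_power_Bot_Top(2)] by (simp add: rho_def[abs_def])
qed

end

section \<open>The solution of the recurrence\<close>

text \<open>Chosen such that the numerator of the formula for \<open>\<rho>\<^sup>k\<^sup>+\<^sup>1(i, j)\<close> is \<open>tau r s k i j\<close> and the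
  denominator is \<open>tau r s (k + 1) (i + 1) (j + 1)\<close>. The recurrence of rowmotion then reduces to a
  single octahedron relation for \<open>tau\<close>.\<close>

definition tau :: "int \<Rightarrow> int \<Rightarrow> int \<Rightarrow> int \<Rightarrow> int \<Rightarrow> 'k::field ratfun" where
  "tau r s k i j = (if k < M_val k i j then 0 else
     Phi A_var (k - M_val k i j) (pos_part (i - k)) (r - pos_part (k - j))
       (pos_part (j - k)) (s - pos_part (k - i)))"

lemma pos_part_simps [simp]: "0 \<le> x \<Longrightarrow> pos_part x = x" "x \<le> 0 \<Longrightarrow> pos_part x = 0"
  by (simp_all add: pos_part_def)

text \<open>While \<open>k <= i\<close> the western side is \<open>i - k\<close>; afterwards it
  stays at 0 and the northern side recedes to \<open>s - k + i\<close>. Likewise \<open>j\<close>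
  governs the southern and then the eastern side. The regimes overlap where \<open>k = i\<close> or
  \<open>k = j\<close>.\<close>

lemma tau_cases:
  "0 \<le> k \<Longrightarrow> k \<le> i \<Longrightarrow> k \<le> j \<Longrightarrow> tau r s k i j = Phi A_var k (i - k) r (j - k) s"
  "0 \<le> i \<Longrightarrow> i \<le> k \<Longrightarrow> k \<le> j \<Longrightarrow> tau r s k i j = Phi A_var i 0 r (j - k) (s - k + i)"
  "0 \<le> j \<Longrightarrow> k \<le> i \<Longrightarrow> j \<le> k \<Longrightarrow> tau r s k i j = Phi A_var j (i - k) (r - k + j) 0 s"
  "i \<le> k \<Longrightarrow> j \<le> k \<Longrightarrow> k \<le> i + j \<Longrightarrow>
     tau r s k i j = Phi A_var (i + j - k) 0 (r - k + j) 0 (s - k + i)"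
  by (auto simp: tau_def M_val_def algebra_simps)

text \<open>This supplies the zero contributions of missing lower covers.\<close>

lemma tau_eq_0: "0 \<le> k \<Longrightarrow> i < 0 \<or> j < 0 \<Longrightarrow> tau r s k i j = 0"
  by (auto simp: tau_def M_val_def pos_part_def)

lemma A_var_pair_nonzero: "0 \<le> u \<Longrightarrow> 0 \<le> v \<Longrightarrow> (A_var (u, v) :: 'k::field ratfun) \<noteq> 0"
  using A_var_nonzero[of "(u, v)"] by simp

text \<open>The overlaps in \<open>tau_cases\<close> place all six terms in one regime. There either
  the lower corner moves, or two opposite sides, or the upper corner, which selects the square, the
  Dodgson or the reflected square relation.\<close>

lemma tau_octahedron:
  assumes "1 \<le> k" "0 \<le> i" "i \<le> r + 1" "0 \<le> j" "j \<le> s + 1" "k \<le> i + j"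
    and "\<not> (i = r + 1 \<and> j = s + 1)" "i = 0 \<Longrightarrow> j \<le> s" "j = 0 \<Longrightarrow> i \<le> r"
  shows "tau r s (k - 1) (i - 1) j * tau r s k (i + 1) j + tau r s (k - 1) i (j - 1) * tau r s k i (j + 1) =
    (tau r s k i j * tau r s (k - 1) i j :: 'k::field ratfun)"
proof -
  consider (le_le) "k \<le> i" "k \<le> j" | (gt_le) "i < k" "k \<le> j" | (le_gt) "k \<le> i" "j < k" | (gt_gt) "i < k" "j < k"
    by linarith
  then show ?thesis
  proof cases
    case le_le
    have "Phi (A_var :: _ \<Rightarrow> 'k ratfun) k (i - k) r (j - k) s * Phi A_var (k - 1) (i - k + 1) r (j - k + 1) s =
      Phi A_var (k - 1) (i - k) r (j - k + 1) s * Phi A_var k (i - k + 1) r (j - k) s +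
      Phi A_var (k - 1) (i - k + 1) r (j - k) s * Phi A_var k (i - k) r (j - k + 1) s"
      by (rule Phi_octahedron_square; (intro A_var_pair_nonzero)?; use assms le_le in linarith)
    then show ?thesis using assms le_le by (simp add: tau_cases(1) algebra_simps)
  next
    case gt_le
    have "Phi (A_var :: _ \<Rightarrow> 'k ratfun) i 0 r (j - k) (s - k + i) * Phi A_var i 0 r (j - k + 1) (s - k + i + 1) =
      (if i = 0 then 0 else Phi A_var (i - 1) 0 r (j - k + 1) (s - k + i) * Phi A_var (i + 1) 0 r (j - k) (s - k + i + 1)) +
      Phi A_var i 0 r (j - k) (s - k + i + 1) * Phi A_var i 0 r (j - k + 1) (s - k + i)"
      by (rule Phi_octahedron_dodgson; (intro A_var_pair_nonzero)?; use assms gt_le in linarith)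
    moreover have "tau r s (k - 1) (i - 1) j =
        (if i = 0 then 0 else Phi A_var (i - 1) 0 r (j - k + 1) (s - k + i) :: 'k ratfun)"
      using assms gt_le by (simp add: tau_cases(2) tau_eq_0 algebra_simps)
    ultimately show ?thesis using assms gt_le
      by (simp add: tau_cases(2) algebra_simps if_distrib[of "\<lambda>t. t * _"] cong: if_cong)
  next
    case le_gt
    have "Phi (A_var :: _ \<Rightarrow> 'k ratfun) j (i - k) (r - k + j) 0 s * Phi A_var j (i - k + 1) (r - k + j + 1) 0 s =
      (if j = 0 then 0 else Phi A_var (j - 1) (i - k + 1) (r - k + j) 0 s * Phi A_var (j + 1) (i - k) (r - k + j + 1) 0 s) +
      Phi A_var j (i - k) (r - k + j + 1) 0 s * Phi A_var j (i - k + 1) (r - k + j) 0 s"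
      by (rule Phi_octahedron_dodgson_swap; (intro A_var_pair_nonzero)?; use assms le_gt in linarith)
    moreover have "tau r s (k - 1) i (j - 1) =
        (if j = 0 then 0 else Phi A_var (j - 1) (i - k + 1) (r - k + j) 0 s :: 'k ratfun)"
      using assms le_gt by (simp add: tau_cases(3) tau_eq_0 algebra_simps)
    ultimately show ?thesis using assms le_gt
      by (simp add: tau_cases(3) algebra_simps if_distrib[of "\<lambda>t. t * _"] cong: if_cong)
  next
    case gt_gt
    let ?K = "i + j - k + 1"
    have "Phi (A_var :: _ \<Rightarrow> 'k ratfun) ?K 0 (r - k + j + 1) 0 (s - k + i + 1) *
        Phi A_var (?K - 1) 0 (r - k + j + 1 - 1) 0 (s - k + i + 1 - 1) =
      Phi A_var (?K - 1) 0 (r - k + j + 1) 0 (s - k + i + 1 - 1) * Phi A_var ?K 0 (r - k + j + 1 - 1) 0 (s - k + i + 1) +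
      Phi A_var (?K - 1) 0 (r - k + j + 1 - 1) 0 (s - k + i + 1) * Phi A_var ?K 0 (r - k + j + 1) 0 (s - k + i + 1 - 1)"
      by (rule Phi_octahedron_square_upper; (intro A_var_pair_nonzero)?; use assms gt_gt in linarith)
    then show ?thesis using assms gt_gt by (simp add: tau_cases(4) algebra_simps)
  qed
qed

lemma tau_nonzero:
  assumes "0 \<le> i" "i \<le> r + 1" "0 \<le> j" "j \<le> s + 1" "0 \<le> k" "k \<le> i + j"
  shows "(tau r s k i j :: 'k::field ratfun) \<noteq> 0"
proof -
  have "k - M_val k i j \<ge> 0" "k - M_val k i j \<le> r - pos_part (k - j) - pos_part (i - k) + 1"
    "k - M_val k i j \<le> s - pos_part (k - i) - pos_part (j - k) + 1"
    "0 \<le> pos_part (i - k)" "0 \<le> pos_part (j - k)"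
    using assms by (auto simp: M_val_def pos_part_def max_def)
  then show ?thesis unfolding tau_def by (simp add: Phi_A_var_nonzero)
qed

text \<open>Just outside the rectangle the number of paths equals the width or the height.\<close>

lemma tau_boundary_eq_1:
  assumes "0 \<le> i" "i \<le> r + 1" "0 \<le> j" "j \<le> s + 1" "0 \<le> k" "k \<le> i + j" "i = r + 1 \<or> j = s + 1"
  shows "(tau r s k i j :: 'k::field ratfun) = 1"
proof -
  let ?K = "k - M_val k i j"
  have *: "?K \<ge> 0" "?K \<le> r - pos_part (k - j) - pos_part (i - k) + 1"
    "?K \<le> s - pos_part (k - i) - pos_part (j - k) + 1"
    "0 \<le> pos_part (i - k)" "0 \<le> pos_part (j - k)"
    using assms by (auto simp: M_val_def pos_part_def max_def)
  have "?K = r - pos_part (k - j) - pos_part (i - k) + 1 \<or> ?K = s - pos_part (k - i) - pos_part (j - k) + 1"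
    using assms by (auto simp: M_val_def pos_part_def max_def)
  then have "Phi (A_var :: _ \<Rightarrow> 'k ratfun) ?K (pos_part (i - k)) (r - pos_part (k - j))
       (pos_part (j - k)) (s - pos_part (k - i)) = 1"
  proof
    assume "?K = r - pos_part (k - j) - pos_part (i - k) + 1"
    then show ?thesis by (intro Phi_full_width_eq_1 A_var_pair_nonzero) (use * in linarith)+
  next
    assume "?K = s - pos_part (k - i) - pos_part (j - k) + 1"
    then show ?thesis by (intro Phi_full_height_eq_1 A_var_pair_nonzero) (use * in linarith)+
  qed
  then show ?thesis using * by (simp add: tau_def)
qed

text \<open>One step further out, more paths are asked for than fit. This accounts for missing upper
  covers.\<close>

lemma tau_beyond_eq_0:
  assumes "0 \<le> r" "0 \<le> s" "0 \<le> i" "0 \<le> j" "0 < k" "k < i + j" "0 < i" "0 < j" "i = r + 2 \<or> j = s + 2"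
  shows "(tau r s k i j :: 'k::field ratfun) = 0"
proof -
  have "k - M_val k i j \<ge> 1"
    "k - M_val k i j > r - pos_part (k - j) - pos_part (i - k) + 1 \<or>
     k - M_val k i j > s - pos_part (k - i) - pos_part (j - k) + 1"
    using assms by (auto simp: M_val_def pos_part_def max_def)
  then show ?thesis unfolding tau_def by (simp add: Phi_eq_0)
qed

text \<open>Without paths, \<open>tau r s 0 i j\<close> is the product of \<open>A_var\<close> over
  all points from \<open>(i, j)\<close> upwards, so the four products differ by the corner. This is
  the initial condition.\<close>

lemma tau_0_product:
  assumes "0 \<le> i" "i \<le> r" "0 \<le> j" "j \<le> s"
  shows "tau r s 0 i j * tau r s 0 (i + 1) (j + 1) =
    (tau r s 0 (i + 1) j * tau r s 0 i (j + 1) * A_var (i, j) :: 'k::field ratfun)"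
proof -
  have "mset_set (hexagon 0 i r j s) + mset_set (hexagon 0 (i + 1) r (j + 1) s) =
    mset_set (hexagon 0 (i + 1) r j s) + mset_set (hexagon 0 i r (j + 1) s) + mset_set {(i, j)}"
    by (rule mset_set_pair_eqI)
      (use assms in \<open>simp_all only: mem_hexagon finite_hexagon insert_iff empty_iff prod.inject finite.intros, smt+\<close>)
  from prod_eq_of_mset_eq[OF this, of A_var] show ?thesis
    using assms by (simp add: tau_cases(1) Phi_def path_det_def)
qed

lemma lower_sum_X:
  assumes "0 \<le> i" "0 \<le> j"
  shows "lower_sum X i j = (A_var (i, j) * X (i, j) :: 'k::field ratfun)"
proof -
  consider "1 \<le> i" "1 \<le> j" | "1 \<le> i" "j = 0" | "i = 0" "1 \<le> j" | "i = 0" "j = 0" using assms by linarith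
  then show ?thesis by cases (simp_all add: lower_sum_def A_var_def)
qed

text \<open>The equation defining \<open>A_var\<close> is the last-step recursion for paths with
  weights \<open>1 / A_var\<close>. Paths from the origin therefore recover the
  indeterminates.\<close>

lemma path_sum_A_var:
  assumes "0 \<le> u" "0 \<le> v"
  shows "path_sum (\<lambda>p. 1 / A_var p) (0, 0) (u, v) = (X (u, v) :: 'k::field ratfun)"
  using assms
proof (induction "nat (u + v)" arbitrary: u v rule: less_induct)
  case less
  let ?B = "\<lambda>p. 1 / A_var p :: 'k ratfun"
  show ?case
  proof (cases "u = 0 \<and> v = 0")
    case True
    then show ?thesis by (simp add: path_sum_diag A_var_def)
  next
    case False
    have "path_sum ?B (0, 0) (u, v) = ?B (u, v) * (path_sum ?B (0, 0) (u - 1, v) + path_sum ?B (0, 0) (u, v - 1))"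
    proof -
      have "0 < u + v" using less.prems False by (cases "u = 0") auto
      then show ?thesis using path_sum_last[of "(0, 0)" "(u, v)" ?B] by (simp add: diag_def)
    qed
    also have "path_sum ?B (0, 0) (u - 1, v) = (if 0 < u then X (u - 1, v) else 0)"
      using less by (auto simp: path_sum_not_le le_pt_def)
    also have "path_sum ?B (0, 0) (u, v - 1) = (if 0 < v then X (u, v - 1) else 0)"
      using less by (auto simp: path_sum_not_le le_pt_def)
    also have "(if 0 < u then X (u - 1, v) else 0) + (if 0 < v then X (u, v - 1) else 0) = (lower_sum X u v :: 'k ratfun)"
      using False by (auto simp: lower_sum_def)
    also have "\<dots> = A_var (u, v) * X (u, v)"
      by (rule lower_sum_X[OF less.prems])
    finally show ?thesis using less.prems A_var_pair_nonzero[of u v, where ?'k='k] by simp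
  qed
qed

context
  fixes r s :: int and vs :: "(int \<times> int) list"
  assumes rs: "0 \<le> r" "0 \<le> s" and lin: "linear_extension r s vs"
begin

text \<open>After adding the fractions, the numerator is one side of \<open>tau_octahedron\<close>
  at \<open>(k + 1, i + 1, j + 1)\<close>. That relation excludes the corner \<open>(r, s)\<close>,
  where all four factors are 1.\<close>

lemma upper_sum_tau:
  fixes g :: "int \<times> int \<Rightarrow> 'k::field ratfun"
  assumes ij: "(i, j) \<in> rect r s" and k: "0 \<le> k" "k \<le> i + j"
    and g1: "i < r \<Longrightarrow> g (i + 1, j) = tau r s k (i + 1) j / tau r s (k + 1) (i + 2) (j + 1)"
    and g2: "j < s \<Longrightarrow> g (i, j + 1) = tau r s k i (j + 1) / tau r s (k + 1) (i + 1) (j + 2)"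
  shows "upper_sum r s g i j = tau r s (k + 1) (i + 1) (j + 1) * tau r s k (i + 1) (j + 1) /
    (tau r s k (i + 1) j * tau r s k i (j + 1))"
proof -
  have b: "0 \<le> i" "i \<le> r" "0 \<le> j" "j \<le> s" using ij by (auto simp: rect_def)
  have nz: "tau r s k (i + 1) j \<noteq> (0 :: 'k ratfun)" "tau r s k i (j + 1) \<noteq> (0 :: 'k ratfun)"
    by (rule tau_nonzero; use b k in linarith)+
  show ?thesis
  proof (cases "i = r \<and> j = s")
    case True
    have "tau r s (k + 1) (i + 1) (j + 1) = (1 :: 'k ratfun)" "tau r s k (i + 1) (j + 1) = (1 :: 'k ratfun)"
      "tau r s k (i + 1) j = (1 :: 'k ratfun)" "tau r s k i (j + 1) = (1 :: 'k ratfun)"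
      by (rule tau_boundary_eq_1; use b k True in linarith)+
    then show ?thesis using True by (simp add: upper_sum_def)
  next
    case False
    have "(if i < r then 1 / g (i + 1, j) else 0) = tau r s (k + 1) (i + 2) (j + 1) / tau r s k (i + 1) j"
    proof (cases "i < r")
      case False
      then have "tau r s (k + 1) (i + 2) (j + 1) = (0 :: 'k ratfun)"
        using b k rs by (intro tau_beyond_eq_0) auto
      then show ?thesis using False by simp
    qed (simp add: g1)
    moreover have "(if j < s then 1 / g (i, j + 1) else 0) = tau r s (k + 1) (i + 1) (j + 2) / tau r s k i (j + 1)"
    proof (cases "j < s")
      case False
      then have "tau r s (k + 1) (i + 1) (j + 2) = (0 :: 'k ratfun)"
        using b k rs by (intro tau_beyond_eq_0) auto
      then show ?thesis using False by simp
    qed (simp add: g2)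
    ultimately have "upper_sum r s g i j = tau r s (k + 1) (i + 2) (j + 1) / tau r s k (i + 1) j +
        tau r s (k + 1) (i + 1) (j + 2) / tau r s k i (j + 1)"
      unfolding upper_sum_def if_not_P[OF False] by (simp only:)
    also have "\<dots> = (tau r s k i (j + 1) * tau r s (k + 1) (i + 2) (j + 1) +
        tau r s k (i + 1) j * tau r s (k + 1) (i + 1) (j + 2)) / (tau r s k (i + 1) j * tau r s k i (j + 1))"
      using nz by (simp add: add_frac_eq mult_ac)
    also have "tau r s k i (j + 1) * tau r s (k + 1) (i + 2) (j + 1) +
        tau r s k (i + 1) j * tau r s (k + 1) (i + 1) (j + 2) =
        (tau r s (k + 1) (i + 1) (j + 1) * tau r s k (i + 1) (j + 1) :: 'k ratfun)"
      using tau_octahedron[of "k + 1" "i + 1" r "j + 1" s, where ?'k='k] b k False by (simp add: add.assoc)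
    finally show ?thesis .
  qed
qed

lemma lower_sum_tau:
  fixes g :: "int \<times> int \<Rightarrow> 'k::field ratfun"
  assumes ij: "(i, j) \<in> rect r s" and k: "1 \<le> k" "k \<le> i + j"
    and g1: "0 < i \<Longrightarrow> g (i - 1, j) = tau r s (k - 1) (i - 1) j / tau r s k i (j + 1)"
    and g2: "0 < j \<Longrightarrow> g (i, j - 1) = tau r s (k - 1) i (j - 1) / tau r s k (i + 1) j"
  shows "lower_sum g i j = tau r s k i j * tau r s (k - 1) i j / (tau r s k i (j + 1) * tau r s k (i + 1) j)"
proof -
  have b: "0 \<le> i" "i \<le> r" "0 \<le> j" "j \<le> s" using ij by (auto simp: rect_def)
  have nz: "tau r s k (i + 1) j \<noteq> (0 :: 'k ratfun)" "tau r s k i (j + 1) \<noteq> (0 :: 'k ratfun)"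
    by (rule tau_nonzero; use b k in linarith)+
  have "(if 0 < i then g (i - 1, j) else 0) = tau r s (k - 1) (i - 1) j / tau r s k i (j + 1)"
    using g1 k by (cases "0 < i") (simp_all add: tau_eq_0)
  moreover have "(if 0 < j then g (i, j - 1) else 0) = tau r s (k - 1) i (j - 1) / tau r s k (i + 1) j"
    using g2 k by (cases "0 < j") (simp_all add: tau_eq_0)
  ultimately have "lower_sum g i j = tau r s (k - 1) (i - 1) j / tau r s k i (j + 1) +
      tau r s (k - 1) i (j - 1) / tau r s k (i + 1) j"
    using k by (auto simp: lower_sum_def)
  also have "\<dots> = (tau r s (k - 1) (i - 1) j * tau r s k (i + 1) j + tau r s (k - 1) i (j - 1) * tau r s k i (j + 1)) /
      (tau r s k i (j + 1) * tau r s k (i + 1) j)"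
    using nz by (simp add: add_frac_eq mult_ac)
  also have "tau r s (k - 1) (i - 1) j * tau r s k (i + 1) j + tau r s (k - 1) i (j - 1) * tau r s k i (j + 1) =
      (tau r s k i j * tau r s (k - 1) i j :: 'k ratfun)"
    by (rule tau_octahedron) (use b k in auto)
  finally show ?thesis .
qed

text \<open>Induction on time and, at fixed time, from the top of the rectangle downwards, because
  the recursion uses the new labels of upper covers. The bound \<open>k <= i + j\<close> passes to
  upper covers, and to lower covers one time step earlier.\<close>

lemma rho_eq_tau:
  assumes "0 \<le> k" "(i, j) \<in> rect r s" "k \<le> i + j"
  shows "rho r s vs (k + 1) (i, j) = (tau r s k i j / tau r s (k + 1) (i + 1) (j + 1) :: 'k::field ratfun)"
proof -
  have "\<forall>i j. (i, j) \<in> rect r s \<longrightarrow> k \<le> i + j \<longrightarrow>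
    rho r s vs (k + 1) (i, j) = (tau r s k i j / tau r s (k + 1) (i + 1) (j + 1) :: 'k ratfun)"
    using assms(1)
  proof (induction k rule: int_ge_induct)
    case base
    show ?case
    proof (intro allI impI)
      fix i j assume "(i, j) \<in> rect r s" "0 \<le> i + j"
      then show "rho r s vs (0 + 1) (i, j) = (tau r s 0 i j / tau r s (0 + 1) (i + 1) (j + 1) :: 'k ratfun)"
      proof (induction "nat (r + s - i - j)" arbitrary: i j rule: less_induct)
        case less
        have b: "0 \<le> i" "i \<le> r" "0 \<le> j" "j \<le> s" using less.prems by (auto simp: rect_def)
        have nz: "tau r s 0 (i + 1) (j + 1) \<noteq> (0 :: 'k ratfun)" "tau r s 0 (i + 1) j \<noteq> (0 :: 'k ratfun)"
          "tau r s 0 i (j + 1) \<noteq> (0 :: 'k ratfun)" "tau r s (0 + 1) (i + 1) (j + 1) \<noteq> (0 :: 'k ratfun)"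
          by (rule tau_nonzero; use b in linarith)+
        have "upper_sum r s (rho r s vs (0 + 1)) i j = (tau r s (0 + 1) (i + 1) (j + 1) * tau r s 0 (i + 1) (j + 1) /
          (tau r s 0 (i + 1) j * tau r s 0 i (j + 1)) :: 'k ratfun)"
        proof (rule upper_sum_tau[OF less.prems(1) order_refl less.prems(2)])
          show "rho r s vs (0 + 1) (i + 1, j) = (tau r s 0 (i + 1) j / tau r s (0 + 1) (i + 2) (j + 1) :: 'k ratfun)"
            if "i < r" using less.hyps[of "i + 1" j] b that by (simp add: rect_def add.commute[of 2 i])
          show "rho r s vs (0 + 1) (i, j + 1) = (tau r s 0 i (j + 1) / tau r s (0 + 1) (i + 1) (j + 2) :: 'k ratfun)"
            if "j < s" using less.hyps[of i "j + 1"] b that by (simp add: rect_def add.commute[of 2 j])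
        qed
        moreover have "rho r s vs 0 = (X :: _ \<Rightarrow> 'k ratfun)" by (intro ext rho_0)
        ultimately have "rho r s vs (0 + 1) (i, j) = (1 / X (i, j) * ((A_var (i, j) * X (i, j)) /
            (tau r s (0 + 1) (i + 1) (j + 1) * tau r s 0 (i + 1) (j + 1) / (tau r s 0 (i + 1) j * tau r s 0 i (j + 1)))) :: 'k ratfun)"
          using rho_step[OF lin order_refl less.prems(1), where ?'a='k] by (simp only: lower_sum_X[OF b(1,3)])
        also have "\<dots> = tau r s 0 i j / tau r s (0 + 1) (i + 1) (j + 1)"
          using nz tau_0_product[OF b, where ?'k='k] by (simp add: divide_simps mult_ac)
        finally show ?case .
      qed
    qed
  next
    case (step k)
    show ?case
    proof (intro allI impI)
      fix i j assume "(i, j) \<in> rect r s" "k + 1 \<le> i + j"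
      then show "rho r s vs (k + 1 + 1) (i, j) =
        (tau r s (k + 1) i j / tau r s (k + 1 + 1) (i + 1) (j + 1) :: 'k ratfun)"
      proof (induction "nat (r + s - i - j)" arbitrary: i j rule: less_induct)
        case less
        have b: "0 \<le> i" "i \<le> r" "0 \<le> j" "j \<le> s" using less.prems by (auto simp: rect_def)
        have k: "0 \<le> k" "0 \<le> k + 1" "1 \<le> k + 1" using step by auto
        have nz: "tau r s (k + 1) (i + 1) (j + 1) \<noteq> (0 :: 'k ratfun)" "tau r s (k + 1) (i + 1) j \<noteq> (0 :: 'k ratfun)"
          "tau r s (k + 1) i (j + 1) \<noteq> (0 :: 'k ratfun)" "tau r s (k + 1 + 1) (i + 1) (j + 1) \<noteq> (0 :: 'k ratfun)"
          "tau r s k i j \<noteq> (0 :: 'k ratfun)"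
          by (rule tau_nonzero; use b k less.prems in linarith)+
        have upper_sum: "upper_sum r s (rho r s vs (k + 1 + 1)) i j = (tau r s (k + 1 + 1) (i + 1) (j + 1) * tau r s (k + 1) (i + 1) (j + 1) /
          (tau r s (k + 1) (i + 1) j * tau r s (k + 1) i (j + 1)) :: 'k ratfun)"
        proof (rule upper_sum_tau[OF less.prems(1) k(2) less.prems(2)])
          show "rho r s vs (k + 1 + 1) (i + 1, j) = (tau r s (k + 1) (i + 1) j / tau r s (k + 1 + 1) (i + 2) (j + 1) :: 'k ratfun)"
            if "i < r" using less.hyps[of "i + 1" j] b that less.prems by (simp add: rect_def add.commute[of 2 i])
          show "rho r s vs (k + 1 + 1) (i, j + 1) = (tau r s (k + 1) i (j + 1) / tau r s (k + 1 + 1) (i + 1) (j + 2) :: 'k ratfun)"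
            if "j < s" using less.hyps[of i "j + 1"] b that less.prems by (simp add: rect_def add.commute[of 2 j])
        qed
        have lower_sum: "lower_sum (rho r s vs (k + 1)) i j = (tau r s (k + 1) i j * tau r s (k + 1 - 1) i j /
          (tau r s (k + 1) i (j + 1) * tau r s (k + 1) (i + 1) j) :: 'k ratfun)"
        proof (rule lower_sum_tau[OF less.prems(1) k(3) less.prems(2)])
          show "rho r s vs (k + 1) (i - 1, j) = (tau r s (k + 1 - 1) (i - 1) j / tau r s (k + 1) i (j + 1) :: 'k ratfun)"
            if "0 < i" using step.IH[rule_format, of "i - 1" j] b that less.prems by (simp add: rect_def)
          show "rho r s vs (k + 1) (i, j - 1) = (tau r s (k + 1 - 1) i (j - 1) / tau r s (k + 1) (i + 1) j :: 'k ratfun)"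
            if "0 < j" using step.IH[rule_format, of i "j - 1"] b that less.prems by (simp add: rect_def)
        qed
        have prev: "rho r s vs (k + 1) (i, j) = (tau r s k i j / tau r s (k + 1) (i + 1) (j + 1) :: 'k ratfun)"
          using step.IH less.prems by simp
        have "rho r s vs (k + 1 + 1) (i, j) = (1 / (tau r s k i j / tau r s (k + 1) (i + 1) (j + 1)) *
          (tau r s (k + 1) i j * tau r s (k + 1 - 1) i j / (tau r s (k + 1) i (j + 1) * tau r s (k + 1) (i + 1) j) /
          (tau r s (k + 1 + 1) (i + 1) (j + 1) * tau r s (k + 1) (i + 1) (j + 1) /
          (tau r s (k + 1) (i + 1) j * tau r s (k + 1) i (j + 1)))) :: 'k ratfun)"
          using rho_step[OF lin k(2) less.prems(1), where ?'a='k] unfolding upper_sum lower_sum prev .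
        also have "\<dots> = tau r s (k + 1) i j / tau r s (k + 1 + 1) (i + 1) (j + 1)"
          using nz by (simp add: divide_simps mult_ac)
        finally show ?case .
      qed
    qed
  qed
  then show ?thesis using assms by blast
qed

text \<open>For \<open>k = i + j\<close> numerator and denominator live on the same rectangle, with
  no path and with one path from the origin to \<open>(r - i, s - j)\<close>. Their quotient is the
  reciprocal of a path sum, known from \<open>path_sum_A_var\<close>.\<close>

lemma rho_antipode:
  assumes "(i, j) \<in> rect r s"
  shows "rho r s vs (i + j + 1) (i, j) = (1 / X (r - i, s - j) :: 'k::field ratfun)"
proof -
  have b: "0 \<le> i" "i \<le> r" "0 \<le> j" "j \<le> s" using assms by (auto simp: rect_def)
  let ?P = "prod A_var (hexagon 0 0 (r - i) 0 (s - j)) :: 'k ratfun"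
  have "rho r s vs (i + j + 1) (i, j) =
    (tau r s (i + j) i j / tau r s (i + j + 1) (i + 1) (j + 1) :: 'k ratfun)"
    by (rule rho_eq_tau) (use assms b in auto)
  also have "tau r s (i + j) i j = ?P"
    using b by (simp add: tau_cases(4) Phi_def path_det_def)
  also have "tau r s (i + j + 1) (i + 1) (j + 1) = ?P * X (r - i, s - j)"
  proof -
    have "hexagon 1 0 (r - i) 0 (s - j) = hexagon 0 0 (r - i) 0 (s - j)"
      by (auto simp: hexagon_def)
    moreover have "path_det (\<lambda>p. 1 / A_var p) 1 0 (r - i) 0 (s - j) = (X (r - i, s - j) :: 'k ratfun)"
    proof -
      have "path_det (\<lambda>p. 1 / A_var p) 1 0 (r - i) 0 (s - j) =
          (\<Prod>x<1::nat. 1) * (\<Prod>y<1::nat. 1) * (fdet 1 (\<lambda>x y. X (r - i, s - j)) :: 'k ratfun)"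
        by (rule path_det_as_fdet) (use b in \<open>simp_all add: source_def sink_def path_sum_A_var\<close>)
      then show ?thesis by (simp add: fdet_def det_single)
    qed
    moreover have "tau r s (i + j + 1) (i + 1) (j + 1) = (Phi A_var 1 0 (r - i) 0 (s - j) :: 'k ratfun)"
      using b by (subst tau_cases(4)) simp_all
    ultimately show ?thesis by (simp add: Phi_def)
  qed
  moreover have "?P \<noteq> 0" using A_var_pair_nonzero[where ?'k='k] by (auto simp: mem_hexagon)
  ultimately show ?thesis by simp
qed

section \<open>Reciprocity in both directions of time\<close>

lemma lower_sum_reflect:
  assumes "\<And>a b. (a, b) \<in> {(i - 1, j), (i, j - 1)} \<Longrightarrow> (a, b) \<in> rect r s \<Longrightarrow> g (a, b) = 1 / h (r - a, s - b)"
    and "(i, j) \<in> rect r s"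
  shows "lower_sum g i j = upper_sum r s h (r - i) (s - j)"
  using assms by (auto simp: lower_sum_def upper_sum_def rect_def algebra_simps)

lemma upper_sum_reflect:
  assumes "\<And>a b. (a, b) \<in> {(i + 1, j), (i, j + 1)} \<Longrightarrow> (a, b) \<in> rect r s \<Longrightarrow> g (a, b) = 1 / h (r - a, s - b)"
    and "(i, j) \<in> rect r s"
  shows "upper_sum r s g i j = lower_sum h (r - i) (s - j)"
  using assms by (auto simp: lower_sum_def upper_sum_def rect_def algebra_simps)

text \<open>The recurrence is invariant under \<open>(n, i, j) \<mapsto> (n - i - j - 1, r - i, s - j)\<close> together with
  inversion of the labels, so it suffices to compare the two sides at \<open>n = i + j + 1\<close>. No label has to
  be nonzero in this direction, as both \<open>1 / (x / y) = y / x\<close> and \<open>1 / (1 / x) = x\<close> also hold for \<open>0\<close>.\<close>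

lemma rho_reciprocity_forward:
  assumes "(i, j) \<in> rect r s" "i + j + 1 \<le> n"
  shows "rho r s vs n (i, j) = (1 / rho r s vs (n - i - j - 1) (r - i, s - j) :: 'k::field ratfun)"
  using assms
proof (induction "nat n" arbitrary: n i j rule: less_induct)
  case (less n)
  show ?case using less.prems
  proof (induction "nat (r + s - i - j)" arbitrary: i j rule: less_induct)
    case (less i j)
    note outer = less.prems and IHn = \<open>\<And>m a b. nat m < nat n \<Longrightarrow> (a, b) \<in> rect r s \<Longrightarrow> a + b + 1 \<le> m \<Longrightarrow>
      rho r s vs m (a, b) = 1 / rho r s vs (m - a - b - 1) (r - a, s - b)\<close>
    have b: "0 \<le> i" "i \<le> r" "0 \<le> j" "j \<le> s" using less.prems by (auto simp: rect_def)
    show ?case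
    proof (cases "n = i + j + 1")
      case True
      then show ?thesis using rho_antipode[OF less.prems(1), where ?'k='k] by (simp add: rho_0)
    next
      case False
      define m where "m = n - i - j - 2"
      have m: "0 \<le> m" "n - i - j - 1 = m + 1" using False less.prems by (simp_all add: m_def)
      have v': "(r - i, s - j) \<in> rect r s" using b by (simp add: rect_def)
      have v: "rho r s vs (n - 1) (i, j) = (1 / rho r s vs m (r - i, s - j) :: 'k ratfun)"
        using IHn[of "n - 1" i j] less.prems False b by (simp add: m_def algebra_simps)
      have lower_sum: "lower_sum (rho r s vs (n - 1)) i j = (upper_sum r s (rho r s vs (m + 1)) (r - i) (s - j) :: 'k ratfun)"
      proof (rule lower_sum_reflect[OF _ less.prems(1)])
        fix a b assume ab: "(a, b) \<in> {(i - 1, j), (i, j - 1)}" "(a, b) \<in> rect r s"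
        then have "rho r s vs (n - 1) (a, b) = (1 / rho r s vs (n - 1 - a - b - 1) (r - a, s - b) :: 'k ratfun)"
          using less.prems by (intro IHn) (auto simp: rect_def)
        moreover have "n - 1 - a - b - 1 = m + 1" using ab by (auto simp: m_def)
        ultimately show "rho r s vs (n - 1) (a, b) = (1 / rho r s vs (m + 1) (r - a, s - b) :: 'k ratfun)" by simp
      qed
      have upper_sum: "upper_sum r s (rho r s vs n) i j = (lower_sum (rho r s vs m) (r - i) (s - j) :: 'k ratfun)"
      proof (rule upper_sum_reflect[OF _ less.prems(1)])
        fix a b assume ab: "(a, b) \<in> {(i + 1, j), (i, j + 1)}" "(a, b) \<in> rect r s"
        then have "rho r s vs n (a, b) = (1 / rho r s vs (n - a - b - 1) (r - a, s - b) :: 'k ratfun)"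
          using less.prems False by (intro less.hyps) (auto simp: rect_def)
        moreover have "n - a - b - 1 = m" using ab by (auto simp: m_def)
        ultimately show "rho r s vs n (a, b) = (1 / rho r s vs m (r - a, s - b) :: 'k ratfun)" by simp
      qed
      have "rho r s vs n (i, j) = (1 / rho r s vs (n - 1) (i, j) *
          (lower_sum (rho r s vs (n - 1)) i j / upper_sum r s (rho r s vs n) i j) :: 'k ratfun)"
        using rho_step[OF lin _ less.prems(1), of "n - 1", where ?'a='k] less.prems b by simp
      moreover have "rho r s vs (m + 1) (r - i, s - j) = (1 / rho r s vs m (r - i, s - j) *
          (lower_sum (rho r s vs m) (r - i) (s - j) / upper_sum r s (rho r s vs (m + 1)) (r - i) (s - j)) :: 'k ratfun)"
        by (rule rho_step[OF lin m(1) v'])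
      ultimately show ?thesis unfolding m(2) v lower_sum upper_sum by simp
    qed
  qed
qed

lemma rho_nonzero:
  assumes "(i, j) \<in> rect r s" "1 \<le> n" "n \<le> i + j + 1"
  shows "rho r s vs n (i, j) \<noteq> (0 :: 'k::field ratfun)"
proof -
  have b: "0 \<le> i" "i \<le> r" "0 \<le> j" "j \<le> s" using assms by (auto simp: rect_def)
  have "rho r s vs (n - 1 + 1) (i, j) = (tau r s (n - 1) i j / tau r s (n - 1 + 1) (i + 1) (j + 1) :: 'k ratfun)"
    by (rule rho_eq_tau) (use assms in auto)
  moreover have "tau r s (n - 1) i j \<noteq> (0 :: 'k ratfun)" "tau r s (n - 1 + 1) (i + 1) (j + 1) \<noteq> (0 :: 'k ratfun)"
    by (rule tau_nonzero; use assms b in linarith)+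
  ultimately show ?thesis by simp
qed

text \<open>\<open>d\<close> is the distance in time from the antipodal case; the exponent on the
  left is \<open>- int d\<close>, so the step is made with \<open>rho_step_back\<close>. The inner
  induction runs downwards from the top, since upper covers of \<open>(i, j)\<close> are needed at
  time \<open>n + 1\<close> with the same \<open>d\<close>.\<close>

lemma rho_reciprocity_backward:
  assumes "(i, j) \<in> rect r s" "1 \<le> n" "n + int d = i + j + 1"
  shows "rho r s vs (n - i - j - 1) (r - i, s - j) = (1 / rho r s vs n (i, j) :: 'k::field ratfun)"
  using assms
proof (induction d arbitrary: n i j)
  case 0
  then have "n = i + j + 1" by simp
  then show ?case using rho_antipode[OF 0(1), where ?'k='k] by (simp add: rho_0)
next
  case (Suc d)
  note IHd = Suc.IH
  show ?case using Suc.prems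
  proof (induction "nat (r + s - i - j)" arbitrary: n i j rule: less_induct)
    case (less i j n)
    have b: "0 \<le> i" "i \<le> r" "0 \<le> j" "j \<le> s" using less.prems by (auto simp: rect_def)
    have n: "n \<le> i + j" "n + 1 + int d = i + j + 1" using less.prems(3) by simp_all
      define m where "m = n - i - j"
      have m: "m \<le> 0" "n - i - j - 1 = m - 1" using n by (simp_all add: m_def)
      have v': "(r - i, s - j) \<in> rect r s" using b by (simp add: rect_def)
      have v: "rho r s vs m (r - i, s - j) = (1 / rho r s vs (n + 1) (i, j) :: 'k ratfun)"
        using IHd[OF less.prems(1) _ n(2)] less.prems(2) by (simp add: m_def algebra_simps)
      have lower_sum: "lower_sum (rho r s vs (m - 1)) (r - i) (s - j) = (upper_sum r s (rho r s vs (n + 1)) i j :: 'k ratfun)"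
      proof -
        have "lower_sum (rho r s vs (m - 1)) (r - i) (s - j) = (upper_sum r s (rho r s vs (n + 1)) (r - (r - i)) (s - (s - j)) :: 'k ratfun)"
        proof (rule lower_sum_reflect[OF _ v'])
          fix a b assume ab: "(a, b) \<in> {(r - i - 1, s - j), (r - i, s - j - 1)}" "(a, b) \<in> rect r s"
          have "rho r s vs (n + 1 - (r - a) - (s - b) - 1) (r - (r - a), s - (s - b)) =
            (1 / rho r s vs (n + 1) (r - a, s - b) :: 'k ratfun)"
          proof (rule less.hyps)
            show "nat (r + s - (r - a) - (s - b)) < nat (r + s - i - j)" using ab by (auto simp: rect_def)
            show "(r - a, s - b) \<in> rect r s" using ab by (auto simp: rect_def)
            show "1 \<le> n + 1" using less.prems(2) by simp
            show "n + 1 + int (Suc d) = r - a + (s - b) + 1" using less.prems(3) ab by auto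
          qed
          moreover have "n + 1 - (r - a) - (s - b) - 1 = m - 1" using ab by (auto simp: m_def)
          ultimately show "rho r s vs (m - 1) (a, b) = (1 / rho r s vs (n + 1) (r - a, s - b) :: 'k ratfun)" by simp
        qed
        then show ?thesis by simp
      qed
      have upper_sum: "upper_sum r s (rho r s vs m) (r - i) (s - j) = (lower_sum (rho r s vs n) i j :: 'k ratfun)"
      proof -
        have "upper_sum r s (rho r s vs m) (r - i) (s - j) = (lower_sum (rho r s vs n) (r - (r - i)) (s - (s - j)) :: 'k ratfun)"
        proof (rule upper_sum_reflect[OF _ v'])
          fix a b assume ab: "(a, b) \<in> {(r - i + 1, s - j), (r - i, s - j + 1)}" "(a, b) \<in> rect r s"
          have "rho r s vs (n - (r - a) - (s - b) - 1) (r - (r - a), s - (s - b)) =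
            (1 / rho r s vs n (r - a, s - b) :: 'k ratfun)"
            by (rule IHd) (use ab less.prems(2,3) in \<open>auto simp: rect_def\<close>)
          moreover have "n - (r - a) - (s - b) - 1 = m" using ab by (auto simp: m_def)
          ultimately show "rho r s vs m (a, b) = (1 / rho r s vs n (r - a, s - b) :: 'k ratfun)" by simp
        qed
        then show ?thesis by simp
      qed
      have "rho r s vs (m - 1) (r - i, s - j) = (1 / rho r s vs m (r - i, s - j) *
          (lower_sum (rho r s vs (m - 1)) (r - i) (s - j) / upper_sum r s (rho r s vs m) (r - i) (s - j)) :: 'k ratfun)"
        by (rule rho_step_back[OF lin m(1) v'])
      also have "\<dots> = rho r s vs (n + 1) (i, j) * (upper_sum r s (rho r s vs (n + 1)) i j / lower_sum (rho r s vs n) i j)"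
        unfolding v lower_sum upper_sum by simp
      finally have eq: "rho r s vs (m - 1) (r - i, s - j) =
        (rho r s vs (n + 1) (i, j) * (upper_sum r s (rho r s vs (n + 1)) i j / lower_sum (rho r s vs n) i j) :: 'k ratfun)" .
      have step: "rho r s vs (n + 1) (i, j) = (1 / rho r s vs n (i, j) *
          (lower_sum (rho r s vs n) i j / upper_sum r s (rho r s vs (n + 1)) i j) :: 'k ratfun)"
        by (rule rho_step[OF lin _ less.prems(1)]) (use less.prems(2) in simp)
      \<comment> \<open>By the convention \<open>x / 0 = 0\<close>, a nonzero label at time
        \<open>n + 1\<close> forces both sums in \<open>step\<close> to be nonzero.\<close>
      have "rho r s vs (n + 1) (i, j) \<noteq> (0 :: 'k ratfun)"
        by (rule rho_nonzero) (use less.prems n in auto)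
      then have "lower_sum (rho r s vs n) i j \<noteq> (0 :: 'k ratfun)" "upper_sum r s (rho r s vs (n + 1)) i j \<noteq> (0 :: 'k ratfun)"
        unfolding step by auto
      then show ?case unfolding m(2) eq unfolding step by simp
  qed
qed

end

theorem theorem2p7:
  fixes r s i j k M :: int and vs :: "(int \<times> int) list"
  assumes "r \<ge> 0" and "s \<ge> 0"
    and "linear_extension r s vs"
    and "(i, j) \<in> rect r s"
    and "k \<in> {0..r + s + 1}"
    and "M = M_val k i j"
  shows "(M \<le> k \<longrightarrow>
            (rho r s vs (k + 1) (i, j) :: 'k::field ratfun) =
              mu (pos_part (k - j)) (pos_part (k - i))
                (\<lambda>A. phi r s (k - M) (i - k + M) (j - k + M) A /
                     phi r s (k - M + 1) (i - k + M) (j - k + M) A)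
                A_var) \<and>
         (M \<ge> k \<longrightarrow>
            (rho r s vs (k + 1) (i, j) :: 'k ratfun) =
              1 / rho r s vs (k - i - j) (r - i, s - j) \<and>
            (k - i - j \<ge> 1 \<longrightarrow> M_val (k - i - j - 1) (r - i) (s - j) \<le> k - i - j - 1))"
proof (intro conjI impI)
  have b: "0 \<le> i" "i \<le> r" "0 \<le> j" "j \<le> s" "0 \<le> k" "k \<le> r + s + 1"
    using assms(4,5) by (auto simp: rect_def)
  {
    assume "M \<le> k"
    \<comment> \<open>For \<open>k > i + j\<close> one has
      \<open>M = 2 * k - i - j > k\<close>.\<close>
    then have k: "k \<le> i + j" using b unfolding assms(6) M_val_def pos_part_def by linarith
    let ?a = "pos_part (k - j)" and ?b = "pos_part (k - i)"
    let ?A = "\<lambda>(u, v). A_var (u - ?a, v - ?b) :: 'k ratfun"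
    \<comment> \<open>Since \<open>i - k + pos_part (k - i) = pos_part (i - k)\<close>, the lower
      corner in the theorem is that of \<open>tau\<close> translated by the shift. \<open>M\<close>
      is unchanged when \<open>k\<close>, \<open>i\<close> and \<open>j\<close> all grow by
      1.\<close>
    have M: "i - k + M = pos_part (i - k) + ?a" "j - k + M = pos_part (j - k) + ?b"
      "M_val (k + 1) (i + 1) (j + 1) = M"
      unfolding assms(6) M_val_def pos_part_def by (auto simp: max_def)
    have phi: "phi r s K (i - k + M) (j - k + M) ?A =
        Phi A_var K (pos_part (i - k)) (r - ?a) (pos_part (j - k)) (s - ?b)"
      if K: "K = k - M \<or> K = k - M + 1" for K
    proof -
      have "phi r s K (i - k + M) (j - k + M) ?A = Phi ?A K (i - k + M) r (j - k + M) s"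
      proof (rule phi_eq_Phi)
        show "0 \<le> i - k + M" "0 \<le> j - k + M" unfolding M by (auto simp: pos_part_def)
        show "0 \<le> K" using K \<open>M \<le> k\<close> by auto
        show "K \<le> r - (i - k + M) + 1" "K \<le> s - (j - k + M) + 1"
          using K b k unfolding assms(6) M_val_def pos_part_def by auto
        show "?A p \<noteq> 0" if p: "p \<in> hexagon K (i - k + M) r (j - k + M) s" for p
        proof -
          have "0 \<le> fst p - ?a" "0 \<le> snd p - ?b"
            using p unfolding M by (auto simp: hexagon_def pos_part_def)
          then show ?thesis by (simp add: case_prod_beta A_var_pair_nonzero)
        qed
      qed
      then show ?thesis unfolding Phi_shift M by simp
    qed
    have "rho r s vs (k + 1) (i, j) = (tau r s k i j / tau r s (k + 1) (i + 1) (j + 1) :: 'k ratfun)"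
      by (rule rho_eq_tau) (use assms k b in auto)
    also have "tau r s k i j = phi r s (k - M) (i - k + M) (j - k + M) ?A"
      using phi[of "k - M"] \<open>M \<le> k\<close> by (simp add: tau_def assms(6))
    also have "tau r s (k + 1) (i + 1) (j + 1) = phi r s (k - M + 1) (i - k + M) (j - k + M) ?A"
      using phi[of "k - M + 1"] \<open>M \<le> k\<close> unfolding tau_def M(3) by (simp add: algebra_simps)
    finally show "rho r s vs (k + 1) (i, j) =
      mu (pos_part (k - j)) (pos_part (k - i))
                (\<lambda>A. phi r s (k - M) (i - k + M) (j - k + M) A /
                     phi r s (k - M + 1) (i - k + M) (j - k + M) A)
                (A_var :: _ \<Rightarrow> 'k ratfun)"
      unfolding mu_def .
  }
  assume "M \<ge> k"
  show "rho r s vs (k + 1) (i, j) = (1 / rho r s vs (k - i - j) (r - i, s - j) :: 'k ratfun)"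
  \<comment> \<open>Exponents \<open>k - i - j < 0\<close> do occur: for \<open>j = 0\<close> and
    \<open>k < i\<close>, for instance, one has \<open>M = k\<close>.\<close>
  proof (cases "k \<le> i + j")
    case True
    have "rho r s vs (k + 1 - i - j - 1) (r - i, s - j) = (1 / rho r s vs (k + 1) (i, j) :: 'k ratfun)"
      by (rule rho_reciprocity_backward[where d = "nat (i + j - k)"]) (use assms True b in auto)
    moreover have "k + 1 - i - j - 1 = k - i - j" by simp
    ultimately show ?thesis by (simp only: div_by_1 divide_divide_eq_right mult_1)
  next
    case False
    have "rho r s vs (k + 1) (i, j) = (1 / rho r s vs (k + 1 - i - j - 1) (r - i, s - j) :: 'k ratfun)"
      by (rule rho_reciprocity_forward) (use assms False b in auto)
    moreover have "k + 1 - i - j - 1 = k - i - j" by simp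
    ultimately show ?thesis by (simp only:)
  qed
  \<comment> \<open>This rests on \<open>k <= r + s + 1\<close>, which says that
    \<open>k - i - j - 1\<close> is at most \<open>(r - i) + (s - j)\<close>.\<close>
  show "M_val (k - i - j - 1) (r - i) (s - j) \<le> k - i - j - 1" if "k - i - j \<ge> 1"
    using that b unfolding M_val_def pos_part_def by linarith
qed

end
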